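(* Let $k$ be a number field and let $C_F:\ x^4+y^4+z^4=0$ be the Fermat quartic over $k$. Every diagonal twist of $C_F$ is $k$-isomorphic to a plane curve $$ax^4+by^4+z^4=0$$ with $a,b\in k^{*}$; conversely every such curve is a diagonal twist of $C_F$, and its field of definition is $L=k(i,\sqrt[4]{a},\sqrt[4]{b})$. Two of these twists, $ax^4+by^4+z^4=0$ and $a'x^4+b'y^4+z^4=0$ (with $a,b,a',b'\in k^*$), are equivalent if and only if there exists $m\in k^{*}$ such that $\{a,b,1\}$ and $\{ma',mb',m\}$ are congruent modulo $k^{*4}$, i.e. after a suitable permutation of the three entries, corresponding entries differ by factors in $k^{*4}$.
   Context: Fix an algebraic closure $\bar k$ of $k$, let $G_k=\operatorname{Gal}(\bar k/k)$ and $i=\sqrt{-1}\in\bar k$. A twist of a smooth projective curve $C/k$ is a smooth projective curve $C'/k$ for which there is an isomorphism $\phi:C'\to C$ over $\bar k$; two twists are equivalent if they are isomorphic over $k$. $\operatorname{Aut}(C)$ is the group of automorphisms over $\bar k$ and $K/k$ is the minimal extension over which all automorphisms are defined; for $C_F$, $K=k(i)$ and $\operatorname{Aut}(C_F)$ is viewed as a subgroup of $\operatorname{PGL}_3(K)$. The field of definition $L$ of a twist is the minimal extension of $K$ over which an isomorphism $\phi:C'\to C$ is defined (independent of $\phi$). The cocycle of $\phi$ is $\xi_\sigma=\phi\cdot{}^{\sigma}\phi^{-1}\in\operatorname{Aut}(C)$, $\sigma\in G_k$. A twist $C'$ of $C_F$ is called diagonal if, for some isomorphism $\phi: C'\to C_F$,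 all the $\xi_\sigma$ are given by diagonal matrices (equivalently, the image $G$ of $\sigma\mapsto(\xi_\sigma,\sigma|_K)$ in $\operatorname{Aut}(C_F)\rtimes\operatorname{Gal}(K/k)$ consists of elements whose first component is a diagonal matrix). *)

theory Defs
  imports
    Complex_Main
    "HOL-Computational_Algebra.Polynomial"
    "HOL-Library.Poly_Mapping"
    "HOL-Library.Function_Algebras"
    "HOL-Combinatorics.Permutations"
begin

section \<open>Fields\<close>

text \<open>
  Throughout, the type \<open>'a\<close> plays the role of the algebraic closure of the base field, and
  all fields in sight are subfields of it, represented as sets.
\<close>

definition is_subfield :: "'a::field set \<Rightarrow> bool" where
  "is_subfield E \<longleftrightarrow>
     0 \<in> E \<and> 1 \<in> E \<and> (\<forall>x\<in>E. \<forall>y\<in>E. x - y \<in> E \<and> x * y \<in> E) \<and> (\<forall>x\<in>E. inverse x \<in> E)"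

definition number_field :: "'a::field_char_0 set \<Rightarrow> bool" where
  "number_field k \<longleftrightarrow> is_subfield k \<and>
     (\<exists>B. finite B \<and> B \<subseteq> k \<and> k = {\<Sum>b\<in>B. of_rat (c b) * b | c. True})"

text \<open>Together with the class \<open>alg_closed_field\<close>, the next predicate says that \<open>'a\<close> is an
  algebraic closure of \<open>k\<close>.\<close>

definition algebraic_extension_of :: "'a::field set \<Rightarrow> bool" where
  "algebraic_extension_of k \<longleftrightarrow>
     (\<forall>x. \<exists>p. p \<noteq> 0 \<and> (\<forall>i. coeff p i \<in> k) \<and> poly p x = 0)"

definition field_adjoin :: "'a::field set \<Rightarrow> 'a set \<Rightarrow> 'a set" where
  "field_adjoin k S = \<Inter>{E. is_subfield E \<and> k \<subseteq> E \<and> S \<subseteq> E}"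

definition galois_group :: "'a::field set \<Rightarrow> ('a \<Rightarrow> 'a) set" where
  "galois_group k = {\<sigma>. bij \<sigma> \<and> (\<forall>x y. \<sigma> (x + y) = \<sigma> x + \<sigma> y) \<and>
     (\<forall>x y. \<sigma> (x * y) = \<sigma> x * \<sigma> y) \<and> (\<forall>x\<in>k. \<sigma> x = x)}"

definition is_least_set :: "'b set set \<Rightarrow> 'b set \<Rightarrow> bool" where
  "is_least_set \<E> L \<longleftrightarrow> L \<in> \<E> \<and> (\<forall>E\<in>\<E>. L \<subseteq> E)"


section \<open>Multivariate polynomials\<close>

text \<open>A monomial is its exponent function; the variables are indexed by natural numbers.\<close>

type_synonym 'a mpol = "(nat \<Rightarrow>\<^sub>0 nat) \<Rightarrow>\<^sub>0 'a"

definition mpol_eval :: "'a::comm_semiring_1 mpol \<Rightarrow> (nat \<Rightarrow> 'a) \<Rightarrow> 'a" where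
  "mpol_eval p v = (\<Sum>m\<in>Poly_Mapping.keys p.
     Poly_Mapping.lookup p m * (\<Prod>i\<in>Poly_Mapping.keys m. v i ^ Poly_Mapping.lookup m i))"

definition mpol_pderiv :: "nat \<Rightarrow> 'a::comm_semiring_1 mpol \<Rightarrow> 'a mpol" where
  "mpol_pderiv i p = (\<Sum>m\<in>Poly_Mapping.keys p.
     Poly_Mapping.single (m - Poly_Mapping.single i 1)
       (of_nat (Poly_Mapping.lookup m i) * Poly_Mapping.lookup p m))"

text \<open>Forms of degree \<open>d\<close> in the \<open>n + 1\<close> variables \<open>0, \<dots>, n\<close> with coefficients in \<open>E\<close>.\<close>

definition forms :: "'a::comm_semiring_1 set \<Rightarrow> nat \<Rightarrow> nat \<Rightarrow> 'a mpol set" where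
  "forms E n d = {p. (\<forall>m. Poly_Mapping.lookup p m \<in> E) \<and>
     (\<forall>m\<in>Poly_Mapping.keys p. Poly_Mapping.keys m \<subseteq> {..n} \<and>
       (\<Sum>i\<in>Poly_Mapping.keys m. Poly_Mapping.lookup m i) = d)}"


section \<open>Projective algebraic sets\<close>

text \<open>
  A point of projective \<open>n\<close>-space is the set of all its vectors of homogeneous coordinates; these
  are the nonzero functions on \<open>nat\<close> that vanish above \<open>n\<close>. A variety defined over a subfield is
  given by its set of geometric points, i.e. points with coordinates in \<open>'a\<close>.
\<close>

type_synonym 'a ppoint = "(nat \<Rightarrow> 'a) set"

definition proj_point :: "(nat \<Rightarrow> 'a::field) \<Rightarrow> 'a ppoint" where
  "proj_point v = {\<lambda>i. c * v i | c. c \<noteq> 0}"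

definition proj_space :: "nat \<Rightarrow> 'a::field ppoint set" where
  "proj_space n = {proj_point v | v. (\<exists>i. v i \<noteq> 0) \<and> (\<forall>i>n. v i = 0)}"

text \<open>
  Zero loci of forms with coefficients in \<open>E\<close>. In characteristic \<open>0\<close> these are exactly
  the algebraic sets whose homogeneous ideal is generated by forms with coefficients in \<open>E\<close>.
\<close>

definition proj_closed :: "'a::field set \<Rightarrow> nat \<Rightarrow> 'a ppoint set \<Rightarrow> bool" where
  "proj_closed E n V \<longleftrightarrow> (\<exists>S. S \<subseteq> (\<Union>d. forms E n d) \<and>
     V = {P \<in> proj_space n. \<forall>f\<in>S. \<forall>v\<in>P. mpol_eval f v = 0})"

definition proj_irreducible :: "nat \<Rightarrow> 'a::field ppoint set \<Rightarrow> bool" where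
  "proj_irreducible n V \<longleftrightarrow> proj_closed UNIV n V \<and> V \<noteq> {} \<and>
     (\<forall>A B. proj_closed UNIV n A \<and> proj_closed UNIV n B \<and> V \<subseteq> A \<union> B \<longrightarrow> V \<subseteq> A \<or> V \<subseteq> B)"

definition irreducible_chain :: "nat \<Rightarrow> 'a::field ppoint set \<Rightarrow> nat \<Rightarrow> bool" where
  "irreducible_chain n V d \<longleftrightarrow> (\<exists>Z :: nat \<Rightarrow> 'a ppoint set.
     (\<forall>i\<le>d. proj_irreducible n (Z i) \<and> Z i \<subseteq> V) \<and> (\<forall>i<d. Z i \<subset> Z (Suc i)))"

definition has_dimension :: "nat \<Rightarrow> 'a::field ppoint set \<Rightarrow> nat \<Rightarrow> bool" where
  "has_dimension n V d \<longleftrightarrow> irreducible_chain n V d \<and> \<not> irreducible_chain n V (Suc d)"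

text \<open>The vector space of coordinate vectors, needed only for the rank of Jacobian matrices.\<close>

global_interpretation coord_vs: vector_space "\<lambda>(c::'a::field) (v::nat \<Rightarrow> 'a) i. c * v i"
  by unfold_locales (auto simp: fun_eq_iff algebra_simps)

definition gradient :: "nat \<Rightarrow> 'a::field mpol \<Rightarrow> (nat \<Rightarrow> 'a) \<Rightarrow> nat \<Rightarrow> 'a" where
  "gradient n f v = (\<lambda>i. if i \<le> n then mpol_eval (mpol_pderiv i f) v else 0)"

text \<open>The rank at \<open>v\<close> of the Jacobian matrix of the homogeneous ideal of \<open>V\<close>.\<close>

definition jacobian_rank :: "nat \<Rightarrow> 'a::field ppoint set \<Rightarrow> (nat \<Rightarrow> 'a) \<Rightarrow> nat" where
  "jacobian_rank n V v = coord_vs.dim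
     {gradient n f v | f d. f \<in> forms UNIV n d \<and> (\<forall>P\<in>V. \<forall>w\<in>P. mpol_eval f w = 0)}"

definition smooth_projective_curve :: "'a::field set \<Rightarrow> nat \<Rightarrow> 'a ppoint set \<Rightarrow> bool" where
  "smooth_projective_curve k n C \<longleftrightarrow>
     proj_closed k n C \<and> proj_irreducible n C \<and> has_dimension n C 1 \<and>
     (\<forall>P\<in>C. \<forall>v\<in>P. jacobian_rank n C v + 1 = n)"


section \<open>Morphisms and isomorphisms\<close>

text \<open>
  A morphism from \<open>V\<close> in projective \<open>n\<close>-space to \<open>W\<close> in projective \<open>m\<close>-space, defined over \<open>E\<close>:
  a map of points that is given, near every point of \<open>V\<close>, by \<open>m + 1\<close> forms of equal degree with
  coefficients in \<open>E\<close>. Values outside \<open>V\<close> are irrelevant.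
\<close>

definition morphism_over ::
  "'a::field set \<Rightarrow> nat \<Rightarrow> 'a ppoint set \<Rightarrow> nat \<Rightarrow> 'a ppoint set \<Rightarrow> ('a ppoint \<Rightarrow> 'a ppoint) \<Rightarrow> bool"
where
  "morphism_over E n V m W \<phi> \<longleftrightarrow> \<phi> ` V \<subseteq> W \<and>
     (\<forall>P\<in>V. \<exists>d F. (\<forall>j\<le>m. F j \<in> forms E n d) \<and>
        (\<forall>v\<in>P. \<exists>j\<le>m. mpol_eval (F j) v \<noteq> 0) \<and>
        (\<forall>Q\<in>V. \<forall>v\<in>Q. (\<exists>j\<le>m. mpol_eval (F j) v \<noteq> 0) \<longrightarrow>
           \<phi> Q = proj_point (\<lambda>j. if j \<le> m then mpol_eval (F j) v else 0)))"

definition isomorphism_over ::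
  "'a::field set \<Rightarrow> nat \<Rightarrow> 'a ppoint set \<Rightarrow> nat \<Rightarrow> 'a ppoint set \<Rightarrow> ('a ppoint \<Rightarrow> 'a ppoint) \<Rightarrow> bool"
where
  "isomorphism_over E n V m W \<phi> \<longleftrightarrow> bij_betw \<phi> V W \<and>
     morphism_over E n V m W \<phi> \<and> morphism_over E m W n V (inv_into V \<phi>)"

definition isomorphic_over ::
  "'a::field set \<Rightarrow> nat \<Rightarrow> 'a ppoint set \<Rightarrow> nat \<Rightarrow> 'a ppoint set \<Rightarrow> bool" where
  "isomorphic_over E n V m W \<longleftrightarrow> (\<exists>\<phi>. isomorphism_over E n V m W \<phi>)"


section \<open>Twists\<close>

text \<open>\<open>is_twist k n C' m C\<close>: the curve \<open>C'\<close> in projective \<open>n\<close>-space is a twist of the curve \<open>C\<close>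
  in projective \<open>m\<close>-space, both over \<open>k\<close>.\<close>

definition is_twist ::
  "'a::field set \<Rightarrow> nat \<Rightarrow> 'a ppoint set \<Rightarrow> nat \<Rightarrow> 'a ppoint set \<Rightarrow> bool" where
  "is_twist k n C' m C \<longleftrightarrow> smooth_projective_curve k n C' \<and> isomorphic_over UNIV n C' m C"

text \<open>\<open>K\<close> is the minimal extension of \<open>k\<close> over which all automorphisms of \<open>C\<close> are defined.\<close>

definition is_automorphism_field ::
  "'a::field set \<Rightarrow> nat \<Rightarrow> 'a ppoint set \<Rightarrow> 'a set \<Rightarrow> bool" where
  "is_automorphism_field k m C K \<longleftrightarrow>
     is_least_set {E. is_subfield E \<and> k \<subseteq> E \<and>
       (\<forall>\<alpha>. isomorphism_over UNIV m C m C \<alpha> \<longrightarrow> isomorphism_over E m C m C \<alpha>)} K"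

text \<open>\<open>L\<close> is the field of definition of the twist \<open>C'\<close> of \<open>C\<close>: the minimal extension of \<open>K\<close> over
  which an isomorphism from \<open>C'\<close> to \<open>C\<close> is defined.\<close>

definition is_field_of_definition ::
  "'a::field set \<Rightarrow> nat \<Rightarrow> 'a ppoint set \<Rightarrow> nat \<Rightarrow> 'a ppoint set \<Rightarrow> 'a set \<Rightarrow> bool" where
  "is_field_of_definition k n C' m C L \<longleftrightarrow> (\<exists>K. is_automorphism_field k m C K \<and>
     is_least_set {E. is_subfield E \<and> K \<subseteq> E \<and> isomorphic_over E n C' m C} L)"

definition galois_point :: "('a \<Rightarrow> 'a) \<Rightarrow> 'a ppoint \<Rightarrow> 'a ppoint" where
  "galois_point \<sigma> P = (\<lambda>v. \<sigma> \<circ> v) ` P"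

definition galois_map ::
  "('a \<Rightarrow> 'a) \<Rightarrow> ('a ppoint \<Rightarrow> 'a ppoint) \<Rightarrow> 'a ppoint \<Rightarrow> 'a ppoint" where
  "galois_map \<sigma> \<phi> P = galois_point \<sigma> (\<phi> (galois_point (inv \<sigma>) P))"

text \<open>The cocycle of an isomorphism \<open>\<phi>\<close> with source \<open>C'\<close>: the composition of \<open>\<phi>\<close> with the inverse
  of its conjugate by \<open>\<sigma>\<close>.\<close>

definition twist_cocycle ::
  "'a ppoint set \<Rightarrow> ('a ppoint \<Rightarrow> 'a ppoint) \<Rightarrow> ('a \<Rightarrow> 'a) \<Rightarrow> 'a ppoint \<Rightarrow> 'a ppoint" where
  "twist_cocycle C' \<phi> \<sigma> = \<phi> \<circ> inv_into C' (galois_map \<sigma> \<phi>)"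

definition given_by_diagonal_matrix ::
  "nat \<Rightarrow> 'a::field ppoint set \<Rightarrow> ('a ppoint \<Rightarrow> 'a ppoint) \<Rightarrow> bool" where
  "given_by_diagonal_matrix m C \<alpha> \<longleftrightarrow>
     (\<exists>c. (\<forall>i\<le>m. c i \<noteq> 0) \<and> (\<forall>P\<in>C. \<alpha> P = (\<lambda>v i. c i * v i) ` P))"


section \<open>The Fermat quartic and its diagonal twists\<close>

definition fermat_quartic :: "'a::field ppoint set" where
  "fermat_quartic = {P \<in> proj_space 2. \<forall>v\<in>P. v 0 ^ 4 + v 1 ^ 4 + v 2 ^ 4 = 0}"

definition diagonal_quartic :: "'a::field \<Rightarrow> 'a \<Rightarrow> 'a ppoint set" where
  "diagonal_quartic a b = {P \<in> proj_space 2. \<forall>v\<in>P. a * v 0 ^ 4 + b * v 1 ^ 4 + v 2 ^ 4 = 0}"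

definition is_diagonal_twist :: "'a::field set \<Rightarrow> nat \<Rightarrow> 'a ppoint set \<Rightarrow> bool" where
  "is_diagonal_twist k n C' \<longleftrightarrow> is_twist k n C' 2 fermat_quartic \<and>
     (\<exists>\<phi>. isomorphism_over UNIV n C' 2 fermat_quartic \<phi> \<and>
        (\<forall>\<sigma>\<in>galois_group k.
           given_by_diagonal_matrix 2 fermat_quartic (twist_cocycle C' \<phi> \<sigma>)))"

text \<open>Congruence modulo fourth powers of \<open>k\<^sup>*\<close> of two unordered triples, given as lists.\<close>

definition congruent_mod_fourth_powers :: "'a::field set \<Rightarrow> 'a list \<Rightarrow> 'a list \<Rightarrow> bool" where
  "congruent_mod_fourth_powers k xs ys \<longleftrightarrow> (\<exists>\<pi>. \<pi> permutes {..<3} \<and>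
     (\<forall>i<3. \<exists>c\<in>k - {0}. xs ! \<pi> i = c ^ 4 * ys ! i))"

end

theory Submission
  imports Defs "HOL-Computational_Algebra.Formal_Laurent_Series"
begin

text \<open>
  The heart of the matter is that every isomorphism between two smooth plane curves
  \<open>a\<^sub>0 x\<^sup>4 + a\<^sub>1 y\<^sup>4 + a\<^sub>2 z\<^sup>4 = 0\<close> over the algebraic closure is given by a monomial matrix
  (\<open>isomorphism_is_monomial\<close>). Once this is known, all three claims are statements about monomial
  matrices up to scalars and their Galois conjugates.

  Linearity is the classical consequence of the fact that the regular differentials of a smooth plane
  quartic are the linear forms times one fixed differential. Here it takes the following shape. The
  homogeneous coordinate ring of the curve embeds into power series in \<open>t\<close>, by a germ
  \<open>(\<xi>(t) : 1 : t)\<close> of the curve at a point with \<open>z = 0\<close> (\<open>vanishes_iff_germ\<close>). If forms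
  \<open>F\<^sub>0, F\<^sub>1, F\<^sub>2\<close> represent a morphism to another such curve near some point, then the cross product of
  \<open>F\<close> and \<open>F'\<close> along the germ is a multiple \<open>h\<close> of the gradient of the target at \<open>F\<close>. Up to a fixed
  factor, the products \<open>F\<^sub>i h\<close> do not depend on the choice of \<open>F\<close>, have degree \<open>1\<close> and are regular at
  every point. A section that is regular everywhere is given by a form
  (\<open>regular_section_is_form\<close>), so the morphism is given by three linear forms
  (\<open>isomorphism_is_linear\<close>). They take the equation of the target to a multiple of the equation of the
  source; the absence of mixed terms forces every row of the matrix to have a single nonzero entry.

  If the isomorphism is defined over \<open>E\<close>, the ratios of these entries are fixed by the Galois group of
  \<open>E\<close>, hence lie in \<open>E\<close>. Comparing the equations of source and target now gives the criterion for
  equivalence (\<open>diagonal_quartics_isomorphic_iff\<close>). It also gives the automorphism field \<open>k(\<iota>)\<close> of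
  the Fermat quartic and the field of definition \<open>k(\<iota>, \<alpha>, \<beta>)\<close>, where \<open>\<alpha>\<^sup>4 = a\<close> and \<open>\<beta>\<^sup>4 = b\<close>.

  A diagonal cocycle is, up to scalars, a pair of cocycles with values in the fourth roots of unity. By
  Hilbert's Theorem 90 they are the coboundaries of some \<open>\<alpha>\<close> and \<open>\<beta>\<close>, and \<open>a = \<alpha>\<^sup>4\<close>, \<open>b = \<beta>\<^sup>4\<close> are in
  \<open>k\<close>. Composing the given isomorphism with the inverse of \<open>diag(\<alpha>, \<beta>, 1)\<close> yields an isomorphism from the
  twist to \<open>a x\<^sup>4 + b y\<^sup>4 + z\<^sup>4 = 0\<close> that commutes with the Galois action. It is defined over \<open>k\<close> because
  suitable averages of the conjugates of local representations have coefficients in \<open>k\<close>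
  (\<open>morphism_descent\<close>). All of this rests on the fact that \<open>k\<close> is the fixed field of its Galois group
  (\<open>fixed_field_of_galois_group\<close>), which is obtained by extending embeddings with Zorn's lemma.
\<close>

section \<open>Automorphisms of the algebraic closure\<close>

lemma subfield_closed:
  assumes "is_subfield E"
  shows "0 \<in> E" "1 \<in> E" "x \<in> E \<Longrightarrow> y \<in> E \<Longrightarrow> x - y \<in> E" "x \<in> E \<Longrightarrow> y \<in> E \<Longrightarrow> x * y \<in> E"
    "x \<in> E \<Longrightarrow> inverse x \<in> E" "x \<in> E \<Longrightarrow> - x \<in> E" "x \<in> E \<Longrightarrow> y \<in> E \<Longrightarrow> x + y \<in> E"
    "x \<in> E \<Longrightarrow> y \<in> E \<Longrightarrow> x / y \<in> E" "x \<in> E \<Longrightarrow> x ^ n \<in> E"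
proof -
  show 0: "0 \<in> E" and 1: "1 \<in> E" and d: "x \<in> E \<Longrightarrow> y \<in> E \<Longrightarrow> x - y \<in> E"
    and m: "x \<in> E \<Longrightarrow> y \<in> E \<Longrightarrow> x * y \<in> E" and i: "x \<in> E \<Longrightarrow> inverse x \<in> E" for x y
    using assms unfolding is_subfield_def by auto
  show n: "x \<in> E \<Longrightarrow> - x \<in> E" for x
    using d[of 0 x] 0 by simp
  show "x \<in> E \<Longrightarrow> y \<in> E \<Longrightarrow> x + y \<in> E" for x y
    using d[of x "- y"] n by simp
  show "x \<in> E \<Longrightarrow> y \<in> E \<Longrightarrow> x / y \<in> E" for x y
    using m i by (simp add: divide_inverse)
  show "x \<in> E \<Longrightarrow> x ^ n \<in> E"
    using 1 m by (induction n) auto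
qed

lemma algebraic_extension_of_mono:
  assumes "algebraic_extension_of k" "k \<subseteq> E"
  shows "algebraic_extension_of E"
  using assms unfolding algebraic_extension_of_def by blast


text \<open>The graphs of ring homomorphisms that are defined on a subring containing \<open>E\<close> and fix
  \<open>E\<close>. As graphs, they are closed under unions of chains.\<close>

definition partial_hom :: "'a::field set \<Rightarrow> ('a \<times> 'a) set \<Rightarrow> bool" where
  "partial_hom E G \<longleftrightarrow> (\<forall>x\<in>E. (x, x) \<in> G) \<and>
     (\<forall>x y x' y'. (x, y) \<in> G \<and> (x', y') \<in> G \<longrightarrow> (x - x', y - y') \<in> G \<and> (x * x', y * y') \<in> G) \<and>
     (\<forall>y. (0, y) \<in> G \<longrightarrow> y = 0)"

lemma partial_hom_closed:
  assumes "is_subfield E" "partial_hom E G"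
  shows "x \<in> E \<Longrightarrow> (x, x) \<in> G" "(0, 0) \<in> G" "(1, 1) \<in> G"
    "(x, y) \<in> G \<Longrightarrow> (x', y') \<in> G \<Longrightarrow> (x - x', y - y') \<in> G"
    "(x, y) \<in> G \<Longrightarrow> (x', y') \<in> G \<Longrightarrow> (x + x', y + y') \<in> G"
    "(x, y) \<in> G \<Longrightarrow> (x', y') \<in> G \<Longrightarrow> (x * x', y * y') \<in> G"
    "(x, y) \<in> G \<Longrightarrow> (x, y') \<in> G \<Longrightarrow> y = y'"
proof -
  show id: "x \<in> E \<Longrightarrow> (x, x) \<in> G" for x
    using assms unfolding partial_hom_def by blast
  then show z: "(0, 0) \<in> G" and "(1, 1) \<in> G"
    using subfield_closed(1,2)[OF assms(1)] by auto
  show d: "(x, y) \<in> G \<Longrightarrow> (x', y') \<in> G \<Longrightarrow> (x - x', y - y') \<in> G" for x y x' y'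
    using assms unfolding partial_hom_def by blast
  show "(x, y) \<in> G \<Longrightarrow> (x', y') \<in> G \<Longrightarrow> (x * x', y * y') \<in> G"
    using assms unfolding partial_hom_def by blast
  show "(x, y) \<in> G \<Longrightarrow> (x', y') \<in> G \<Longrightarrow> (x + x', y + y') \<in> G"
    using d[OF _ d[OF z, of x' y'], of x y] by simp
  show "(x, y) \<in> G \<Longrightarrow> (x, y') \<in> G \<Longrightarrow> y = y'"
    using d[of x y x y'] assms(2) unfolding partial_hom_def by fastforce
qed

lemma partial_hom_sum:
  assumes "is_subfield E" "partial_hom E G" "\<And>i. i \<in> I \<Longrightarrow> (f i, g i) \<in> G"
  shows "(sum f I, sum g I) \<in> G"
  using assms(3)
  by (induction I rule: infinite_finite_induct) (auto intro: partial_hom_closed(2,5)[OF assms(1,2)])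

lemma partial_hom_power:
  assumes "is_subfield E" "partial_hom E G" "(x, y) \<in> G"
  shows "(x ^ n, y ^ n) \<in> G"
  by (induction n) (auto intro: partial_hom_closed(3,6)[OF assms(1,2)] assms(3))

text \<open>The domain of a partial homomorphism is a field, because a nonzero root of \<open>c + X q\<close> with
  \<open>c \<noteq> 0\<close> has the inverse \<open>- q(x) / c\<close>.\<close>

lemma partial_hom_inverse:
  assumes E: "is_subfield E" "algebraic_extension_of E" and G: "partial_hom E G"
    and x: "x \<in> Domain G" "x \<noteq> 0"
  shows "inverse x \<in> Domain G"
proof -
  obtain y where y: "(x, y) \<in> G" using x by blast
  obtain p where "p \<noteq> 0" "\<And>i. coeff p i \<in> E" "poly p x = 0"
    using E(2) unfolding algebraic_extension_of_def by blast
  then show ?thesis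
  proof (induction p rule: pCons_induct)
    case (pCons c q)
    have q: "coeff q i \<in> E" for i
      using pCons.prems(2)[of "Suc i"] by simp
    have c: "c \<in> E" using pCons.prems(2)[of 0] by simp
    show ?case
    proof (cases "c = 0")
      case True
      then show ?thesis using pCons.IH pCons.prems q x by auto
    next
      case False
      have "(poly q x, poly q y) \<in> G"
        unfolding poly_altdef
        by (intro partial_hom_sum[OF E(1) G] partial_hom_closed(6)[OF E(1) G]
            partial_hom_closed(1)[OF E(1) G q] partial_hom_power[OF E(1) G y])
      then have "(poly q x * (- inverse c), poly q y * (- inverse c)) \<in> G"
        by (intro partial_hom_closed(6)[OF E(1) G] partial_hom_closed(1)[OF E(1) G] subfield_closed(5,6)[OF E(1)] c)
      moreover have "inverse x = poly q x * (- inverse c)"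
        using False x pCons.prems(3) by (simp add: field_simps add_eq_0_iff)
      ultimately show ?thesis by auto
    qed
  qed simp
qed

text \<open>Extension to a simple extension: \<open>x\<close> is a root of \<open>p\<close>, of minimal degree over the domain, and
  is sent to a root \<open>y\<close> of the conjugate polynomial \<open>p'\<close>.\<close>

lemma partial_hom_extend:
  assumes E: "is_subfield E" "algebraic_extension_of E" and G: "partial_hom E G"
    and p: "p \<noteq> 0" "\<And>i. (coeff p i, coeff p' i) \<in> G" "poly p x = 0" "poly p' y = 0"
    and min: "\<And>q. q \<noteq> 0 \<Longrightarrow> (\<And>i. coeff q i \<in> Domain G) \<Longrightarrow> poly q x = 0 \<Longrightarrow> degree p \<le> degree q"
  shows "\<exists>G'. partial_hom E G' \<and> G \<subseteq> G' \<and> (x, y) \<in> G'"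
proof -
  note cl = partial_hom_closed[OF E(1) G]
  define G' where "G' = {(poly q x, poly r y) | q r. \<forall>i. (coeff q i, coeff r i) \<in> G}"
  have const: "(u, v) \<in> G'" if "(u, v) \<in> G" for u v
  proof -
    have "(coeff [:u:] i, coeff [:v:] i) \<in> G" for i
      using that cl(2) by (cases i) auto
    then show ?thesis unfolding G'_def by force
  qed
  have X: "(x, y) \<in> G'"
  proof -
    have "(coeff [:0, 1::'a:] i, coeff [:0, 1:] i) \<in> G" for i
      using cl(2,3) by (auto simp: coeff_pCons split: nat.split)
    then show ?thesis unfolding G'_def by (force intro: exI[of _ "[:0, 1:]"])
  qed
  define n where "n = degree p"
  define c where "c = coeff p n"
  have c: "c \<noteq> 0" "(c, coeff p' n) \<in> G" using p by (auto simp: c_def n_def)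
  then obtain d where d: "(inverse c, d) \<in> G"
    using partial_hom_inverse[OF E G, of c] by blast
  \<comment> \<open>Division with remainder by \<open>p\<close> and \<open>p'\<close>, carried out simultaneously.\<close>
  have van: "poly r y = 0"
    if "\<forall>i\<ge>m. coeff q i = 0" "\<forall>i. (coeff q i, coeff r i) \<in> G" "poly q x = 0" for m q r
    using that
  proof (induction m arbitrary: q r)
    case 0
    then have "coeff r i = 0" for i
      using cl(7)[OF cl(2), of "coeff r i"] by (metis le0)
    then have "r = 0" by (simp add: poly_eq_iff)
    then show ?case by simp
  next
    case (Suc m)
    show ?case
    proof (cases "coeff q m = 0")
      case True
      have "\<forall>i\<ge>m. coeff q i = 0"
        using Suc.prems(1) True by (metis Suc_leI le_neq_implies_less)
      then show ?thesis using Suc by blast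
    next
      case False
      then have deg: "degree q = m"
        using Suc.prems(1) by (intro antisym degree_le le_degree) auto
      have "q \<noteq> 0" using False by auto
      then have nm: "n \<le> m"
        using min[of q] Suc.prems(2,3) deg by (force simp: n_def)
      define u where "u = coeff q m * inverse c"
      define u' where "u' = coeff r m * d"
      have u: "(u, u') \<in> G" unfolding u_def u'_def using Suc.prems(2) d cl(6) by blast
      define q1 where "q1 = q - monom u (m - n) * p"
      define r1 where "r1 = r - monom u' (m - n) * p'"
      have "(coeff q1 i, coeff r1 i) \<in> G" for i
        unfolding q1_def r1_def coeff_diff coeff_monom_mult
        by (intro cl(4)) (use Suc.prems(2) p(2) u cl(2,6) in auto)
      moreover have "coeff q1 i = 0" if "i \<ge> m" for i
      proof (cases "i = m")
        case True
        then show ?thesis using nm c by (simp add: q1_def coeff_monom_mult u_def c_def)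
      next
        case False
        then have "i - (m - n) > degree p" using that nm by (auto simp: n_def)
        then show ?thesis
          using Suc.prems(1) that False by (simp add: q1_def coeff_monom_mult coeff_eq_0)
      qed
      moreover have "poly q1 x = 0" using Suc.prems(3) p(3) by (simp add: q1_def)
      ultimately have "poly r1 y = 0" using Suc.IH by blast
      then show ?thesis using p(4) by (simp add: r1_def)
    qed
  qed
  have "partial_hom E G'"
    unfolding partial_hom_def
  proof (intro conjI allI impI ballI)
    fix z assume "z \<in> E" then show "(z, z) \<in> G'" using const cl(1) by blast
  next
    fix z z' w w' assume "(z, w) \<in> G' \<and> (z', w') \<in> G'"
    then obtain q r q' r' where q: "z = poly q x" "w = poly r y" "\<forall>i. (coeff q i, coeff r i) \<in> G"
      and q': "z' = poly q' x" "w' = poly r' y" "\<forall>i. (coeff q' i, coeff r' i) \<in> G"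
      unfolding G'_def by blast
    have "\<forall>i. (coeff (q - q') i, coeff (r - r') i) \<in> G"
      using q(3) q'(3) cl(4) by simp
    then show "(z - z', w - w') \<in> G'"
      unfolding G'_def q q' by (force intro: exI[of _ "q - q'"] exI[of _ "r - r'"])
    have "\<forall>i. (coeff (q * q') i, coeff (r * r') i) \<in> G"
      unfolding coeff_mult using q(3) q'(3) by (intro allI partial_hom_sum[OF E(1) G] cl(6)) auto
    then show "(z * z', w * w') \<in> G'"
      unfolding G'_def q q' by (force intro: exI[of _ "q * q'"] exI[of _ "r * r'"])
  next
    fix w assume "(0, w) \<in> G'"
    then obtain q r where "poly q x = 0" "w = poly r y" "\<forall>i. (coeff q i, coeff r i) \<in> G"
      unfolding G'_def by auto
    then show "w = 0" using van[of "Suc (degree q)" q r] by (simp add: coeff_eq_0)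
  qed
  then show ?thesis using const X by auto
qed

lemma ex_minimal_polynomial:
  assumes "algebraic_extension_of E" "E \<subseteq> D"
  shows "\<exists>p. p \<noteq> 0 \<and> (\<forall>i. coeff p i \<in> D) \<and> poly p x = 0 \<and>
    (\<forall>q. q \<noteq> 0 \<longrightarrow> (\<forall>i. coeff q i \<in> D) \<longrightarrow> poly q x = 0 \<longrightarrow> degree p \<le> degree q)"
proof -
  obtain p where "p \<noteq> 0 \<and> (\<forall>i. coeff p i \<in> D) \<and> poly p x = 0"
    using assms unfolding algebraic_extension_of_def by blast
  from ex_has_least_nat[of "\<lambda>p. p \<noteq> 0 \<and> (\<forall>i. coeff p i \<in> D) \<and> poly p x = 0", OF this]
  show ?thesis by blast
qed

lemma galois_group_props:
  assumes "\<sigma> \<in> galois_group k"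
  shows "bij \<sigma>" "\<sigma> (x + y) = \<sigma> x + \<sigma> y" "\<sigma> (x * y) = \<sigma> x * \<sigma> y" "x \<in> k \<Longrightarrow> \<sigma> x = x"
    "\<sigma> 0 = 0" "\<sigma> 1 = 1" "\<sigma> x = 0 \<longleftrightarrow> x = 0" "\<sigma> (x - y) = \<sigma> x - \<sigma> y" "\<sigma> (- x) = - \<sigma> x"
    "\<sigma> (x ^ n) = \<sigma> x ^ n" "\<sigma> (sum f I) = (\<Sum>i\<in>I. \<sigma> (f i))" "\<sigma> (x / y) = \<sigma> x / \<sigma> y"
    "\<sigma> x = \<sigma> y \<longleftrightarrow> x = y"
proof -
  show b: "bij \<sigma>" and a: "\<sigma> (x + y) = \<sigma> x + \<sigma> y" and m: "\<sigma> (x * y) = \<sigma> x * \<sigma> y"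
    and "x \<in> k \<Longrightarrow> \<sigma> x = x" for x y
    using assms unfolding galois_group_def by auto
  show i: "\<sigma> x = \<sigma> y \<longleftrightarrow> x = y" for x y
    using b by (meson bij_def inj_eq)
  show z: "\<sigma> 0 = 0" using a[of 0 0] by (metis add.right_neutral add_left_cancel)
  then show z': "\<sigma> x = 0 \<longleftrightarrow> x = 0" for x using i[of x 0] by simp
  show o: "\<sigma> 1 = 1" using m[of 1 1] z'[of 1] by simp
  show "\<sigma> (x - y) = \<sigma> x - \<sigma> y" using a[of "x - y" y] by simp
  show "\<sigma> (- x) = - \<sigma> x" using a[of "- x" x] z by (simp add: eq_neg_iff_add_eq_0)
  show "\<sigma> (x ^ n) = \<sigma> x ^ n" using o m by (induction n) auto
  show "\<sigma> (sum f I) = (\<Sum>i\<in>I. \<sigma> (f i))"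
    using z a by (induction I rule: infinite_finite_induct) auto
  show "\<sigma> (x / y) = \<sigma> x / \<sigma> y"
    using m[of "x / y" y] z z'[of y] by (cases "y = 0") (simp_all add: eq_divide_eq)
qed

lemma galois_group_id: "(\<lambda>x. x) \<in> galois_group k"
  unfolding galois_group_def by (auto intro: bij_id[unfolded id_def])

lemma galois_group_comp:
  assumes "\<sigma> \<in> galois_group k" "\<tau> \<in> galois_group k"
  shows "\<sigma> \<circ> \<tau> \<in> galois_group k"
  using assms unfolding galois_group_def by (auto intro: bij_comp)

lemma galois_group_inv:
  assumes "\<sigma> \<in> galois_group k"
  shows "inv \<sigma> \<in> galois_group k" "\<sigma> (inv \<sigma> x) = x" "inv \<sigma> (\<sigma> x) = x"
proof -
  note s = galois_group_props[OF assms]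
  show 1: "\<sigma> (inv \<sigma> x) = x" and 2: "inv \<sigma> (\<sigma> x) = x" for x
    using s(1) by (auto simp: bij_is_surj surj_f_inv_f bij_is_inj)
  have "inv \<sigma> (x + y) = inv \<sigma> x + inv \<sigma> y" for x y
    using s(2)[of "inv \<sigma> x" "inv \<sigma> y"] 1 2 by metis
  moreover have "inv \<sigma> (x * y) = inv \<sigma> x * inv \<sigma> y" for x y
    using s(3)[of "inv \<sigma> x" "inv \<sigma> y"] 1 2 by metis
  ultimately show "inv \<sigma> \<in> galois_group k"
    using s(1,4) 2 unfolding galois_group_def by (auto intro: bij_imp_bij_inv) metis
qed

lemma galois_group_poly_root:
  assumes "\<sigma> \<in> galois_group k" "\<And>i. coeff p i \<in> k" "poly p x = 0"
  shows "poly p (\<sigma> x) = 0"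
proof -
  note s = galois_group_props[OF assms(1)]
  have "poly p (\<sigma> x) = \<sigma> (poly p x)"
    unfolding poly_altdef using assms(2) by (simp add: s)
  then show ?thesis using s(5) assms(3) by simp
qed

text \<open>A partial homomorphism that is maximal for inclusion is total, as otherwise it extends to
  some further algebraic element; it is onto since it permutes the roots of every polynomial
  over \<open>E\<close>.\<close>

lemma partial_hom_extends_to_automorphism:
  fixes E :: "'a::alg_closed_field set"
  assumes E: "is_subfield E" "algebraic_extension_of E" and G0: "partial_hom E G0"
  shows "\<exists>\<sigma>\<in>galois_group E. \<forall>(x, y)\<in>G0. \<sigma> x = y"
proof -
  define \<A> where "\<A> = {G. partial_hom E G \<and> G0 \<subseteq> G}"
  have "\<exists>M\<in>\<A>. \<forall>X\<in>\<A>. M \<subseteq> X \<longrightarrow> X = M"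
  proof (rule subset_Zorn_nonempty)
    show "\<A> \<noteq> {}" using G0 by (auto simp: \<A>_def)
  next
    fix \<C> assume \<C>: "\<C> \<noteq> {}" "subset.chain \<A> \<C>"
    have mem: "partial_hom E X" "G0 \<subseteq> X" if "X \<in> \<C>" for X
      using \<C>(2) that unfolding subset_chain_def \<A>_def by auto
    have two: "\<exists>X\<in>\<C>. a \<in> X \<and> b \<in> X" if "a \<in> \<Union>\<C>" "b \<in> \<Union>\<C>" for a b
      using \<C>(2) that unfolding subset_chain_def by (elim UnionE) (metis subsetD)
    have "partial_hom E (\<Union>\<C>)"
      unfolding partial_hom_def
    proof (intro conjI allI impI ballI)
      fix x assume "x \<in> E" then show "(x, x) \<in> \<Union>\<C>"
        using \<C>(1) mem(1) unfolding partial_hom_def by blast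
    next
      fix x y x' y' assume "(x, y) \<in> \<Union>\<C> \<and> (x', y') \<in> \<Union>\<C>"
      then obtain X where "X \<in> \<C>" "(x, y) \<in> X" "(x', y') \<in> X" using two by meson
      then show "(x - x', y - y') \<in> \<Union>\<C>" "(x * x', y * y') \<in> \<Union>\<C>"
        using mem(1)[of X] unfolding partial_hom_def by blast+
    next
      fix y assume "(0, y) \<in> \<Union>\<C>"
      then show "y = 0" using mem(1) unfolding partial_hom_def by blast
    qed
    then show "\<Union>\<C> \<in> \<A>" using \<C>(1) mem(2) by (auto simp: \<A>_def)
  qed
  then obtain M where M: "partial_hom E M" "G0 \<subseteq> M"
    and max: "\<And>X. partial_hom E X \<Longrightarrow> M \<subseteq> X \<Longrightarrow> X = M"
    unfolding \<A>_def by auto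
  note cl = partial_hom_closed[OF E(1) M(1)]
  have ED: "E \<subseteq> Domain M" using cl(1) by blast
  have total: "x \<in> Domain M" for x
  proof -
    obtain p where p: "p \<noteq> 0" "\<forall>i. coeff p i \<in> Domain M" "poly p x = 0"
      and min: "\<And>q. q \<noteq> 0 \<Longrightarrow> (\<forall>i. coeff q i \<in> Domain M) \<Longrightarrow> poly q x = 0 \<Longrightarrow> degree p \<le> degree q"
      using ex_minimal_polynomial[OF E(2) ED] by metis
    define \<tau> where "\<tau> u = (SOME v. (u, v) \<in> M)" for u
    have \<tau>: "(u, \<tau> u) \<in> M" if "u \<in> Domain M" for u
      using that unfolding \<tau>_def by (metis DomainE someI_ex)
    have "\<tau> 0 = 0" using \<tau>[of 0] cl(2) cl(7)[of 0 "\<tau> 0" 0] by auto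
    then have co: "(coeff p i, coeff (map_poly \<tau> p) i) \<in> M" for i
      using p(2) \<tau> by (simp add: coeff_map_poly)
    have "degree (map_poly \<tau> p) > 0"
    proof -
      have "degree p > 0"
      proof (rule ccontr)
        assume "\<not> degree p > 0"
        then obtain c where "p = [:c:]" by (auto elim: degree_eq_zeroE)
        then show False using p(1,3) by simp
      qed
      moreover obtain d where "(inverse (lead_coeff p), d) \<in> M"
        using partial_hom_inverse[OF E M(1), of "lead_coeff p"] p by auto
      then have "(lead_coeff p * inverse (lead_coeff p), coeff (map_poly \<tau> p) (degree p) * d) \<in> M"
        using co cl(6) by blast
      then have "(1, coeff (map_poly \<tau> p) (degree p) * d) \<in> M" using p(1) by simp
      then have "coeff (map_poly \<tau> p) (degree p) * d = 1" using cl(3,7) by blast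
      then have "coeff (map_poly \<tau> p) (degree p) \<noteq> 0" by auto
      ultimately show ?thesis using le_degree by fastforce
    qed
    then obtain y where "poly (map_poly \<tau> p) y = 0" using alg_closed_imp_poly_has_root by blast
    then obtain G' where "partial_hom E G'" "M \<subseteq> G'" "(x, y) \<in> G'"
      using partial_hom_extend[OF E M(1) p(1) co p(3) _ min] by blast
    then show ?thesis using max by blast
  qed
  define \<sigma> where "\<sigma> x = (SOME y. (x, y) \<in> M)" for x
  have \<sigma>: "(x, \<sigma> x) \<in> M" for x
    using total[of x] unfolding \<sigma>_def by (metis DomainE someI_ex)
  have eq: "\<sigma> x = y" if "(x, y) \<in> M" for x y using \<sigma> that cl(7) by blast
  have add: "\<sigma> (x + y) = \<sigma> x + \<sigma> y" and mult: "\<sigma> (x * y) = \<sigma> x * \<sigma> y"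
    and diff: "\<sigma> (x - y) = \<sigma> x - \<sigma> y" and fix_E: "x \<in> E \<Longrightarrow> \<sigma> x = x" for x y
    using eq cl(1,4,5,6) \<sigma> by metis+
  have z: "\<sigma> 0 = 0" "\<sigma> 1 = 1" using eq cl(2,3) by blast+
  have inj: "inj \<sigma>"
  proof (rule injI)
    fix x y assume "\<sigma> x = \<sigma> y"
    then have "\<sigma> (x - y) = 0" using diff by simp
    then have "\<sigma> ((x - y) * inverse (x - y)) = 0" unfolding mult by simp
    then show "x = y" using z by (cases "x = y") auto
  qed
  have "\<exists>x. \<sigma> x = y" for y
  proof -
    obtain p where p: "p \<noteq> 0" "\<And>i. coeff p i \<in> E" "poly p y = 0"
      using E(2) unfolding algebraic_extension_of_def by blast
    have sum: "\<sigma> (sum f I) = (\<Sum>i\<in>I. \<sigma> (f i))" for f :: "nat \<Rightarrow> 'a" and I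
      using z add by (induction I rule: infinite_finite_induct) auto
    have pow: "\<sigma> (x ^ n) = \<sigma> x ^ n" for x n
      using z mult by (induction n) auto
    define R where "R = {x. poly p x = 0}"
    have "poly p (\<sigma> x) = \<sigma> (poly p x)" for x
      unfolding poly_altdef by (simp add: sum mult pow fix_E p(2))
    then have "\<sigma> ` R \<subseteq> R" using z by (auto simp: R_def)
    moreover have "finite R" using p(1) by (simp add: R_def poly_roots_finite)
    ultimately have "\<sigma> ` R = R"
      using inj by (meson endo_inj_surj inj_on_subset subset_UNIV)
    moreover have "y \<in> R" using p(3) by (simp add: R_def)
    ultimately show ?thesis by (metis imageE)
  qed
  then have "surj \<sigma>" by (metis surjI)
  then have "\<sigma> \<in> galois_group E"
    using inj add mult fix_E unfolding galois_group_def by (auto simp: bij_def)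
  then show ?thesis using eq M(2) by blast
qed

text \<open>An element outside \<open>E\<close> has a conjugate \<open>y \<noteq> x\<close>: its minimal polynomial has no multiple
  roots in characteristic \<open>0\<close> and is not linear.\<close>

theorem fixed_field_of_galois_group:
  fixes E :: "'a::{alg_closed_field, field_char_0} set"
  assumes E: "is_subfield E" "algebraic_extension_of E"
    and fixed: "\<And>\<sigma>. \<sigma> \<in> galois_group E \<Longrightarrow> \<sigma> x = x"
  shows "x \<in> E"
proof (rule ccontr)
  assume x: "x \<notin> E"
  define G where "G = {(u, u) | u. u \<in> E}"
  have G: "partial_hom E G"
    unfolding partial_hom_def G_def using subfield_closed[OF E(1)] by auto
  have D: "Domain G = E" by (auto simp: G_def)
  obtain p where p: "p \<noteq> 0" "\<forall>i. coeff p i \<in> E" "poly p x = 0"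
    and min: "\<And>q. q \<noteq> 0 \<Longrightarrow> (\<forall>i. coeff q i \<in> E) \<Longrightarrow> poly q x = 0 \<Longrightarrow> degree p \<le> degree q"
    using ex_minimal_polynomial[OF E(2) order.refl] by metis
  obtain q where q: "p = [:- x, 1:] * q" using p(3) poly_eq_0_iff_dvd by (metis dvdE)
  have "q \<noteq> 0" using p(1) q by auto
  then have deg: "degree p = Suc (degree q)" unfolding q by (subst degree_mult_eq) auto
  have "degree q \<noteq> 0"
  proof
    assume "degree q = 0"
    then obtain c where c: "q = [:c:]" by (elim degree_eq_zeroE)
    have "c \<in> E" "- x * c \<in> E" "c \<noteq> 0"
      using p(2)[rule_format, of 0] p(2)[rule_format, of 1] q c \<open>q \<noteq> 0\<close> by (auto simp: mult_ac)
    then have "- (- x * c / c) \<in> E" by (intro subfield_closed(6,8)[OF E(1)])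
    then show False using x \<open>c \<noteq> 0\<close> by simp
  qed
  then obtain y where y: "poly q y = 0" using alg_closed_imp_poly_has_root by blast
  have "y \<noteq> x"
  proof
    assume "y = x"
    then have "poly (pderiv p) x = 0" using y unfolding q pderiv_mult by (simp add: pderiv_pCons)
    moreover have "pderiv p \<noteq> 0" using deg by (simp add: pderiv_eq_0_iff)
    moreover have "coeff (pderiv p) i \<in> E" for i
    proof -
      have "of_nat n \<in> E" for n
        by (induction n) (auto intro: subfield_closed(1,2,7)[OF E(1)])
      then show ?thesis
        using p(2) subfield_closed(4)[OF E(1)] unfolding coeff_pderiv by blast
    qed
    ultimately have "degree p \<le> degree (pderiv p)" using min by blast
    then show False using deg by (simp add: degree_pderiv)
  qed
  obtain G' where "partial_hom E G'" "(x, y) \<in> G'"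
    using partial_hom_extend[OF E G p(1), of p x y] p q y min D by (auto simp: G_def)
  then show False
    using partial_hom_extends_to_automorphism[OF E, of G'] fixed \<open>y \<noteq> x\<close> by fastforce
qed


section \<open>Evaluation of forms under ring homomorphisms\<close>

definition is_ring_hom :: "('b::comm_semiring_1 \<Rightarrow> 'c::comm_semiring_1) \<Rightarrow> bool" where
  "is_ring_hom h \<longleftrightarrow> h 0 = 0 \<and> h 1 = 1 \<and> (\<forall>x y. h (x + y) = h x + h y) \<and> (\<forall>x y. h (x * y) = h x * h y)"

definition monom_eval :: "(nat \<Rightarrow>\<^sub>0 nat) \<Rightarrow> (nat \<Rightarrow> 'b::comm_semiring_1) \<Rightarrow> 'b" where
  "monom_eval m v = (\<Prod>i\<in>Poly_Mapping.keys m. v i ^ Poly_Mapping.lookup m i)"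

text \<open>The coefficients are mapped by a homomorphism \<open>h\<close> before evaluation. For \<open>h\<close> the identity this is
  evaluation at a point, for an automorphism the evaluation of a conjugate form, and for an embedding
  into polynomials or power series the restriction of a form to a line or to a germ of the curve.\<close>

definition hom_eval :: "('a::zero \<Rightarrow> 'b::comm_semiring_1) \<Rightarrow> 'a mpol \<Rightarrow> (nat \<Rightarrow> 'b) \<Rightarrow> 'b" where
  "hom_eval h p v = (\<Sum>m\<in>Poly_Mapping.keys p. h (Poly_Mapping.lookup p m) * monom_eval m v)"

definition mdeg :: "(nat \<Rightarrow>\<^sub>0 nat) \<Rightarrow> nat" where
  "mdeg m = (\<Sum>i\<in>Poly_Mapping.keys m. Poly_Mapping.lookup m i)"

definition Var :: "nat \<Rightarrow> 'a::zero_neq_one mpol" where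
  "Var i = Poly_Mapping.single (Poly_Mapping.single i 1) 1"

definition Const :: "'a::zero \<Rightarrow> 'a mpol" where
  "Const c = Poly_Mapping.single 0 c"

lemma is_ring_homD:
  assumes "is_ring_hom h"
  shows "h 0 = 0" "h 1 = 1" "h (x + y) = h x + h y" "h (x * y) = h x * h y"
    "h (x ^ n) = h x ^ n" "h (sum f I) = (\<Sum>i\<in>I. h (f i))" "h (prod f I) = (\<Prod>i\<in>I. h (f i))"
proof -
  show *: "h 0 = 0" "h 1 = 1" and a: "h (x + y) = h x + h y" and m: "h (x * y) = h x * h y" for x y
    using assms by (auto simp: is_ring_hom_def)
  show "h (x ^ n) = h x ^ n" by (induction n) (auto simp: * m)
  show "h (sum f I) = (\<Sum>i\<in>I. h (f i))"
    by (induction I rule: infinite_finite_induct) (auto simp: * a)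
  show "h (prod f I) = (\<Prod>i\<in>I. h (f i))"
    by (induction I rule: infinite_finite_induct) (auto simp: * m)
qed

lemma is_ring_hom_of_nat:
  assumes "is_ring_hom h" shows "h (of_nat n) = of_nat n"
  by (induction n) (auto simp: is_ring_homD[OF assms])

lemma is_ring_hom_id: "is_ring_hom (\<lambda>x. x)"
  by (simp add: is_ring_hom_def)

lemma is_ring_hom_galois: "\<sigma> \<in> galois_group k \<Longrightarrow> is_ring_hom \<sigma>"
  using galois_group_props[of \<sigma> k] by (simp add: is_ring_hom_def)

lemma is_ring_hom_fps_const: "is_ring_hom fps_const"
  by (simp add: is_ring_hom_def)

lemma mpol_eval_hom_eval: "mpol_eval p v = hom_eval (\<lambda>x. x) p v"
  by (simp add: mpol_eval_def hom_eval_def monom_eval_def)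

lemma monom_eval_superset:
  "finite S \<Longrightarrow> Poly_Mapping.keys m \<subseteq> S \<Longrightarrow> monom_eval m v = (\<Prod>i\<in>S. v i ^ Poly_Mapping.lookup m i)"
  unfolding monom_eval_def by (rule prod.mono_neutral_left) (auto simp: in_keys_iff)

lemma mdeg_superset:
  "finite S \<Longrightarrow> Poly_Mapping.keys m \<subseteq> S \<Longrightarrow> mdeg m = (\<Sum>i\<in>S. Poly_Mapping.lookup m i)"
  unfolding mdeg_def by (rule sum.mono_neutral_left) (auto simp: in_keys_iff)

lemma monom_eval_0 [simp]: "monom_eval 0 v = 1"
  by (simp add: monom_eval_def)

lemma monom_eval_single [simp]: "monom_eval (Poly_Mapping.single i n) v = v i ^ n"
  by (cases "n = 0") (simp_all add: monom_eval_def)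

lemma monom_eval_add: "monom_eval (m + m') v = monom_eval m v * monom_eval m' v"
proof -
  let ?S = "Poly_Mapping.keys m \<union> Poly_Mapping.keys m'"
  have "Poly_Mapping.keys (m + m') \<subseteq> ?S" by (rule Poly_Mapping.keys_add)
  then show ?thesis
    by (subst (1 2 3) monom_eval_superset[of ?S]) (auto simp: lookup_add power_add prod.distrib)
qed

lemma monom_eval_scale: "monom_eval m (\<lambda>i. c i * v i) = monom_eval m c * monom_eval m v"
  by (simp add: monom_eval_def power_mult_distrib prod.distrib)

lemma monom_eval_const: "monom_eval m (\<lambda>i. c) = c ^ mdeg m"
  by (simp add: monom_eval_def mdeg_def power_sum)

lemma monom_eval_hom: "is_ring_hom g \<Longrightarrow> g (monom_eval m v) = monom_eval m (g \<circ> v)"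
  by (simp add: monom_eval_def is_ring_homD)

lemma mdeg_0 [simp]: "mdeg 0 = 0"
  by (simp add: mdeg_def)

lemma mdeg_single [simp]: "mdeg (Poly_Mapping.single i n) = n"
  by (cases "n = 0") (simp_all add: mdeg_def)

lemma mdeg_add: "mdeg (m + m') = mdeg m + mdeg m'"
proof -
  let ?S = "Poly_Mapping.keys m \<union> Poly_Mapping.keys m'"
  have "Poly_Mapping.keys (m + m') \<subseteq> ?S" by (rule Poly_Mapping.keys_add)
  then show ?thesis
    by (subst (1 2 3) mdeg_superset[of ?S]) (auto simp: lookup_add sum.distrib)
qed

lemma mpol_sum_single: "p = (\<Sum>m\<in>Poly_Mapping.keys p. Poly_Mapping.single m (Poly_Mapping.lookup p m))"
proof (rule poly_mapping_eqI)
  fix m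
  have "Poly_Mapping.lookup (\<Sum>m\<in>Poly_Mapping.keys p. Poly_Mapping.single m (Poly_Mapping.lookup p m)) m
     = (\<Sum>m'\<in>Poly_Mapping.keys p. if m' = m then Poly_Mapping.lookup p m' else 0)"
    unfolding lookup_sum by (intro sum.cong) (auto simp: lookup_single when_def)
  then show "Poly_Mapping.lookup p m =
    Poly_Mapping.lookup (\<Sum>m\<in>Poly_Mapping.keys p. Poly_Mapping.single m (Poly_Mapping.lookup p m)) m"
    by (simp add: in_keys_iff)
qed

lemma hom_eval_superset:
  assumes "h 0 = 0" "finite S" "Poly_Mapping.keys p \<subseteq> S"
  shows "hom_eval h p v = (\<Sum>m\<in>S. h (Poly_Mapping.lookup p m) * monom_eval m v)"
  unfolding hom_eval_def using assms by (intro sum.mono_neutral_left) (auto simp: in_keys_iff)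

lemma hom_eval_zero [simp]: "hom_eval h 0 v = 0"
  by (simp add: hom_eval_def)

lemma hom_eval_single:
  assumes "h 0 = 0" shows "hom_eval h (Poly_Mapping.single m c) v = h c * monom_eval m v"
  using assms by (simp add: hom_eval_def)

lemma hom_eval_Var [simp]: "is_ring_hom h \<Longrightarrow> hom_eval h (Var i) v = v i"
  by (simp add: Var_def hom_eval_single is_ring_homD)

lemma hom_eval_Const [simp]: "is_ring_hom h \<Longrightarrow> hom_eval h (Const c) v = h c"
  by (simp add: Const_def hom_eval_single is_ring_homD)

lemma hom_eval_add:
  assumes h: "is_ring_hom h"
  shows "hom_eval h (p + q) v = hom_eval h p v + hom_eval h q v"
proof -
  let ?S = "Poly_Mapping.keys p \<union> Poly_Mapping.keys q"
  have "Poly_Mapping.keys (p + q) \<subseteq> ?S" by (rule Poly_Mapping.keys_add)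
  then show ?thesis
    by (subst (1 2 3) hom_eval_superset[of h ?S])
      (auto simp: is_ring_homD[OF h] lookup_add distrib_right sum.distrib)
qed

lemma hom_eval_sum:
  assumes "is_ring_hom h"
  shows "hom_eval h (sum p I) v = (\<Sum>i\<in>I. hom_eval h (p i) v)"
  by (induction I rule: infinite_finite_induct) (auto simp: hom_eval_add[OF assms])

lemma hom_eval_mult:
  assumes h: "is_ring_hom h"
  shows "hom_eval h (p * q) v = hom_eval h p v * hom_eval h q v"
proof -
  have "p * q = (\<Sum>m\<in>Poly_Mapping.keys p. \<Sum>m'\<in>Poly_Mapping.keys q.
      Poly_Mapping.single (m + m') (Poly_Mapping.lookup p m * Poly_Mapping.lookup q m'))"
    by (subst (1) mpol_sum_single[of p], subst (1) mpol_sum_single[of q])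
      (simp add: sum_product mult_single)
  then show ?thesis
    by (simp add: hom_eval_sum[OF h] hom_eval_single is_ring_homD[OF h] monom_eval_add,
        simp add: hom_eval_def sum_product mult_ac)
qed

lemma hom_eval_one [simp]: "is_ring_hom h \<Longrightarrow> hom_eval h 1 v = 1"
  using hom_eval_single[of h 0 1 v] by (simp add: is_ring_homD)

lemma hom_eval_power:
  assumes "is_ring_hom h"
  shows "hom_eval h (p ^ n) v = hom_eval h p v ^ n"
  by (induction n) (auto simp: assms hom_eval_mult[OF assms])

lemma hom_eval_diff:
  fixes h :: "'a::comm_ring_1 \<Rightarrow> 'b::comm_ring_1"
  assumes "is_ring_hom h"
  shows "hom_eval h (p - q) v = hom_eval h p v - hom_eval h q v"
  using hom_eval_add[OF assms, of "p - q" q v] by simp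

lemma hom_eval_hom:
  assumes "is_ring_hom g"
  shows "g (hom_eval h p v) = hom_eval (g \<circ> h) p (g \<circ> v)"
  by (simp add: hom_eval_def is_ring_homD[OF assms] monom_eval_hom[OF assms])

lemma hom_eval_cong:
  assumes "Poly_Mapping.keys p \<subseteq> {m. Poly_Mapping.keys m \<subseteq> A}" "\<And>i. i \<in> A \<Longrightarrow> v i = w i"
  shows "hom_eval h p v = hom_eval h p w"
  unfolding hom_eval_def monom_eval_def using assms(1)
  by (intro sum.cong arg_cong2[where f="(*)"] prod.cong refl arg_cong2[where f="(^)"] assms(2)) auto

definition scale_vars :: "(nat \<Rightarrow> 'a::comm_semiring_1) \<Rightarrow> 'a mpol \<Rightarrow> 'a mpol" where
  "scale_vars c p = Poly_Mapping.mapp (\<lambda>m a. a * monom_eval m c) p"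

definition map_coeffs :: "('a::zero \<Rightarrow> 'a) \<Rightarrow> 'a mpol \<Rightarrow> 'a mpol" where
  "map_coeffs h p = Poly_Mapping.map h p"

lemma lookup_scale_vars: "Poly_Mapping.lookup (scale_vars c p) m = Poly_Mapping.lookup p m * monom_eval m c"
  by (auto simp: scale_vars_def lookup_mapp in_keys_iff when_def)

lemma lookup_map_coeffs: "h 0 = 0 \<Longrightarrow> Poly_Mapping.lookup (map_coeffs h p) m = h (Poly_Mapping.lookup p m)"
  by (auto simp: map_coeffs_def Poly_Mapping.map.rep_eq when_def)

lemma keys_scale_vars: "Poly_Mapping.keys (scale_vars c p) \<subseteq> Poly_Mapping.keys p"
  by (auto simp: in_keys_iff lookup_scale_vars)

lemma keys_map_coeffs: "h 0 = 0 \<Longrightarrow> Poly_Mapping.keys (map_coeffs h p) \<subseteq> Poly_Mapping.keys p"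
  by (auto simp: in_keys_iff lookup_map_coeffs)

lemma mpol_eval_scale_vars: "mpol_eval (scale_vars c p) v = mpol_eval p (\<lambda>i. c i * v i)"
  unfolding mpol_eval_hom_eval
  by (subst hom_eval_superset[OF _ _ keys_scale_vars])
    (auto simp: lookup_scale_vars monom_eval_scale hom_eval_def mult_ac)

lemma mpol_eval_map_coeffs: "h 0 = 0 \<Longrightarrow> mpol_eval (map_coeffs h p) v = hom_eval h p v"
  unfolding mpol_eval_hom_eval
  by (subst hom_eval_superset[OF _ _ keys_map_coeffs])
    (auto simp: lookup_map_coeffs hom_eval_def mult_ac)

lemma galois_mpol_eval:
  assumes "\<sigma> \<in> galois_group k"
  shows "\<sigma> (mpol_eval p v) = mpol_eval (map_coeffs \<sigma> p) (\<sigma> \<circ> v)"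
  using hom_eval_hom[OF is_ring_hom_galois[OF assms], of "\<lambda>x. x" p v]
  by (simp add: mpol_eval_hom_eval[symmetric] mpol_eval_map_coeffs galois_group_props[OF assms] comp_def)

lemma map_coeffs_fixed:
  assumes "h 0 = 0" "\<And>m. h (Poly_Mapping.lookup p m) = Poly_Mapping.lookup p m"
  shows "map_coeffs h p = p"
  by (rule poly_mapping_eqI) (simp add: lookup_map_coeffs assms)


section \<open>Forms\<close>

lemma is_subfield_UNIV: "is_subfield UNIV"
  by (simp add: is_subfield_def)

lemma forms_iff: "p \<in> forms E n d \<longleftrightarrow> (\<forall>m. Poly_Mapping.lookup p m \<in> E) \<and>
     (\<forall>m\<in>Poly_Mapping.keys p. Poly_Mapping.keys m \<subseteq> {..n} \<and> mdeg m = d)"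
  by (simp add: forms_def mdeg_def)

lemma forms_mono: "E \<subseteq> E' \<Longrightarrow> n \<le> n' \<Longrightarrow> forms E n d \<subseteq> forms E' n' d"
  unfolding forms_iff[abs_def] by (fastforce simp: forms_def)

lemma forms_zero: "is_subfield E \<Longrightarrow> 0 \<in> forms E n d"
  by (simp add: forms_iff subfield_closed)

lemma forms_add:
  assumes "is_subfield E" "p \<in> forms E n d" "q \<in> forms E n d"
  shows "p + q \<in> forms E n d"
  using assms Poly_Mapping.keys_add[of p q] unfolding forms_iff
  by (auto simp: lookup_add subfield_closed; blast)

lemma forms_sum:
  assumes "is_subfield E" "\<And>i. i \<in> I \<Longrightarrow> p i \<in> forms E n d"
  shows "sum p I \<in> forms E n d"
  using assms(2) by (induction I rule: infinite_finite_induct) (auto intro: forms_add forms_zero assms)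

lemma forms_single:
  assumes "is_subfield E" "c \<in> E" "Poly_Mapping.keys m \<subseteq> {..n}" "mdeg m = d"
  shows "Poly_Mapping.single m c \<in> forms E n d"
  using assms by (auto simp: forms_iff lookup_single when_def subfield_closed)

lemma forms_Var: "is_subfield E \<Longrightarrow> i \<le> n \<Longrightarrow> Var i \<in> forms E n 1"
  unfolding Var_def by (rule forms_single) (auto simp: subfield_closed)

lemma forms_Const: "is_subfield E \<Longrightarrow> c \<in> E \<Longrightarrow> Const c \<in> forms E n 0"
  unfolding Const_def by (rule forms_single) auto

lemma forms_mult:
  fixes E :: "'a::field set"
  assumes "is_subfield E" "p \<in> forms E n d" "q \<in> forms E n e"
  shows "p * q \<in> forms E n (d + e)"
proof -
  have "p * q = (\<Sum>m\<in>Poly_Mapping.keys p. \<Sum>m'\<in>Poly_Mapping.keys q.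
      Poly_Mapping.single (m + m') (Poly_Mapping.lookup p m * Poly_Mapping.lookup q m'))"
    by (subst (1) mpol_sum_single[of p], subst (1) mpol_sum_single[of q])
      (simp add: sum_product mult_single)
  also have "\<dots> \<in> forms E n (d + e)"
  proof (intro forms_sum forms_single assms(1))
    fix m m' assume m: "m \<in> Poly_Mapping.keys p" "m' \<in> Poly_Mapping.keys q"
    show "Poly_Mapping.lookup p m * Poly_Mapping.lookup q m' \<in> E"
      using assms by (auto simp: forms_iff subfield_closed)
    show "Poly_Mapping.keys (m + m') \<subseteq> {..n}"
      using Poly_Mapping.keys_add[of m m'] m assms by (fastforce simp: forms_iff)
    show "mdeg (m + m') = d + e" using m assms by (auto simp: forms_iff mdeg_add)
  qed
  finally show ?thesis .
qed

lemma forms_power: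
  fixes E :: "'a::field set"
  assumes "is_subfield E" "p \<in> forms E n d"
  shows "p ^ j \<in> forms E n (j * d)"
proof (induction j)
  case 0
  show ?case using forms_Const[of E 1 n] subfield_closed(2)[OF assms(1)] assms(1)
    by (simp add: Const_def)
next
  case (Suc j)
  then show ?case using forms_mult[OF assms(1,2) Suc] by simp
qed

lemma forms_diff:
  fixes E :: "'a::field set"
  assumes "is_subfield E" "p \<in> forms E n d" "q \<in> forms E n d"
  shows "p - q \<in> forms E n d"
proof -
  have "Const (-1) * q \<in> forms E n (0 + d)"
    by (intro forms_mult assms forms_Const) (use subfield_closed[OF assms(1)] in auto)
  then have "p + Const (-1) * q \<in> forms E n d"
    using forms_add[OF assms(1,2)] by simp
  moreover have "p + Const (-1) * q = p - q"
    by (simp add: Const_def single_uminus)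
  ultimately show ?thesis by simp
qed

lemma forms_UNIV_map: "p \<in> forms UNIV n d \<Longrightarrow> h 0 = 0 \<Longrightarrow> map_coeffs h p \<in> forms UNIV n d"
  using keys_map_coeffs[of h p] by (auto simp: forms_iff)

lemma forms_UNIV_scale: "p \<in> forms UNIV n d \<Longrightarrow> scale_vars c p \<in> forms UNIV n d"
  using keys_scale_vars[of c p] by (auto simp: forms_iff)

lemma hom_eval_homogeneous:
  assumes "p \<in> forms E n d"
  shows "hom_eval h p (\<lambda>i. c * v i) = c ^ d * hom_eval h p v"
proof -
  have "mdeg m = d" if "m \<in> Poly_Mapping.keys p" for m using assms that by (simp add: forms_iff)
  then show ?thesis
    unfolding hom_eval_def sum_distrib_left
    by (intro sum.cong) (auto simp: monom_eval_scale[of _ "\<lambda>_. c"] monom_eval_const mult_ac)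
qed

lemmas mpol_eval_homogeneous = hom_eval_homogeneous[of _ _ _ _ "\<lambda>x. x", folded mpol_eval_hom_eval]

lemma mpol_eval_cong:
  assumes "p \<in> forms E n d" "\<And>i. i \<le> n \<Longrightarrow> v i = w i"
  shows "mpol_eval p v = mpol_eval p w"
  unfolding mpol_eval_hom_eval using assms
  by (intro hom_eval_cong[of p "{..n}"]) (auto simp: forms_iff)

lemmas mpol_eval_add = hom_eval_add[OF is_ring_hom_id, folded mpol_eval_hom_eval]
lemmas mpol_eval_mult = hom_eval_mult[OF is_ring_hom_id, folded mpol_eval_hom_eval]
lemmas mpol_eval_power = hom_eval_power[OF is_ring_hom_id, folded mpol_eval_hom_eval]
lemmas mpol_eval_sum = hom_eval_sum[OF is_ring_hom_id, folded mpol_eval_hom_eval]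
lemmas mpol_eval_diff = hom_eval_diff[OF is_ring_hom_id, folded mpol_eval_hom_eval]
lemmas mpol_eval_Var [simp] = hom_eval_Var[OF is_ring_hom_id, folded mpol_eval_hom_eval]
lemmas mpol_eval_Const [simp] = hom_eval_Const[OF is_ring_hom_id, folded mpol_eval_hom_eval]


section \<open>Ternary forms and their derivatives\<close>

lemma atMost_2: "{..2::nat} = {0, 1, 2}" by auto

lemma monom_eval_ternary:
  assumes "Poly_Mapping.keys m \<subseteq> {..2}"
  shows "monom_eval m v = v 0 ^ Poly_Mapping.lookup m 0 * v 1 ^ Poly_Mapping.lookup m 1 * v 2 ^ Poly_Mapping.lookup m 2"
  using monom_eval_superset[of "{..2}" m v] assms by (simp add: atMost_2 mult_ac)

lemma mdeg_ternary:
  assumes "Poly_Mapping.keys m \<subseteq> {..2}"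
  shows "mdeg m = Poly_Mapping.lookup m 0 + Poly_Mapping.lookup m 1 + Poly_Mapping.lookup m 2"
  using mdeg_superset[of "{..2}" m] assms by (simp add: atMost_2)

lemma monom_eval_minus_single:
  assumes "Poly_Mapping.keys m \<subseteq> {..2}"
  shows "monom_eval (m - Poly_Mapping.single i 1) v =
    v 0 ^ (Poly_Mapping.lookup m 0 - (if i = 0 then 1 else 0)) *
    v 1 ^ (Poly_Mapping.lookup m 1 - (if i = 1 then 1 else 0)) *
    v 2 ^ (Poly_Mapping.lookup m 2 - (if i = 2 then 1 else 0))"
proof -
  have "Poly_Mapping.keys (m - Poly_Mapping.single i 1) \<subseteq> {..2}"
    using assms by (auto simp: in_keys_iff lookup_minus subset_iff)
  then show ?thesis
    by (subst monom_eval_ternary) (auto simp: lookup_minus lookup_single when_def)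
qed

lemma hom_eval_pderiv:
  assumes "is_ring_hom h" "p \<in> forms E 2 d"
  shows "hom_eval h (mpol_pderiv i p) v = (\<Sum>m\<in>Poly_Mapping.keys p. h (Poly_Mapping.lookup p m) *
    of_nat (Poly_Mapping.lookup m i) * monom_eval (m - Poly_Mapping.single i 1) v)"
  unfolding mpol_pderiv_def
  by (simp add: hom_eval_sum hom_eval_single assms is_ring_homD[OF assms(1)] is_ring_hom_of_nat mult_ac)

lemma euler_relation:
  assumes h: "is_ring_hom h" and p: "p \<in> forms E 2 d"
  shows "v 0 * hom_eval h (mpol_pderiv 0 p) v + v 1 * hom_eval h (mpol_pderiv 1 p) v
     + v 2 * hom_eval h (mpol_pderiv 2 p) v = of_nat d * hom_eval h p v"
proof -
  have *: "v i * (of_nat (Poly_Mapping.lookup m i) * monom_eval (m - Poly_Mapping.single i 1) v)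
      = of_nat (Poly_Mapping.lookup m i) * monom_eval m v"
    if "Poly_Mapping.keys m \<subseteq> {..2}" "i \<le> 2" for m i
  proof (cases "Poly_Mapping.lookup m i")
    case (Suc n)
    have "i = 0 \<or> i = 1 \<or> i = 2" using that(2) by auto
    then show ?thesis
      unfolding monom_eval_minus_single[OF that(1)] monom_eval_ternary[OF that(1)] using Suc
      by (auto simp: algebra_simps)
  qed simp
  have "v 0 * hom_eval h (mpol_pderiv 0 p) v + v 1 * hom_eval h (mpol_pderiv 1 p) v
     + v 2 * hom_eval h (mpol_pderiv 2 p) v =
    (\<Sum>m\<in>Poly_Mapping.keys p. h (Poly_Mapping.lookup p m) *
      (v 0 * (of_nat (Poly_Mapping.lookup m 0) * monom_eval (m - Poly_Mapping.single 0 1) v)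
       + v 1 * (of_nat (Poly_Mapping.lookup m 1) * monom_eval (m - Poly_Mapping.single 1 1) v)
       + v 2 * (of_nat (Poly_Mapping.lookup m 2) * monom_eval (m - Poly_Mapping.single 2 1) v)))"
    unfolding hom_eval_pderiv[OF h p] sum_distrib_left sum.distrib[symmetric]
    by (intro sum.cong) (simp_all add: distrib_left mult_ac)
  also have "\<dots> = (\<Sum>m\<in>Poly_Mapping.keys p. h (Poly_Mapping.lookup p m) * (of_nat (mdeg m) * monom_eval m v))"
    using p by (intro sum.cong refl, subst (1 2 3) *)
      (auto simp: forms_iff mdeg_ternary distrib_left distrib_right)
  also have "\<dots> = of_nat d * hom_eval h p v"
    using p unfolding hom_eval_def sum_distrib_left
    by (intro sum.cong) (auto simp: forms_iff algebra_simps)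
  finally show ?thesis .
qed

text \<open>The chain rule along a power series curve.\<close>

lemma fps_deriv_hom_eval:
  fixes w :: "nat \<Rightarrow> 'a::field fps"
  assumes p: "p \<in> forms E 2 d"
  shows "fps_deriv (hom_eval fps_const p w) =
    hom_eval fps_const (mpol_pderiv 0 p) w * fps_deriv (w 0) +
    hom_eval fps_const (mpol_pderiv 1 p) w * fps_deriv (w 1) +
    hom_eval fps_const (mpol_pderiv 2 p) w * fps_deriv (w 2)"
proof -
  have *: "fps_deriv (fps_const c * monom_eval m w) =
    fps_const c * of_nat (Poly_Mapping.lookup m 0) * monom_eval (m - Poly_Mapping.single 0 1) w * fps_deriv (w 0) +
    fps_const c * of_nat (Poly_Mapping.lookup m 1) * monom_eval (m - Poly_Mapping.single 1 1) w * fps_deriv (w 1) +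
    fps_const c * of_nat (Poly_Mapping.lookup m 2) * monom_eval (m - Poly_Mapping.single 2 1) w * fps_deriv (w 2)"
    if "Poly_Mapping.keys m \<subseteq> {..2}" for m c
    unfolding monom_eval_minus_single[OF that] monom_eval_ternary[OF that]
    by (simp add: fps_deriv_power algebra_simps fps_of_nat)
  show ?thesis
    unfolding hom_eval_pderiv[OF is_ring_hom_fps_const p] sum_distrib_right sum.distrib[symmetric]
    unfolding hom_eval_def fps_deriv_sum using p
    by (intro sum.cong refl *) (auto simp: forms_iff)
qed

lemma forms_pderiv:
  fixes p :: "'a::field mpol"
  assumes "p \<in> forms UNIV 2 (Suc d)"
  shows "mpol_pderiv i p \<in> forms UNIV 2 d"
  unfolding mpol_pderiv_def
proof (intro forms_sum is_subfield_UNIV)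
  fix m assume "m \<in> Poly_Mapping.keys p"
  then have m: "Poly_Mapping.keys m \<subseteq> {..2}" "mdeg m = Suc d" using assms by (auto simp: forms_iff)
  show "Poly_Mapping.single (m - Poly_Mapping.single i 1)
      (of_nat (Poly_Mapping.lookup m i) * Poly_Mapping.lookup p m) \<in> forms UNIV 2 d"
  proof (cases "Poly_Mapping.lookup m i = 0")
    case True then show ?thesis by (simp add: forms_zero is_subfield_UNIV)
  next
    case False
    then have m': "m - Poly_Mapping.single i 1 + Poly_Mapping.single i 1 = m"
      by (intro poly_mapping_eqI) (auto simp: lookup_add lookup_minus lookup_single when_def)
    then have "mdeg (m - Poly_Mapping.single i 1) + 1 = mdeg m"
      by (metis mdeg_add mdeg_single)
    moreover have "Poly_Mapping.keys (m - Poly_Mapping.single i 1) \<subseteq> {..2}"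
      using m by (auto simp: in_keys_iff lookup_minus subset_iff)
    ultimately show ?thesis using m by (intro forms_single is_subfield_UNIV) auto
  qed
qed

lemma pderiv_constant:
  assumes "p \<in> forms UNIV 2 0"
  shows "mpol_pderiv i p = 0"
proof -
  have "Poly_Mapping.lookup m i = 0" if "m \<in> Poly_Mapping.keys p" for m
  proof -
    have "Poly_Mapping.keys m \<subseteq> {..2}" "mdeg m = 0" using assms that by (auto simp: forms_iff)
    then show ?thesis unfolding mdeg_def by (metis finite_keys in_keys_iff sum_eq_0_iff)
  qed
  then show ?thesis unfolding mpol_pderiv_def by (intro sum.neutral) auto
qed

text \<open>Stated so as to cover the degree \<open>d = 0\<close>.\<close>

lemma forms_mult_pderiv:
  fixes p :: "'a::field mpol"
  assumes "p \<in> forms UNIV 2 d" "q \<in> forms UNIV 2 3"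
  shows "q * mpol_pderiv i p \<in> forms UNIV 2 (d + 2)"
proof (cases d)
  case 0
  then show ?thesis using assms by (simp add: pderiv_constant forms_zero is_subfield_UNIV)
next
  case (Suc d')
  then show ?thesis
    using forms_mult[OF is_subfield_UNIV assms(2) forms_pderiv[of p d' i]] assms(1)
    by (simp add: numeral_3_eq_3)
qed


section \<open>Averaging over the Galois group\<close>

text \<open>Artin's independence of characters: if \<open>m\<close> separates \<open>h\<close> from \<open>g\<close>, then subtracting \<open>g(m)\<close> times
  the relation at \<open>x\<close> from the relation at \<open>m x\<close> eliminates \<open>g\<close> but not \<open>h\<close>.\<close>

lemma independence_of_characters:
  fixes c :: "('m \<Rightarrow> 'b::field) \<Rightarrow> 'b"
  assumes "finite H" "one \<in> M" "\<And>x y. x \<in> M \<Longrightarrow> y \<in> M \<Longrightarrow> mul x y \<in> M"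
    and "\<And>h. h \<in> H \<Longrightarrow> h one = 1"
    and "\<And>h x y. h \<in> H \<Longrightarrow> x \<in> M \<Longrightarrow> y \<in> M \<Longrightarrow> h (mul x y) = h x * h y"
    and "\<And>h h'. h \<in> H \<Longrightarrow> h' \<in> H \<Longrightarrow> \<forall>x\<in>M. h x = h' x \<Longrightarrow> h = h'"
    and "\<And>x. x \<in> M \<Longrightarrow> (\<Sum>h\<in>H. c h * h x) = 0"
  shows "\<forall>h\<in>H. c h = 0"
  using assms(1,4-7)
proof (induction H arbitrary: c rule: finite_induct)
  case (insert g H)
  have zero: "(\<Sum>h\<in>H. c h * h x) = - c g * g x" if "x \<in> M" for x
    using insert.prems(4)[OF that] insert.hyps by (simp add: eq_neg_iff_add_eq_0 add.commute)
  have H: "c h = 0" if h: "h \<in> H" for h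
  proof -
    have "h \<noteq> g" using h insert.hyps by auto
    then obtain m where m: "m \<in> M" "h m \<noteq> g m" using insert.prems(3)[of h g] h by auto
    have "\<forall>h\<in>H. c h * (h m - g m) = 0"
    proof (rule insert.IH)
      fix x assume x: "x \<in> M"
      have "(\<Sum>h\<in>H. c h * (h m - g m) * h x) = (\<Sum>h\<in>H. c h * h (mul m x)) - g m * (\<Sum>h\<in>H. c h * h x)"
        unfolding sum_distrib_left sum_subtractf[symmetric]
        using insert.prems(2) m x by (intro sum.cong) (auto simp: algebra_simps)
      also have "\<dots> = 0"
        using zero[of "mul m x"] zero[of x] m x assms(3) insert.prems(2)[of g m x]
        by (simp add: algebra_simps)
      finally show "(\<Sum>h\<in>H. c h * (h m - g m) * h x) = 0" .
    qed (use insert.prems in auto)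
    then show ?thesis using h m by auto
  qed
  then have "(\<Sum>h\<in>H. c h * h one) = 0" by simp
  then have "c g = 0" using zero[OF assms(2)] insert.prems(1)[of g] by simp
  then show ?case using H by auto
qed simp

lemma finite_galois_orbit:
  assumes "algebraic_extension_of k"
  shows "finite ((\<lambda>\<sigma>. \<sigma> x) ` galois_group k)"
proof -
  obtain p where p: "p \<noteq> 0" "\<And>i. coeff p i \<in> k" "poly p x = 0"
    using assms unfolding algebraic_extension_of_def by blast
  then have "(\<lambda>\<sigma>. \<sigma> x) ` galois_group k \<subseteq> {y. poly p y = 0}"
    using galois_group_poly_root by blast
  then show ?thesis using poly_roots_finite[OF p(1)] finite_subset by blast
qed

definition agree_on :: "'b set \<Rightarrow> ('b \<Rightarrow> 'c) \<Rightarrow> ('b \<Rightarrow> 'c) \<Rightarrow> bool" where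
  "agree_on T f g \<longleftrightarrow> (\<forall>t\<in>T. f t = g t)"

text \<open>All quantities that only depend on the action of \<open>\<sigma>\<close> on a finite set \<open>T\<close> can be averaged
  over a finite set \<open>H\<close> of representatives, as if the Galois group were finite.
  The elements \<open>\<theta>\<close> on which the action is determined by that on \<open>T\<close> are enough to produce nonzero
  averages, by independence of characters.\<close>

definition galois_transversal :: "'a::field set \<Rightarrow> 'a set \<Rightarrow> ('a \<Rightarrow> 'a) set \<Rightarrow> bool" where
  "galois_transversal k T H \<longleftrightarrow> finite H \<and> H \<subseteq> galois_group k \<and> (\<exists>h\<in>H. agree_on T h (\<lambda>x. x)) \<and>
     (\<forall>f :: ('a \<Rightarrow> 'a) \<Rightarrow> 'a. (\<forall>\<sigma>\<in>galois_group k. \<forall>\<tau>\<in>galois_group k. agree_on T \<sigma> \<tau> \<longrightarrow> f \<sigma> = f \<tau>) \<longrightarrow>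
       (\<forall>g\<in>galois_group k. (\<Sum>h\<in>H. f (g \<circ> h)) = sum f H)) \<and>
     (\<forall>c :: ('a \<Rightarrow> 'a) \<Rightarrow> 'a. (\<exists>h\<in>H. c h \<noteq> 0) \<longrightarrow>
       (\<exists>\<theta>. (\<forall>\<sigma>\<in>galois_group k. \<forall>\<tau>\<in>galois_group k. agree_on T \<sigma> \<tau> \<longrightarrow> \<sigma> \<theta> = \<tau> \<theta>) \<and>
         (\<Sum>h\<in>H. c h * h \<theta>) \<noteq> 0))"

lemma galois_transversalD:
  fixes k :: "'a::field set" and f c :: "('a \<Rightarrow> 'a) \<Rightarrow> 'a"
  assumes "galois_transversal k T H"
  shows "finite H" "H \<subseteq> galois_group k" "\<exists>h\<in>H. agree_on T h (\<lambda>x. x)"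
    "(\<And>\<sigma> \<tau>. \<sigma> \<in> galois_group k \<Longrightarrow> \<tau> \<in> galois_group k \<Longrightarrow> agree_on T \<sigma> \<tau> \<Longrightarrow> f \<sigma> = f \<tau>) \<Longrightarrow>
       g \<in> galois_group k \<Longrightarrow> (\<Sum>h\<in>H. f (g \<circ> h)) = sum f H"
    "h \<in> H \<Longrightarrow> c h \<noteq> 0 \<Longrightarrow> \<exists>\<theta>. (\<forall>\<sigma>\<in>galois_group k. \<forall>\<tau>\<in>galois_group k. agree_on T \<sigma> \<tau> \<longrightarrow> \<sigma> \<theta> = \<tau> \<theta>) \<and>
         (\<Sum>h\<in>H. c h * h \<theta>) \<noteq> 0"
proof -
  note * = assms[unfolded galois_transversal_def]
  show "finite H" "H \<subseteq> galois_group k" "\<exists>h\<in>H. agree_on T h (\<lambda>x. x)"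
    by (rule *[THEN conjunct1] *[THEN conjunct2, THEN conjunct1]
        *[THEN conjunct2, THEN conjunct2, THEN conjunct1])+
  show "(\<Sum>h\<in>H. f (g \<circ> h)) = sum f H"
    if "\<And>\<sigma> \<tau>. \<sigma> \<in> galois_group k \<Longrightarrow> \<tau> \<in> galois_group k \<Longrightarrow> agree_on T \<sigma> \<tau> \<Longrightarrow> f \<sigma> = f \<tau>"
      "g \<in> galois_group k"
  proof -
    have "\<forall>g\<in>galois_group k. (\<Sum>h\<in>H. f (g \<circ> h)) = sum f H"
      by (rule *[THEN conjunct2, THEN conjunct2, THEN conjunct2, THEN conjunct1, THEN spec, THEN mp])
        (use that(1) in blast)
    then show ?thesis using that(2) by (rule bspec)
  qed
  show "\<exists>\<theta>. (\<forall>\<sigma>\<in>galois_group k. \<forall>\<tau>\<in>galois_group k. agree_on T \<sigma> \<tau> \<longrightarrow> \<sigma> \<theta> = \<tau> \<theta>) \<and>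
         (\<Sum>h\<in>H. c h * h \<theta>) \<noteq> 0" if "h \<in> H" "c h \<noteq> 0"
    by (rule *[THEN conjunct2, THEN conjunct2, THEN conjunct2, THEN conjunct2, THEN spec, THEN mp])
      (use that in blast)
qed

lemma ex_galois_transversal:
  fixes k :: "'a::field set"
  assumes "algebraic_extension_of k" "finite T"
  shows "\<exists>H. galois_transversal k T H"
proof -
  let ?G = "galois_group k"
  define r where "r \<sigma> = (SOME \<tau>. \<tau> \<in> ?G \<and> agree_on T \<tau> \<sigma>)" for \<sigma>
  have r: "r \<sigma> \<in> ?G" "agree_on T (r \<sigma>) \<sigma>" if "\<sigma> \<in> ?G" for \<sigma>
    using someI[of "\<lambda>\<tau>. \<tau> \<in> ?G \<and> agree_on T \<tau> \<sigma>" \<sigma>] that unfolding r_def by (auto simp: agree_on_def)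
  have r_eq: "r \<sigma> = r \<tau>" if "agree_on T \<sigma> \<tau>" for \<sigma> \<tau>
  proof -
    have "agree_on T \<rho> \<sigma> \<longleftrightarrow> agree_on T \<rho> \<tau>" for \<rho> using that by (auto simp: agree_on_def)
    then show ?thesis unfolding r_def by simp
  qed
  define H where "H = r ` ?G"
  have HG: "H \<subseteq> ?G" using r by (auto simp: H_def)
  have rH: "r h = h" if "h \<in> H" for h using that r r_eq by (auto simp: H_def)
  have H_eq: "h = h'" if "h \<in> H" "h' \<in> H" "agree_on T h h'" for h h'
    using r_eq[OF that(3)] rH that by simp
  have fin: "finite H"
  proof (rule inj_on_finite)
    show "inj_on (\<lambda>h. restrict h T) H"
      by (rule inj_onI) (metis H_eq agree_on_def restrict_apply')
    show "(\<lambda>h. restrict h T) ` H \<subseteq> PiE T (\<lambda>t. (\<lambda>\<sigma>. \<sigma> t) ` ?G)" using HG by auto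
    show "finite (PiE T (\<lambda>t. (\<lambda>\<sigma>. \<sigma> t) ` ?G))"
      using assms finite_galois_orbit by (intro finite_PiE) auto
  qed
  have id: "r (\<lambda>x. x) \<in> H" "agree_on T (r (\<lambda>x. x)) (\<lambda>x. x)"
    using galois_group_id[of k] r by (auto simp: H_def)
  have sum: "(\<Sum>h\<in>H. f (g \<circ> h)) = sum f H"
    if f: "\<And>\<sigma> \<tau>. \<sigma> \<in> ?G \<Longrightarrow> \<tau> \<in> ?G \<Longrightarrow> agree_on T \<sigma> \<tau> \<Longrightarrow> f \<sigma> = f \<tau>" and g: "g \<in> ?G"
    for f :: "('a \<Rightarrow> 'a) \<Rightarrow> 'a" and g
  proof -
    have in_G: "g \<circ> h \<in> ?G" if "h \<in> H" for h using galois_group_comp[OF g] HG that by blast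
    have inj: "inj_on (\<lambda>h. r (g \<circ> h)) H"
    proof (rule inj_onI)
      fix h h' assume h: "h \<in> H" "h' \<in> H" "r (g \<circ> h) = r (g \<circ> h')"
      then have "agree_on T (g \<circ> h) (g \<circ> h')"
        using r(2)[OF in_G[OF h(1)]] r(2)[OF in_G[OF h(2)]] by (simp add: agree_on_def)
      then have "agree_on T h h'" using galois_group_props(13)[OF g] by (simp add: agree_on_def)
      then show "h = h'" using H_eq h by blast
    qed
    have "(\<lambda>h. r (g \<circ> h)) ` H \<subseteq> H" using in_G by (auto simp: H_def)
    then have "(\<lambda>h. r (g \<circ> h)) ` H = H" using fin inj by (metis endo_inj_surj)
    then have "sum f H = (\<Sum>h\<in>H. f (r (g \<circ> h)))" using sum.reindex[OF inj, of f] by simp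
    also have "\<dots> = (\<Sum>h\<in>H. f (g \<circ> h))" using r in_G by (intro sum.cong f) auto
    finally show ?thesis by simp
  qed
  define M where "M = {\<theta>. \<forall>\<sigma>\<in>?G. \<forall>\<tau>\<in>?G. agree_on T \<sigma> \<tau> \<longrightarrow> \<sigma> \<theta> = \<tau> \<theta>}"
  have ind: "\<exists>\<theta>\<in>M. (\<Sum>h\<in>H. c h * h \<theta>) \<noteq> 0" if "h \<in> H" "c h \<noteq> 0" for c :: "('a \<Rightarrow> 'a) \<Rightarrow> 'a" and h
  proof (rule ccontr)
    assume "\<not> ?thesis"
    then have z: "\<And>\<theta>. \<theta> \<in> M \<Longrightarrow> (\<Sum>h\<in>H. c h * h \<theta>) = 0" by blast
    have "\<forall>h\<in>H. c h = 0"
    proof (rule independence_of_characters[of H 1 M "(*)", OF fin _ _ _ _ _ z])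
      show "1 \<in> M" by (auto simp: M_def galois_group_props(6))
      show "x * y \<in> M" if "x \<in> M" "y \<in> M" for x y
        using that galois_group_props(3)[of _ k] unfolding M_def by simp metis
      show "h 1 = 1" if "h \<in> H" for h using galois_group_props(6) HG that by blast
      show "h (x * y) = h x * h y" if "h \<in> H" for h x y
        using galois_group_props(3) HG that by blast
      show "h = h'" if "h \<in> H" "h' \<in> H" "\<forall>x\<in>M. h x = h' x" for h h'
      proof -
        have "T \<subseteq> M" by (auto simp: M_def agree_on_def)
        then show ?thesis using H_eq that by (meson agree_on_def subsetD)
      qed
    qed
    then show False using that by blast
  qed
  show ?thesis
    unfolding galois_transversal_def
  proof (intro exI[of _ H] conjI allI impI ballI)
    show "\<exists>h\<in>H. agree_on T h (\<lambda>x. x)" using id by blast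
    show "(\<Sum>h\<in>H. f (g \<circ> h)) = sum f H"
      if "\<forall>\<sigma>\<in>?G. \<forall>\<tau>\<in>?G. agree_on T \<sigma> \<tau> \<longrightarrow> f \<sigma> = f \<tau>" "g \<in> ?G" for f :: "('a \<Rightarrow> 'a) \<Rightarrow> 'a" and g
      using that by (intro sum) auto
    show "\<exists>\<theta>. (\<forall>\<sigma>\<in>?G. \<forall>\<tau>\<in>?G. agree_on T \<sigma> \<tau> \<longrightarrow> \<sigma> \<theta> = \<tau> \<theta>) \<and> (\<Sum>h\<in>H. c h * h \<theta>) \<noteq> 0"
      if "\<exists>h\<in>H. c h \<noteq> 0" for c :: "('a \<Rightarrow> 'a) \<Rightarrow> 'a"
      using that ind[where c = c] unfolding M_def by blast
  qed (fact fin HG)+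
qed

text \<open>Hilbert's Theorem 90. Continuity is expressed by a finite set \<open>T\<close> on which the action of \<open>\<sigma>\<close>
  determines \<open>\<gamma> \<sigma>\<close>. The element \<open>\<alpha>\<close> is a Poincare series, that is, an average of the \<open>\<gamma>(h) h(\<theta>)\<close>.\<close>

theorem hilbert_90:
  fixes k :: "'a::field set"
  assumes "algebraic_extension_of k" "finite T"
    and cont: "\<And>\<sigma> \<tau>. \<sigma> \<in> galois_group k \<Longrightarrow> \<tau> \<in> galois_group k \<Longrightarrow> agree_on T \<sigma> \<tau> \<Longrightarrow> \<gamma> \<sigma> = \<gamma> \<tau>"
    and cocycle: "\<And>\<sigma> \<tau>. \<sigma> \<in> galois_group k \<Longrightarrow> \<tau> \<in> galois_group k \<Longrightarrow> \<gamma> (\<sigma> \<circ> \<tau>) = \<gamma> \<sigma> * \<sigma> (\<gamma> \<tau>)"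
    and nonzero: "\<And>\<sigma>. \<sigma> \<in> galois_group k \<Longrightarrow> \<gamma> \<sigma> \<noteq> (0::'a)"
  shows "\<exists>\<alpha>. \<alpha> \<noteq> 0 \<and> (\<forall>\<sigma>\<in>galois_group k. \<gamma> \<sigma> * \<sigma> \<alpha> = \<alpha>)"
proof -
  obtain H where "galois_transversal k T H" using ex_galois_transversal assms(1,2) by blast
  note H = galois_transversalD[OF this]
  obtain h0 where "h0 \<in> H" using H(3) by blast
  obtain \<theta> where \<theta>: "\<And>\<sigma> \<tau>. \<sigma> \<in> galois_group k \<Longrightarrow> \<tau> \<in> galois_group k \<Longrightarrow> agree_on T \<sigma> \<tau> \<Longrightarrow> \<sigma> \<theta> = \<tau> \<theta>"
    and nz: "(\<Sum>h\<in>H. \<gamma> h * h \<theta>) \<noteq> 0"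
    using H(5)[of h0 \<gamma>, OF \<open>h0 \<in> H\<close>] nonzero H(2) \<open>h0 \<in> H\<close> by blast
  have "\<gamma> \<sigma> * \<sigma> (\<Sum>h\<in>H. \<gamma> h * h \<theta>) = (\<Sum>h\<in>H. \<gamma> h * h \<theta>)" if \<sigma>: "\<sigma> \<in> galois_group k" for \<sigma>
  proof -
    have "\<gamma> \<sigma> * \<sigma> (\<Sum>h\<in>H. \<gamma> h * h \<theta>) = (\<Sum>h\<in>H. \<gamma> (\<sigma> \<circ> h) * (\<sigma> \<circ> h) \<theta>)"
      unfolding galois_group_props(11)[OF \<sigma>] sum_distrib_left
      using cocycle[OF \<sigma>] H(2) by (intro sum.cong) (auto simp: galois_group_props(3)[OF \<sigma>] mult_ac)
    also have "\<dots> = (\<Sum>h\<in>H. \<gamma> h * h \<theta>)"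
    proof (rule H(4)[OF _ \<sigma>, of "\<lambda>h. \<gamma> h * h \<theta>"])
      show "\<gamma> \<tau> * \<tau> \<theta> = \<gamma> \<tau>' * \<tau>' \<theta>"
        if "\<tau> \<in> galois_group k" "\<tau>' \<in> galois_group k" "agree_on T \<tau> \<tau>'" for \<tau> \<tau>'
        using cont[OF that] \<theta>[OF that] by simp
    qed
    finally show ?thesis .
  qed
  then show ?thesis using nz by blast
qed


section \<open>Projective points and Galois descent of morphisms\<close>

lemma proj_point_self: "v \<in> proj_point v"
  unfolding proj_point_def by (auto intro!: exI[of _ 1])

lemma proj_point_mem_iff: "w \<in> proj_point v \<longleftrightarrow> (\<exists>c. c \<noteq> 0 \<and> w = (\<lambda>i. c * v i))"
  by (auto simp: proj_point_def)

lemma proj_point_scale: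
  assumes "c \<noteq> 0" shows "proj_point (\<lambda>i. c * v i) = proj_point v"
proof (intro set_eqI iffI)
  fix w assume "w \<in> proj_point (\<lambda>i. c * v i)"
  then obtain d where "d \<noteq> 0" "w = (\<lambda>i. d * (c * v i))" by (auto simp: proj_point_def)
  then show "w \<in> proj_point v"
    using assms by (auto simp: proj_point_def fun_eq_iff intro!: exI[of _ "d * c"])
next
  fix w assume "w \<in> proj_point v"
  then obtain d where "d \<noteq> 0" "w = (\<lambda>i. d * v i)" by (auto simp: proj_point_def)
  then show "w \<in> proj_point (\<lambda>i. c * v i)"
    using assms by (auto simp: proj_point_def fun_eq_iff intro!: exI[of _ "d / c"])
qed

lemma proj_point_eqI: "w \<in> proj_point v \<Longrightarrow> proj_point w = proj_point v"
  using proj_point_scale by (auto simp: proj_point_mem_iff)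

lemma proj_point_eq_iff: "proj_point w = proj_point v \<longleftrightarrow> (\<exists>c. c \<noteq> 0 \<and> w = (\<lambda>i. c * v i))"
  using proj_point_scale[of _ v] proj_point_self[of w] proj_point_mem_iff[of w v] by metis

lemma proj_spaceD:
  assumes "P \<in> proj_space n" "v \<in> P"
  shows "P = proj_point v" "\<exists>i\<le>n. v i \<noteq> 0" "i > n \<Longrightarrow> v i = 0"
proof -
  obtain w where w: "P = proj_point w" "\<exists>i. w i \<noteq> 0" "\<forall>i>n. w i = 0"
    using assms by (auto simp: proj_space_def)
  then obtain c where c: "c \<noteq> 0" "v = (\<lambda>i. c * w i)" using assms(2) by (auto simp: proj_point_mem_iff)
  show "P = proj_point v" using proj_point_eqI w assms(2) by blast
  show "i > n \<Longrightarrow> v i = 0" using c w by simp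
  show "\<exists>i\<le>n. v i \<noteq> 0" using c w by (metis mult_eq_0_iff not_le)
qed

lemma proj_space_nonempty: "P \<in> proj_space n \<Longrightarrow> \<exists>v. v \<in> P"
  using proj_point_self by (auto simp: proj_space_def)

lemma proj_spaceI: "i \<le> n \<Longrightarrow> v i \<noteq> 0 \<Longrightarrow> (\<And>i. i > n \<Longrightarrow> v i = 0) \<Longrightarrow> proj_point v \<in> proj_space n"
  unfolding proj_space_def by blast

lemma galois_point_proj_point:
  assumes "\<sigma> \<in> galois_group k"
  shows "galois_point \<sigma> (proj_point v) = proj_point (\<sigma> \<circ> v)"
proof (intro set_eqI iffI)
  note s = galois_group_props[OF assms]
  fix w
  { assume "w \<in> galois_point \<sigma> (proj_point v)"
    then obtain c where "c \<noteq> 0" "w = (\<lambda>i. \<sigma> c * \<sigma> (v i))"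
      by (auto simp: galois_point_def proj_point_def s comp_def)
    then show "w \<in> proj_point (\<sigma> \<circ> v)"
      using s(7)[of c] by (auto simp: proj_point_mem_iff comp_def) }
  { assume "w \<in> proj_point (\<sigma> \<circ> v)"
    then obtain c where c: "c \<noteq> 0" "w = (\<lambda>i. c * \<sigma> (v i))" by (auto simp: proj_point_def)
    have "w = \<sigma> \<circ> (\<lambda>i. inv \<sigma> c * v i)"
      using c galois_group_inv(2)[OF assms] by (simp add: fun_eq_iff s)
    moreover have "inv \<sigma> c \<noteq> 0" using c galois_group_inv(2)[OF assms, of c] s(5) by metis
    ultimately show "w \<in> galois_point \<sigma> (proj_point v)"
      unfolding galois_point_def by (intro image_eqI) (auto simp: proj_point_mem_iff) }
qed

lemma galois_point_comp: "galois_point (\<sigma> \<circ> \<tau>) P = galois_point \<sigma> (galois_point \<tau> P)"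
  unfolding galois_point_def image_image by (rule image_cong) (auto simp: comp_assoc)

lemma galois_point_inv:
  assumes "\<sigma> \<in> galois_group k"
  shows "galois_point \<sigma> (galois_point (inv \<sigma>) P) = P" "galois_point (inv \<sigma>) (galois_point \<sigma> P) = P"
proof -
  have "\<sigma> \<circ> inv \<sigma> = id" "inv \<sigma> \<circ> \<sigma> = id"
    using galois_group_inv(2,3)[OF assms] by (auto simp: fun_eq_iff)
  then show "galois_point \<sigma> (galois_point (inv \<sigma>) P) = P" "galois_point (inv \<sigma>) (galois_point \<sigma> P) = P"
    unfolding galois_point_comp[symmetric] by (simp_all add: galois_point_def)
qed

lemma galois_point_proj_space:
  assumes "\<sigma> \<in> galois_group k" "P \<in> proj_space n"
  shows "galois_point \<sigma> P \<in> proj_space n"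
proof -
  obtain v where v: "v \<in> P" using proj_space_nonempty assms(2) by blast
  note d = proj_spaceD[OF assms(2) v]
  obtain i where i: "i \<le> n" "v i \<noteq> 0" using d(2) by blast
  have "proj_point (\<sigma> \<circ> v) \<in> proj_space n"
    by (rule proj_spaceI[of i]) (use i d(3) galois_group_props(5,7)[OF assms(1)] in auto)
  then show ?thesis using galois_point_proj_point[OF assms(1), of v] d(1) by simp
qed

lemma proj_closed_galois:
  assumes "proj_closed k n V" "\<sigma> \<in> galois_group k" "P \<in> V"
  shows "galois_point \<sigma> P \<in> V"
proof -
  obtain S where S: "S \<subseteq> (\<Union>d. forms k n d)" "V = {P \<in> proj_space n. \<forall>f\<in>S. \<forall>v\<in>P. mpol_eval f v = 0}"
    using assms(1) by (auto simp: proj_closed_def)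
  note s = galois_group_props[OF assms(2)]
  have "mpol_eval f (\<sigma> \<circ> v) = 0" if f: "f \<in> S" and v: "v \<in> P" for f v
  proof -
    obtain d where "f \<in> forms k n d" using S f by blast
    then have "map_coeffs \<sigma> f = f"
      using s(4,5) by (intro map_coeffs_fixed) (auto simp: forms_iff)
    then have "mpol_eval f (\<sigma> \<circ> v) = \<sigma> (mpol_eval f v)" using galois_mpol_eval[OF assms(2)] by metis
    then show ?thesis using assms(3) S f v s(5) by auto
  qed
  then show ?thesis
    using S(2) assms(3) galois_point_proj_space[OF assms(2)] by (auto simp: galois_point_def)
qed

lemma morphism_over_rep:
  assumes "morphism_over E n V m W \<phi>" "P \<in> V"
  obtains d F where "\<And>j. j \<le> m \<Longrightarrow> F j \<in> forms E n d"
    "\<And>v. v \<in> P \<Longrightarrow> \<exists>j\<le>m. mpol_eval (F j) v \<noteq> 0"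
    "\<And>Q v j. Q \<in> V \<Longrightarrow> v \<in> Q \<Longrightarrow> j \<le> m \<Longrightarrow> mpol_eval (F j) v \<noteq> 0 \<Longrightarrow>
       \<phi> Q = proj_point (\<lambda>j. if j \<le> m then mpol_eval (F j) v else 0)"
proof -
  have "\<exists>d F. (\<forall>j\<le>m. F j \<in> forms E n d) \<and>
        (\<forall>v\<in>P. \<exists>j\<le>m. mpol_eval (F j) v \<noteq> 0) \<and>
        (\<forall>Q\<in>V. \<forall>v\<in>Q. (\<exists>j\<le>m. mpol_eval (F j) v \<noteq> 0) \<longrightarrow>
           \<phi> Q = proj_point (\<lambda>j. if j \<le> m then mpol_eval (F j) v else 0))"
    using assms unfolding morphism_over_def by blast
  then obtain d F where F: "\<forall>j\<le>m. F j \<in> forms E n d"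
    and nz: "\<forall>v\<in>P. \<exists>j\<le>m. mpol_eval (F j) v \<noteq> 0"
    and rep: "\<forall>Q\<in>V. \<forall>v\<in>Q. (\<exists>j\<le>m. mpol_eval (F j) v \<noteq> 0) \<longrightarrow>
           \<phi> Q = proj_point (\<lambda>j. if j \<le> m then mpol_eval (F j) v else 0)"
    by (elim exE conjE)
  show thesis
  proof (rule that)
    show "F j \<in> forms E n d" if "j \<le> m" for j using F that by blast
    show "\<exists>j\<le>m. mpol_eval (F j) v \<noteq> 0" if "v \<in> P" for v using nz that by blast
    show "\<phi> Q = proj_point (\<lambda>j. if j \<le> m then mpol_eval (F j) v else 0)"
      if "Q \<in> V" "v \<in> Q" "j \<le> m" "mpol_eval (F j) v \<noteq> 0" for Q v j
      using rep that by blast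
  qed
qed

text \<open>Averages of the conjugates of the forms that represent a morphism near \<open>P\<close> have coefficients
  in \<open>k\<close>. Equivariance means that all the conjugates, hence also their linear combinations,
  represent the same map.\<close>

theorem morphism_descent:
  fixes k :: "'a::{alg_closed_field, field_char_0} set"
  assumes k: "is_subfield k" "algebraic_extension_of k"
    and V: "V \<subseteq> proj_space n" "\<And>\<sigma> P. \<sigma> \<in> galois_group k \<Longrightarrow> P \<in> V \<Longrightarrow> galois_point \<sigma> P \<in> V"
    and W: "W \<subseteq> proj_space m"
    and \<psi>: "morphism_over UNIV n V m W \<psi>"
    and equiv: "\<And>\<sigma> P. \<sigma> \<in> galois_group k \<Longrightarrow> P \<in> V \<Longrightarrow> \<psi> (galois_point \<sigma> P) = galois_point \<sigma> (\<psi> P)"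
  shows "morphism_over k n V m W \<psi>"
  unfolding morphism_over_def
proof (intro conjI ballI)
  show "\<psi> ` V \<subseteq> W" using \<psi> by (simp add: morphism_over_def)
  fix P assume P: "P \<in> V"
  obtain d F where F: "\<And>j. j \<le> m \<Longrightarrow> F j \<in> forms UNIV n d"
    and nz: "\<And>v. v \<in> P \<Longrightarrow> \<exists>j\<le>m. mpol_eval (F j) v \<noteq> 0"
    and rep: "\<And>Q v j. Q \<in> V \<Longrightarrow> v \<in> Q \<Longrightarrow> j \<le> m \<Longrightarrow> mpol_eval (F j) v \<noteq> 0 \<Longrightarrow>
           \<psi> Q = proj_point (\<lambda>j. if j \<le> m then mpol_eval (F j) v else 0)"
    by (rule morphism_over_rep[OF \<psi> P]) (assumption | blast)+
  obtain v0 where v0: "v0 \<in> P" using P V(1) proj_space_nonempty by blast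
  obtain j0 where j0: "j0 \<le> m" "mpol_eval (F j0) v0 \<noteq> 0" using nz[OF v0] by blast
  define T where "T = (\<Union>j\<le>m. Poly_Mapping.lookup (F j) ` Poly_Mapping.keys (F j))"
  have "finite T" by (auto simp: T_def)
  obtain H where "galois_transversal k T H" using ex_galois_transversal k(2) \<open>finite T\<close> by blast
  note H = galois_transversalD[OF this]
  obtain h1 where h1: "h1 \<in> H" "agree_on T h1 (\<lambda>x. x)" using H(3) by blast
  have hG: "h \<in> galois_group k" if "h \<in> H" for h using H(2) that by blast
  have h0: "h 0 = 0" if "h \<in> H" for h using galois_group_props(5)[OF hG[OF that]] .
  have coeff_T: "\<sigma> (Poly_Mapping.lookup (F j) e) = \<tau> (Poly_Mapping.lookup (F j) e)"
    if "j \<le> m" "\<sigma> \<in> galois_group k" "\<tau> \<in> galois_group k" "agree_on T \<sigma> \<tau>" for j e \<sigma> \<tau>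
  proof (cases "e \<in> Poly_Mapping.keys (F j)")
    case True then show ?thesis using that by (auto simp: agree_on_def T_def)
  next
    case False then show ?thesis
      using galois_group_props(5)[OF that(2)] galois_group_props(5)[OF that(3)] by (simp add: in_keys_iff)
  qed
  have "map_coeffs h1 (F j0) = F j0"
    using coeff_T[OF j0(1) hG[OF h1(1)] galois_group_id h1(2)] h0[OF h1(1)] by (intro map_coeffs_fixed) auto
  then have "mpol_eval (map_coeffs h1 (F j0)) v0 \<noteq> 0" using j0 by simp
  from H(5)[of h1 "\<lambda>h. mpol_eval (map_coeffs h (F j0)) v0", OF h1(1) this]
  obtain \<theta> where \<theta>: "\<And>\<sigma> \<tau>. \<sigma> \<in> galois_group k \<Longrightarrow> \<tau> \<in> galois_group k \<Longrightarrow> agree_on T \<sigma> \<tau> \<Longrightarrow> \<sigma> \<theta> = \<tau> \<theta>"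
    and \<theta>nz: "(\<Sum>h\<in>H. mpol_eval (map_coeffs h (F j0)) v0 * h \<theta>) \<noteq> 0" by blast
  define F' where "F' j = (\<Sum>h\<in>H. Const (h \<theta>) * map_coeffs h (F j))" for j
  have F'_eval: "mpol_eval (F' j) v = (\<Sum>h\<in>H. h \<theta> * mpol_eval (map_coeffs h (F j)) v)" for j v
    by (simp add: F'_def mpol_eval_sum mpol_eval_mult)
  have lookup_F': "Poly_Mapping.lookup (F' j) e = (\<Sum>h\<in>H. h \<theta> * h (Poly_Mapping.lookup (F j) e))" for j e
    unfolding F'_def lookup_sum
  proof (intro sum.cong refl)
    fix h assume "h \<in> H"
    have "Const (h \<theta>) * map_coeffs h (F j) = Poly_Mapping.map ((*) (h \<theta>)) (map_coeffs h (F j))"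
      by (simp add: Const_def mult_map_scale_conv_mult)
    then show "Poly_Mapping.lookup (Const (h \<theta>) * map_coeffs h (F j)) e = h \<theta> * h (Poly_Mapping.lookup (F j) e)"
      using h0[OF \<open>h \<in> H\<close>] by (simp add: Poly_Mapping.map.rep_eq lookup_map_coeffs when_def)
  qed
  have F'_k: "F' j \<in> forms k n d" if j: "j \<le> m" for j
  proof -
    have "F' j \<in> forms UNIV n (0 + d)"
      unfolding F'_def
      by (intro forms_sum is_subfield_UNIV forms_mult forms_Const UNIV_I forms_UNIV_map F j h0)
    moreover have "Poly_Mapping.lookup (F' j) e \<in> k" for e
    proof (rule fixed_field_of_galois_group[OF k])
      fix \<sigma> assume \<sigma>: "\<sigma> \<in> galois_group k"
      have "\<sigma> (Poly_Mapping.lookup (F' j) e) =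
          (\<Sum>h\<in>H. (\<sigma> \<circ> h) \<theta> * (\<sigma> \<circ> h) (Poly_Mapping.lookup (F j) e))"
        by (simp add: lookup_F' galois_group_props[OF \<sigma>])
      also have "\<dots> = Poly_Mapping.lookup (F' j) e"
        unfolding lookup_F'
      proof (rule H(4)[OF _ \<sigma>, of "\<lambda>h. h \<theta> * h (Poly_Mapping.lookup (F j) e)"])
        show "\<sigma> \<theta> * \<sigma> (Poly_Mapping.lookup (F j) e) = \<tau> \<theta> * \<tau> (Poly_Mapping.lookup (F j) e)"
          if "\<sigma> \<in> galois_group k" "\<tau> \<in> galois_group k" "agree_on T \<sigma> \<tau>" for \<sigma> \<tau>
          using \<theta>[OF that] coeff_T[OF j that] by simp
      qed
      finally show "\<sigma> (Poly_Mapping.lookup (F' j) e) = Poly_Mapping.lookup (F' j) e" .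
    qed
    ultimately show ?thesis by (simp add: forms_iff)
  qed
  show "\<exists>d F. (\<forall>j\<le>m. F j \<in> forms k n d) \<and> (\<forall>v\<in>P. \<exists>j\<le>m. mpol_eval (F j) v \<noteq> 0) \<and>
        (\<forall>Q\<in>V. \<forall>v\<in>Q. (\<exists>j\<le>m. mpol_eval (F j) v \<noteq> 0) \<longrightarrow>
           \<psi> Q = proj_point (\<lambda>j. if j \<le> m then mpol_eval (F j) v else 0))"
  proof (rule exI[of _ d], rule exI[of _ F'], intro conjI allI impI ballI)
    show "F' j \<in> forms k n d" if "j \<le> m" for j using F'_k that .
  next
    fix v assume "v \<in> P"
    then have "v \<in> proj_point v0" using proj_spaceD(1)[OF subsetD[OF V(1) P] v0] by simp
    then obtain c where c: "c \<noteq> 0" "v = (\<lambda>i. c * v0 i)" by (auto simp: proj_point_mem_iff)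
    have "mpol_eval (F' j0) v = c ^ d * mpol_eval (F' j0) v0"
      unfolding c(2) using mpol_eval_homogeneous[OF F'_k[OF j0(1)]] .
    then show "\<exists>j\<le>m. mpol_eval (F' j) v \<noteq> 0"
      using j0(1) \<theta>nz c(1) by (intro exI[of _ j0]) (simp add: F'_eval mult.commute)
  next
    fix Q v assume Q: "Q \<in> V" and v: "v \<in> Q" and "\<exists>j\<le>m. mpol_eval (F' j) v \<noteq> 0"
    then obtain j1 where j1: "j1 \<le> m" "mpol_eval (F' j1) v \<noteq> 0" by blast
    have "\<psi> Q \<in> proj_space m" using Q W \<psi> by (auto simp: morphism_over_def)
    then obtain u where u: "u \<in> \<psi> Q" using proj_space_nonempty by blast
    note u' = proj_spaceD[OF \<open>\<psi> Q \<in> proj_space m\<close> u]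
    have "\<exists>l. \<forall>j\<le>m. mpol_eval (map_coeffs h (F j)) v = l * u j" if h: "h \<in> H" for h
    proof -
      define w where "w = inv h \<circ> v"
      have iG: "inv h \<in> galois_group k" using galois_group_inv hG h by blast
      have hw: "h \<circ> w = v" using galois_group_inv(2)[OF hG[OF h]] by (simp add: w_def fun_eq_iff)
      have ev: "mpol_eval (map_coeffs h (F j)) v = h (mpol_eval (F j) w)" for j
        using galois_mpol_eval[OF hG[OF h], of "F j" w] hw by simp
      show ?thesis
      proof (cases "\<exists>j\<le>m. mpol_eval (F j) w \<noteq> 0")
        case False
        then show ?thesis using h0[OF h] ev by (intro exI[of _ 0]) auto
      next
        case True
        then obtain j2 where j2: "j2 \<le> m" "mpol_eval (F j2) w \<noteq> 0" by blast
        have w: "w \<in> galois_point (inv h) Q" using v by (auto simp: w_def galois_point_def)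
        have "\<psi> Q = galois_point h (\<psi> (galois_point (inv h) Q))"
          using equiv[OF hG[OF h] V(2)[OF iG Q]] galois_point_inv(1)[OF hG[OF h]] by simp
        also have "\<dots> = proj_point (h \<circ> (\<lambda>j. if j \<le> m then mpol_eval (F j) w else 0))"
          using rep[OF V(2)[OF iG Q] w j2] galois_point_proj_point[OF hG[OF h]] by simp
        finally have "(h \<circ> (\<lambda>j. if j \<le> m then mpol_eval (F j) w else 0)) \<in> \<psi> Q"
          using proj_point_self by metis
        then obtain l where "(h \<circ> (\<lambda>j. if j \<le> m then mpol_eval (F j) w else 0)) = (\<lambda>i. l * u i)"
          using u'(1) proj_point_mem_iff by metis
        then have "h (mpol_eval (F j) w) = l * u j" if "j \<le> m" for j
          using that by (auto simp: fun_eq_iff dest: spec[of _ j])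
        then show ?thesis using ev by metis
      qed
    qed
    then obtain l where l: "\<And>h j. h \<in> H \<Longrightarrow> j \<le> m \<Longrightarrow> mpol_eval (map_coeffs h (F j)) v = l h * u j"
      by metis
    define c where "c = (\<Sum>h\<in>H. h \<theta> * l h)"
    have ev: "mpol_eval (F' j) v = c * u j" if "j \<le> m" for j
      using l that by (simp add: F'_eval c_def sum_distrib_right mult.assoc)
    then have "c \<noteq> 0" using j1 by auto
    moreover have "(\<lambda>j. if j \<le> m then mpol_eval (F' j) v else 0) = (\<lambda>j. c * u j)"
      using ev u'(3) by (auto simp: fun_eq_iff)
    ultimately show "\<psi> Q = proj_point (\<lambda>j. if j \<le> m then mpol_eval (F' j) v else 0)"
      using u'(1) proj_point_scale by metis
  qed
qed


section \<open>Binary forms\<close>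

definition vec3 :: "'b::zero \<Rightarrow> 'b \<Rightarrow> 'b \<Rightarrow> nat \<Rightarrow> 'b" where
  "vec3 x y z i = (if i = 0 then x else if i = 1 then y else if i = 2 then z else 0)"

lemma vec3_simps [simp]: "vec3 x y z 0 = x" "vec3 x y z 1 = y" "vec3 x y z (Suc 0) = y" "vec3 x y z 2 = z"
  "vec3 x y z (Suc (Suc 0)) = z" "i > 2 \<Longrightarrow> vec3 x y z i = 0"
  by (auto simp: vec3_def)

lemma Var_power: "(Var i :: 'a::comm_semiring_1 mpol) ^ n = Poly_Mapping.single (Poly_Mapping.single i n) 1"
proof (induction n)
  case (Suc n)
  then show ?case by (simp add: Var_def mult_single single_add[symmetric])
qed simp

lemma Const_mult: "Const (a * b) = (Const a * Const b :: 'a::comm_semiring_1 mpol)"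
  by (simp add: Const_def mult_single)

lemma Const_add: "Const (a + b) = (Const a + Const b :: 'a::comm_semiring_1 mpol)"
  by (simp add: Const_def single_add)

lemma Const_minus: "Const (- a) = (- Const a :: 'a::comm_ring_1 mpol)"
  by (simp add: Const_def single_uminus)

lemma Const_0 [simp]: "Const 0 = 0" by (simp add: Const_def)
lemma Const_1 [simp]: "Const 1 = (1 :: 'a::comm_semiring_1 mpol)" by (simp add: Const_def)

lemma single_ternary:
  fixes c :: "'a::comm_semiring_1"
  assumes "Poly_Mapping.keys m \<subseteq> {..2}"
  shows "Poly_Mapping.single m c =
    Const c * Var 0 ^ Poly_Mapping.lookup m 0 * Var 1 ^ Poly_Mapping.lookup m 1 * Var 2 ^ Poly_Mapping.lookup m 2"
proof -
  have "m = Poly_Mapping.single 0 (Poly_Mapping.lookup m 0) + Poly_Mapping.single 1 (Poly_Mapping.lookup m 1)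
      + Poly_Mapping.single 2 (Poly_Mapping.lookup m 2)"
  proof (rule poly_mapping_eqI)
    fix i
    have "i > 2 \<Longrightarrow> Poly_Mapping.lookup m i = 0" using assms by (force simp: in_keys_iff subset_iff)
    moreover have "i = 0 \<or> i = 1 \<or> i = 2 \<or> i > 2" by auto
    ultimately show "Poly_Mapping.lookup m i = Poly_Mapping.lookup (Poly_Mapping.single 0 (Poly_Mapping.lookup m 0)
       + Poly_Mapping.single 1 (Poly_Mapping.lookup m 1) + Poly_Mapping.single 2 (Poly_Mapping.lookup m 2)) i"
      by (auto simp: lookup_add lookup_single when_def)
  qed
  then show ?thesis
    unfolding Var_power Const_def mult_single by simp
qed

lemma single_binary:
  fixes c :: "'a::comm_semiring_1"
  assumes "Poly_Mapping.keys m \<subseteq> {..1}"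
  shows "Poly_Mapping.single m c = Const c * Var 0 ^ Poly_Mapping.lookup m 0 * Var 1 ^ Poly_Mapping.lookup m 1"
    "mdeg m = Poly_Mapping.lookup m 0 + Poly_Mapping.lookup m 1"
proof -
  have k: "Poly_Mapping.keys m \<subseteq> {..2}" using assms by auto
  have "2 \<notin> Poly_Mapping.keys m" using assms by auto
  then have "Poly_Mapping.lookup m 2 = 0" by (simp add: in_keys_iff)
  then show "Poly_Mapping.single m c = Const c * Var 0 ^ Poly_Mapping.lookup m 0 * Var 1 ^ Poly_Mapping.lookup m 1"
    "mdeg m = Poly_Mapping.lookup m 0 + Poly_Mapping.lookup m 1"
    using single_ternary[OF k, of c] mdeg_ternary[OF k] by simp_all
qed

lemma constant_form:
  assumes "p \<in> forms E n 0" shows "p = Const (Poly_Mapping.lookup p 0)"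
proof (rule poly_mapping_eqI)
  fix m
  have "m = 0" if "m \<in> Poly_Mapping.keys p"
  proof (rule poly_mapping_eqI)
    fix i
    have "mdeg m = 0" using assms that by (auto simp: forms_iff)
    then show "Poly_Mapping.lookup m i = Poly_Mapping.lookup 0 i"
      unfolding mdeg_def by (metis finite_keys in_keys_iff lookup_zero sum_eq_0_iff)
  qed
  then show "Poly_Mapping.lookup p m = Poly_Mapping.lookup (Const (Poly_Mapping.lookup p 0)) m"
    by (cases "m = 0") (auto simp: Const_def lookup_single in_keys_iff)
qed

text \<open>Modulo the linear form that vanishes at \<open>(x\<^sub>0 : y\<^sub>0)\<close>, the variables are multiples of one linear
  form with value \<open>1\<close> at \<open>(x\<^sub>0, y\<^sub>0)\<close>.\<close>

lemma binary_form_factor: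
  fixes p :: "'a::field mpol"
  assumes p: "p \<in> forms UNIV 1 (Suc e)" and xy: "x0 \<noteq> 0 \<or> y0 \<noteq> 0"
    and root: "mpol_eval p (vec3 x0 y0 0) = 0"
  shows "\<exists>p'\<in>forms UNIV 1 e. p = (Const y0 * Var 0 - Const x0 * Var 1) * p'"
proof -
  define lin where "lin = (Const y0 * Var 0 - Const x0 * Var 1 :: 'a mpol)"
  obtain r s where rs: "r * x0 + s * y0 = 1"
  proof (cases "x0 = 0")
    case True then show ?thesis using xy that[of 0 "1 / y0"] by simp
  next
    case False then show ?thesis using that[of "1 / x0" 0] by simp
  qed
  define \<Lambda> where "\<Lambda> = (Const r * Var 0 + Const s * Var 1 :: 'a mpol)"
  define v where "v = vec3 x0 y0 (0::'a)"
  have C: "Const c \<in> forms UNIV n 0" for c :: 'a and n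
    by (simp add: forms_Const is_subfield_UNIV)
  have V: "Var i \<in> forms (UNIV :: 'a set) 1 (Suc 0)" if "i \<le> 1" for i
    using forms_Var[OF is_subfield_UNIV that] by simp
  note fm = forms_mult[OF is_subfield_UNIV]
  note fa = forms_add[OF is_subfield_UNIV]
  have \<Lambda>f: "\<Lambda> \<in> forms UNIV 1 1"
    unfolding \<Lambda>_def by (intro fa) (use fm[OF C V] in auto)
  define R where "R e p \<longleftrightarrow> (\<exists>p'. p' \<in> forms UNIV 1 (e - 1) \<and> (e = 0 \<longrightarrow> p' = 0) \<and>
      p = Const (mpol_eval p v) * \<Lambda> ^ e + lin * p')" for e and p :: "'a mpol"
  have RC: "R 0 (Const c)" for c unfolding R_def
    by (intro exI[of _ 0]) (auto simp: forms_zero is_subfield_UNIV)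
  have c1: "Const (r * x0 + s * y0) = (1 :: 'a mpol)" using rs by simp
  have vx: "mpol_eval (Var 0) v = x0" and vy: "mpol_eval (Var 1) v = y0" by (simp_all add: v_def)
  have RX: "R 1 (Var 0)" unfolding R_def
  proof (intro exI[of _ "Const s"] conjI)
    have "Var 0 = Const (r * x0 + s * y0) * Var (0::nat)" using c1 by simp
    also have "\<dots> = Const x0 * \<Lambda> + lin * Const s"
      unfolding \<Lambda>_def lin_def by (simp add: Const_add Const_mult algebra_simps)
    finally show "Var 0 = Const (mpol_eval (Var 0) v) * \<Lambda> ^ 1 + lin * Const s"
      unfolding vx power_one_right .
  qed (use C in auto)
  have RY: "R 1 (Var 1)" unfolding R_def
  proof (intro exI[of _ "Const (- r)"] conjI)
    have "Var 1 = Const (r * x0 + s * y0) * Var (1::nat)" using c1 by simp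
    also have "\<dots> = Const y0 * \<Lambda> + lin * Const (- r)"
      unfolding \<Lambda>_def lin_def by (simp add: Const_add Const_mult Const_minus algebra_simps)
    finally show "Var 1 = Const (mpol_eval (Var 1) v) * \<Lambda> ^ 1 + lin * Const (- r)"
      unfolding vy power_one_right .
  qed (use C in auto)
  have Rmult: "R (e + f) (p * q)" if pq: "R e p" "R f q" "p \<in> forms UNIV 1 e" "q \<in> forms UNIV 1 f" for e f p q
  proof -
    obtain p' where p': "p' \<in> forms UNIV 1 (e - 1)" "e = 0 \<longrightarrow> p' = 0"
      "p = Const (mpol_eval p v) * \<Lambda> ^ e + lin * p'" using pq(1) by (auto simp: R_def)
    obtain q' where q': "q' \<in> forms UNIV 1 (f - 1)" "f = 0 \<longrightarrow> q' = 0"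
      "q = Const (mpol_eval q v) * \<Lambda> ^ f + lin * q'" using pq(2) by (auto simp: R_def)
    define w where "w = Const (mpol_eval p v) * \<Lambda> ^ e * q' + p' * q"
    have "Const (mpol_eval p v) * \<Lambda> ^ e * q' \<in> forms UNIV 1 (e + f - 1)"
    proof (cases f)
      case 0 then show ?thesis using q' by (simp add: forms_zero is_subfield_UNIV)
    next
      case (Suc f')
      then show ?thesis
        using fm[OF fm[OF C forms_power[OF is_subfield_UNIV \<Lambda>f, of e]] q'(1)] by simp
    qed
    moreover have "p' * q \<in> forms UNIV 1 (e + f - 1)"
    proof (cases e)
      case 0 then show ?thesis using p' by (simp add: forms_zero is_subfield_UNIV)
    next
      case (Suc e') then show ?thesis using fm[OF p'(1) pq(4)] by simp
    qed
    ultimately have "w \<in> forms UNIV 1 (e + f - 1)" unfolding w_def by (rule fa)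
    moreover have "p * q = Const (mpol_eval (p * q) v) * \<Lambda> ^ (e + f) + lin * w"
    proof -
      have "p * q = Const (mpol_eval p v) * \<Lambda> ^ e * q + lin * p' * q"
        by (subst (1) p'(3)) (simp add: algebra_simps)
      also have "Const (mpol_eval p v) * \<Lambda> ^ e * q =
          Const (mpol_eval p v) * \<Lambda> ^ e * (Const (mpol_eval q v) * \<Lambda> ^ f + lin * q')"
        by (subst (1) q'(3)) simp
      finally show ?thesis
        unfolding mpol_eval_mult Const_mult w_def power_add by (simp only: algebra_simps)
    qed
    ultimately show ?thesis using p' q' unfolding R_def by (intro exI[of _ w]) (auto simp: w_def)
  qed
  have Radd: "R e (p + q)" if "R e p" "R e q" for e p q
  proof -
    obtain p' where p': "p' \<in> forms UNIV 1 (e - 1)" "e = 0 \<longrightarrow> p' = 0"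
      "p = Const (mpol_eval p v) * \<Lambda> ^ e + lin * p'" using \<open>R e p\<close> by (auto simp: R_def)
    obtain q' where q': "q' \<in> forms UNIV 1 (e - 1)" "e = 0 \<longrightarrow> q' = 0"
      "q = Const (mpol_eval q v) * \<Lambda> ^ e + lin * q'" using \<open>R e q\<close> by (auto simp: R_def)
    have "p + q = (Const (mpol_eval p v) * \<Lambda> ^ e + lin * p') + (Const (mpol_eval q v) * \<Lambda> ^ e + lin * q')"
      using p'(3) q'(3) by simp
    also have "\<dots> = Const (mpol_eval (p + q) v) * \<Lambda> ^ e + lin * (p' + q')"
      unfolding mpol_eval_add Const_add by (simp only: algebra_simps)
    finally show ?thesis unfolding R_def
      using p' q' fa by (intro exI[of _ "p' + q'"]) auto
  qed
  have Rpow: "R n (Var i ^ n)" if "i \<le> 1" for i n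
  proof (induction n)
    case 0 then show ?case using RC[of 1] by simp
  next
    case (Suc n)
    have "R 1 (Var i)" using RX RY that by (cases "i = 0") (auto simp: le_Suc_eq)
    then show ?case
      using Rmult[OF _ Suc, of 1 "Var i"] V[OF that] forms_power[OF is_subfield_UNIV V[OF that], of n] by simp
  qed
  have Rsingle: "R (Suc e) (Poly_Mapping.single m c)" if "Poly_Mapping.keys m \<subseteq> {..1}" "mdeg m = Suc e" for m and c :: 'a
  proof -
    have p: "Var i ^ n \<in> forms (UNIV :: 'a set) 1 n" if "i \<le> 1" for i n
      using forms_power[OF is_subfield_UNIV V[OF that], of n] by simp
    have "R (0 + Poly_Mapping.lookup m 0 + Poly_Mapping.lookup m 1) (Const c * Var 0 ^ Poly_Mapping.lookup m 0 * Var 1 ^ Poly_Mapping.lookup m 1)"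
      by (intro Rmult RC Rpow fm C p) auto
    moreover have "0 + Poly_Mapping.lookup m 0 + Poly_Mapping.lookup m 1 = Suc e"
      using single_binary(2)[OF that(1)] that(2) by simp
    ultimately show ?thesis unfolding single_binary(1)[OF that(1)] by simp
  qed
  have R0: "R (Suc e) 0" unfolding R_def
    by (intro exI[of _ 0]) (auto simp: forms_zero is_subfield_UNIV mpol_eval_def)
  have "R (Suc e) (\<Sum>m\<in>S. Poly_Mapping.single m (Poly_Mapping.lookup p m))"
    if "S \<subseteq> Poly_Mapping.keys p" for S
    using finite_subset[OF that finite_keys] that p
    by (induction S rule: finite_induct) (simp_all add: Radd Rsingle R0 forms_iff)
  then have "R (Suc e) p" using mpol_sum_single[of p] by (metis order.refl)
  then show ?thesis using root by (auto simp: R_def v_def lin_def)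
qed

definition const_poly :: "'a::zero \<Rightarrow> 'a poly" where "const_poly c = [:c:]"

lemma is_ring_hom_poly: "is_ring_hom (\<lambda>q. poly q (x::'a::comm_semiring_1))"
  by (simp add: is_ring_hom_def)

lemma poly_hom_eval: "poly (hom_eval const_poly p v) x = mpol_eval p (\<lambda>i. poly (v i) x)"
  using hom_eval_hom[OF is_ring_hom_poly[of x], of const_poly p v]
  by (simp add: mpol_eval_hom_eval comp_def const_poly_def)

lemma binary_eval_vec3:
  "p \<in> forms E 1 e \<Longrightarrow> v 0 = x \<Longrightarrow> v 1 = y \<Longrightarrow> mpol_eval p v = mpol_eval p (vec3 x y 0)"
  by (intro mpol_eval_cong[of p E 1 e]) (auto simp: vec3_def le_Suc_eq)

text \<open>If the dehomogenized polynomial has no root, it is constant, and then the root is the point at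
  infinity \<open>(1 : 0)\<close>.\<close>

lemma binary_form_root:
  fixes p :: "'a::{alg_closed_field, field_char_0} mpol"
  assumes p: "p \<in> forms UNIV 1 (Suc e)"
  shows "\<exists>x y. (x \<noteq> 0 \<or> y \<noteq> 0) \<and> mpol_eval p (vec3 x y 0) = 0"
proof -
  define q where "q = hom_eval const_poly p (vec3 [:0, 1:] 1 0)"
  have q: "poly q x = mpol_eval p (vec3 x 1 0)" for x
    unfolding q_def poly_hom_eval by (rule binary_eval_vec3[OF p]) auto
  show ?thesis
  proof (cases "degree q = 0")
    case False
    then obtain x where "poly q x = 0" using alg_closed_imp_poly_has_root by blast
    then show ?thesis using q by (intro exI[of _ x] exI[of _ 1]) auto
  next
    case True
    then obtain c where c: "q = [:c:]" by (auto elim: degree_eq_zeroE)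
    define r where "r = hom_eval const_poly p (vec3 1 [:0, 1:] 0)"
    have r: "poly r y = mpol_eval p (vec3 1 y 0)" for y
      unfolding r_def poly_hom_eval by (rule binary_eval_vec3[OF p]) auto
    have "poly r y = c * y ^ Suc e" if "y \<noteq> 0" for y
    proof -
      have "mpol_eval p (vec3 1 y 0) = mpol_eval p (\<lambda>i. y * vec3 (1 / y) 1 0 i)"
        using that by (intro mpol_eval_cong[OF p]) (auto simp: vec3_def)
      also have "\<dots> = y ^ Suc e * mpol_eval p (vec3 (1 / y) 1 0)" by (rule mpol_eval_homogeneous[OF p])
      also have "\<dots> = y ^ Suc e * c" using q[of "1 / y"] c by simp
      finally show ?thesis using r by (simp add: mult.commute)
    qed
    then have "UNIV - {0} \<subseteq> {y. poly (r - monom c (Suc e)) y = 0}"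
      by (auto simp: poly_monom)
    moreover have "infinite (UNIV - {0::'a})" by (simp add: infinite_UNIV_char_0)
    ultimately have "r - monom c (Suc e) = 0"
      using poly_roots_finite finite_subset by blast
    then have "poly r 0 = 0" by (simp add: poly_monom)
    then show ?thesis using r by (intro exI[of _ 1] exI[of _ 0]) auto
  qed
qed

lemma binary_form_infinite_zeros:
  fixes p :: "'a::{alg_closed_field, field_char_0} mpol"
  assumes "p \<in> forms UNIV 1 e" "infinite {x. mpol_eval p (vec3 x 1 0) = 0}"
  shows "p = 0"
  using assms
proof (induction e arbitrary: p)
  case 0
  then have c: "p = Const (Poly_Mapping.lookup p 0)" using constant_form by blast
  have "{x. mpol_eval p (vec3 x 1 0) = 0} \<noteq> {}" using 0 by (metis finite.emptyI)
  then obtain x where "mpol_eval p (vec3 x 1 0) = 0" by blast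
  then have "Poly_Mapping.lookup p 0 = 0" by (subst (asm) c) simp
  then show ?case using c by simp
next
  case (Suc e)
  obtain x0 y0 where xy: "x0 \<noteq> 0 \<or> y0 \<noteq> 0" "mpol_eval p (vec3 x0 y0 0) = 0"
    using binary_form_root[OF Suc.prems(1)] by blast
  obtain p' where p': "p' \<in> forms UNIV 1 e" "p = (Const y0 * Var 0 - Const x0 * Var 1) * p'"
    using binary_form_factor[OF Suc.prems(1) xy] by blast
  have "{x. mpol_eval p (vec3 x 1 0) = 0} \<subseteq> {x. y0 * x = x0} \<union> {x. mpol_eval p' (vec3 x 1 0) = 0}"
    by (auto simp: p'(2) mpol_eval_mult mpol_eval_diff)
  moreover have "finite {x. y0 * x = x0}"
  proof (cases "y0 = 0")
    case True then show ?thesis using xy by auto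
  next
    case False
    then have "{x. y0 * x = x0} \<subseteq> {x0 / y0}" by (auto simp: field_simps)
    then show ?thesis by (rule finite_subset) simp
  qed
  ultimately have "infinite {x. mpol_eval p' (vec3 x 1 0) = 0}"
    using Suc.prems(2) finite_subset finite_UnI by blast
  then show ?case using Suc.IH p' by simp
qed



section \<open>The coordinate ring of a diagonal quartic\<close>

definition on_cone :: "(nat \<Rightarrow> 'a::field) \<Rightarrow> (nat \<Rightarrow> 'a) \<Rightarrow> bool" where
  "on_cone A v \<longleftrightarrow> A 0 * v 0 ^ 4 + A 1 * v 1 ^ 4 + A 2 * v 2 ^ 4 = 0 \<and> (\<exists>i\<le>2. v i \<noteq> 0)"

definition vanishes :: "(nat \<Rightarrow> 'a::field) \<Rightarrow> 'a mpol \<Rightarrow> bool" where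
  "vanishes A p \<longleftrightarrow> (\<forall>v. on_cone A v \<longrightarrow> mpol_eval p v = 0)"

definition quartic_form :: "(nat \<Rightarrow> 'a::comm_semiring_1) \<Rightarrow> 'a mpol" where
  "quartic_form A = Const (A 0) * Var 0 ^ 4 + Const (A 1) * Var 1 ^ 4 + Const (A 2) * Var 2 ^ 4"

lemma hom_eval_quartic_form:
  "is_ring_hom h \<Longrightarrow> hom_eval h (quartic_form A) v = h (A 0) * v 0 ^ 4 + h (A 1) * v 1 ^ 4 + h (A 2) * v 2 ^ 4"
  by (simp add: quartic_form_def hom_eval_add hom_eval_mult hom_eval_power)

lemmas mpol_eval_quartic_form = hom_eval_quartic_form[OF is_ring_hom_id, folded mpol_eval_hom_eval]

text \<open>Division by the quartic, which is monic in the last variable up to a constant.\<close>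

lemma quartic_division:
  fixes p :: "'a::field mpol"
  assumes A: "A 2 \<noteq> 0" and p: "p \<in> forms UNIV 2 d"
  obtains B q where "\<And>i. i < 4 \<Longrightarrow> B i \<in> forms UNIV 1 (d - i)"
    "p = (\<Sum>i<4. B i * Var 2 ^ i) + q * quartic_form A"
proof -
  note fm = forms_mult[OF is_subfield_UNIV]
  note fa = forms_add[OF is_subfield_UNIV]
  have C: "Const c \<in> forms UNIV n 0" for c :: 'a and n
    by (simp add: forms_Const is_subfield_UNIV)
  have V: "Var i ^ n \<in> forms (UNIV :: 'a set) 1 n" if "i \<le> 1" for i n
    using forms_power[OF is_subfield_UNIV forms_Var[OF is_subfield_UNIV that], of n] by simp
  define R where "R p \<longleftrightarrow> (\<exists>B q. (\<forall>i<4. B i \<in> forms UNIV 1 (d - i)) \<and>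
    p = (\<Sum>i<4. B i * Var 2 ^ i) + q * quartic_form A)" for p
  have Radd: "R (p + q)" if "R p" "R q" for p q
  proof -
    obtain B r B' r' where "\<forall>i<4. B i \<in> forms UNIV 1 (d - i)" "p = (\<Sum>i<4. B i * Var 2 ^ i) + r * quartic_form A"
      "\<forall>i<4. B' i \<in> forms UNIV 1 (d - i)" "q = (\<Sum>i<4. B' i * Var 2 ^ i) + r' * quartic_form A"
      using \<open>R p\<close> \<open>R q\<close> unfolding R_def by blast
    then show ?thesis unfolding R_def
      by (intro exI[of _ "\<lambda>i. B i + B' i"] exI[of _ "r + r'"])
        (auto intro!: fa simp: algebra_simps sum.distrib)
  qed
  have Rmul: "R (q * quartic_form A)" for q unfolding R_def
    by (intro exI[of _ "\<lambda>i. 0"] exI[of _ q]) (auto simp: forms_zero is_subfield_UNIV)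
  define c4 where "c4 = 1 / A 2"
  have Z4: "(Var 2 :: 'a mpol) ^ 4 = Const c4 * quartic_form A
      + Const (- c4 * A 0) * Var 0 ^ 4 + Const (- c4 * A 1) * Var 1 ^ 4"
  proof -
    have "Const (c4 * A 2) = (1 :: 'a mpol)" using A by (simp add: c4_def)
    then have "Const c4 * (Const (A 2) * Var 2 ^ 4) = (Var 2 :: 'a mpol) ^ 4"
      unfolding mult.assoc[symmetric] Const_mult[symmetric] by simp
    then show ?thesis by (simp add: quartic_form_def Const_mult Const_minus algebra_simps)
  qed
  have Rmono: "R (Const c * Var 0 ^ i * Var 1 ^ j * Var 2 ^ l)" if "i + j + l = d" for c i j l
    using that
  proof (induction l arbitrary: c i j rule: less_induct)
    case (less l)
    show ?case
    proof (cases "l < 4")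
      case True
      have "d - l = 0 + i + j" using less.prems by simp
      then have *: "Const c * Var 0 ^ i * Var 1 ^ j \<in> forms UNIV 1 (d - l)"
        using fm[OF fm[OF C V[of 0 i]] V[of 1 j], of c] by simp
      have "(\<Sum>i'<4. (if i' = l then Const c * Var 0 ^ i * Var 1 ^ j else 0) * Var 2 ^ i')
        = (\<Sum>i'<4. if i' = l then Const c * Var 0 ^ i * Var 1 ^ j * Var 2 ^ l else 0)"
        by (intro sum.cong) auto
      then show ?thesis unfolding R_def
        using * True by (intro exI[of _ "\<lambda>i'. if i' = l then Const c * Var 0 ^ i * Var 1 ^ j else 0"] exI[of _ 0])
          (auto simp: forms_zero is_subfield_UNIV)
    next
      case False
      then have l: "Var 2 ^ l = (Var 2 :: 'a mpol) ^ (l - 4) * Var 2 ^ 4"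
        unfolding power_add[symmetric] by simp
      have "Const c * Var 0 ^ i * Var 1 ^ j * Var 2 ^ l =
        (Const c * Var 0 ^ i * Var 1 ^ j * Var 2 ^ (l - 4) * Const c4) * quartic_form A
        + Const (c * (- c4 * A 0)) * Var 0 ^ (i + 4) * Var 1 ^ j * Var 2 ^ (l - 4)
        + Const (c * (- c4 * A 1)) * Var 0 ^ i * Var 1 ^ (j + 4) * Var 2 ^ (l - 4)"
        unfolding l Z4 Const_mult[of c] by (simp only: power_add algebra_simps)
      moreover have "R \<dots>" using False less.prems by (intro Radd Rmul less.IH) auto
      ultimately show ?thesis by simp
    qed
  qed
  have Rsingle: "R (Poly_Mapping.single m c)" if "Poly_Mapping.keys m \<subseteq> {..2}" "mdeg m = d" for m c
    unfolding single_ternary[OF that(1)] using that(2) mdeg_ternary[OF that(1)] by (intro Rmono) simp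
  have R0: "R 0" using Rmul[of 0] by simp
  have "R (\<Sum>m\<in>S. Poly_Mapping.single m (Poly_Mapping.lookup p m))"
    if "S \<subseteq> Poly_Mapping.keys p" for S
    using finite_subset[OF that finite_keys] that p
    by (induction S rule: finite_induct) (simp_all add: Radd Rsingle R0 forms_iff)
  then have "R p" using mpol_sum_single[of p] by (metis order.refl)
  then show ?thesis using that unfolding R_def by blast
qed

text \<open>The four fourth roots of \<open>s\<close> are distinct. They are the orbit of one of them under \<open>w \<mapsto> \<iota> w\<close>, so
  that the coefficients are obtained by a finite Fourier transform.\<close>

lemma cubic_zero_on_fourth_roots:
  fixes s :: "'a::{alg_closed_field, field_char_0}"
  assumes "s \<noteq> 0" and zero: "\<And>w. w ^ 4 = s \<Longrightarrow> (\<Sum>i<4. c i * w ^ i) = 0"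
  shows "i < 4 \<Longrightarrow> c i = 0"
proof -
  obtain w where w: "w ^ 4 = s" using nth_root_exists[of 4 s] by auto
  obtain \<iota> :: 'a where "\<iota> ^ 2 = -1" using nth_root_exists[of 2 "-1::'a"] by auto
  then have i2: "\<iota> * \<iota> = -1" by (simp add: power2_eq_square)
  have i4: "\<iota> ^ 4 = 1" "\<iota> ^ 3 = - \<iota>" "(\<iota> ^ 2) = -1"
    using i2 by (simp_all add: power2_eq_square eval_nat_numeral mult.assoc)
  have "w \<noteq> 0" "\<iota> \<noteq> 0" using w assms(1) i2 by auto
  have s: "(\<Sum>i<4. c i * x ^ i) = c 0 + c 1 * x + c 2 * x ^ 2 + c 3 * x ^ 3" for x
    by (simp add: eval_nat_numeral)
  have e1: "c 0 + c 1 * w + c 2 * w ^ 2 + c 3 * w ^ 3 = 0"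
    using zero[of w] w s by simp
  have e2: "c 0 - c 1 * w + c 2 * w ^ 2 - c 3 * w ^ 3 = 0"
    using zero[of "- w"] w s by simp
  have e3: "c 0 + \<iota> * (c 1 * w) - c 2 * w ^ 2 - \<iota> * (c 3 * w ^ 3) = 0"
    using zero[of "\<iota> * w", unfolded s] w i4 by (simp add: power_mult_distrib mult_ac)
  have e4: "c 0 - \<iota> * (c 1 * w) - c 2 * w ^ 2 + \<iota> * (c 3 * w ^ 3) = 0"
    using zero[of "- (\<iota> * w)", unfolded s] w i4 by (simp add: power_mult_distrib mult_ac)
  define a b d where "a = c 1 * w" and "b = c 2 * w ^ 2" and "d = c 3 * w ^ 3"
  have "2 * (c 0 + b) = 0" using arg_cong2[OF e1 e2, of "(+)"] by (simp add: a_def b_def d_def algebra_simps)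
  moreover have "2 * (c 0 - b) = 0" using arg_cong2[OF e3 e4, of "(+)"] by (simp add: a_def b_def d_def algebra_simps)
  moreover have "2 * (a + d) = 0" using arg_cong2[OF e1 e2, of "(-)"] by (simp add: a_def b_def d_def algebra_simps)
  moreover have "2 * (\<iota> * (a - d)) = 0" using arg_cong2[OF e3 e4, of "(-)"] by (simp add: a_def b_def d_def algebra_simps)
  ultimately have "c 0 + b = 0" "c 0 = b" "a + d = 0" "a = d" using \<open>\<iota> \<noteq> 0\<close> by auto
  then have "2 * c 0 = 0" "b = 0" "2 * a = 0" "d = 0" by auto
  then have "c 0 = 0" "c 1 = 0" "c 2 = 0" "c 3 = 0" using \<open>w \<noteq> 0\<close> by (auto simp: a_def b_def d_def)
  moreover assume "i < 4"
  then have "i = 0 \<or> i = 1 \<or> i = 2 \<or> i = 3" by auto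
  ultimately show "c i = 0" by auto
qed

text \<open>The germ \<open>(\<xi>(t) : 1 : t)\<close> of the curve at a point with last coordinate \<open>0\<close>. As the equation
  involves \<open>z\<close> only through \<open>z\<^sup>4\<close>, \<open>\<xi>\<close> is a power series in \<open>t\<^sup>4\<close>.\<close>

definition is_germ :: "(nat \<Rightarrow> 'a::field) \<Rightarrow> 'a fps \<Rightarrow> bool" where
  "is_germ A \<xi> \<longleftrightarrow> fps_const (A 0) * \<xi> ^ 4 + fps_const (A 1) + fps_const (A 2) * fps_X ^ 4 = 0 \<and>
     (\<forall>n. \<not> 4 dvd n \<longrightarrow> fps_nth \<xi> n = 0)"

definition germ :: "'a::field fps \<Rightarrow> 'a mpol \<Rightarrow> 'a fps" where
  "germ \<xi> p = hom_eval fps_const p (vec3 \<xi> 1 fps_X)"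

lemma germ_simps:
  fixes p q :: "'a::field mpol"
  shows "germ \<xi> (p + q) = germ \<xi> p + germ \<xi> q" "germ \<xi> (p * q) = germ \<xi> p * germ \<xi> q"
    "germ \<xi> (p ^ n) = germ \<xi> p ^ n" "germ \<xi> (p - q) = germ \<xi> p - germ \<xi> q"
    "germ \<xi> (sum f I) = (\<Sum>i\<in>I. germ \<xi> (f i))" "germ \<xi> (Var i) = vec3 \<xi> 1 fps_X i"
    "germ \<xi> (Const c) = fps_const c" "germ \<xi> 0 = 0"
  by (simp_all add: germ_def is_ring_hom_fps_const hom_eval_add hom_eval_mult hom_eval_power
      hom_eval_diff hom_eval_sum)

lemma ex_germ:
  fixes A :: "nat \<Rightarrow> 'a::{alg_closed_field, field_char_0}"
  assumes "A 0 \<noteq> 0" "A 1 \<noteq> 0" "A 0 * \<zeta> ^ 4 + A 1 = 0"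
  shows "\<exists>\<xi>. is_germ A \<xi> \<and> fps_nth \<xi> 0 = \<zeta>"
proof -
  define c where "c = A 2 / A 1"
  define y where "y = fps_const c * fps_X ^ 4"
  define g where "g = fps_binomial (1 / 4 :: 'a)"
  have y0: "fps_nth y 0 = 0" by (simp add: y_def)
  have "g ^ 4 = fps_binomial (1 / 4 + 1 / 4 + 1 / 4 + 1 / 4)"
    unfolding fps_binomial_add_mult g_def by (simp add: eval_nat_numeral mult_ac)
  also have "\<dots> = fps_binomial 1" by simp
  also have "\<dots> = 1 + fps_X"
  proof (rule fps_ext)
    fix n
    show "fps_nth (fps_binomial (1 :: 'a)) n = fps_nth (1 + fps_X) n"
      using gbinomial_Suc_Suc[of "0::'a"]
      by (cases n rule: nat.exhaust[case_product nat.exhaust[of "n - 1"]]) (auto simp: fps_X_def)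
  qed
  finally have g4: "(g oo y) ^ 4 = 1 + y"
    using fps_compose_power[OF y0, of g 4] y0 by (simp add: fps_compose_add_distrib)
  define \<xi> where "\<xi> = fps_const \<zeta> * (g oo y)"
  have "fps_const (A 0) * \<xi> ^ 4 = fps_const (A 0 * \<zeta> ^ 4) * (1 + y)"
    by (simp add: \<xi>_def power_mult_distrib g4 fps_const_power mult.assoc flip: fps_const_mult)
  also have "A 0 * \<zeta> ^ 4 = - A 1" using assms(3) by (simp add: add_eq_0_iff2)
  also have "fps_const (- A 1) * (1 + y) = - fps_const (A 1) - fps_const (A 1 * c) * fps_X ^ 4"
    by (simp add: y_def algebra_simps flip: fps_const_mult fps_const_neg)
  also have "A 1 * c = A 2" using assms(2) by (simp add: c_def)
  finally have "fps_const (A 0) * \<xi> ^ 4 + fps_const (A 1) + fps_const (A 2) * fps_X ^ 4 = 0" by simp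
  moreover have "fps_nth \<xi> n = 0" if "\<not> 4 dvd n" for n
  proof -
    have "fps_nth (y ^ i) n = 0" for i
    proof -
      have "y ^ i = fps_const (c ^ i) * fps_X ^ (4 * i)"
        by (simp add: y_def power_mult_distrib power_mult fps_const_power)
      moreover have "n \<noteq> 4 * i" using that by auto
      ultimately show ?thesis by (simp add: fps_X_power_nth)
    qed
    then show ?thesis by (simp add: \<xi>_def fps_compose_nth)
  qed
  moreover have "fps_nth \<xi> 0 = \<zeta>" by (simp add: \<xi>_def g_def)
  ultimately show ?thesis unfolding is_germ_def by blast
qed


lemma germ_quartic_form: "is_germ A \<xi> \<Longrightarrow> germ \<xi> (quartic_form A) = 0"
  by (simp add: is_germ_def germ_def hom_eval_quartic_form[OF is_ring_hom_fps_const])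

lemma fps_nth_mult_four:
  fixes f g :: "'b::comm_ring_1 fps"
  assumes "\<forall>n. \<not> 4 dvd n \<longrightarrow> fps_nth f n = 0" "\<forall>n. \<not> 4 dvd n \<longrightarrow> fps_nth g n = 0"
  shows "\<forall>n. \<not> 4 dvd n \<longrightarrow> fps_nth (f * g) n = 0"
proof (intro allI impI)
  fix n :: nat assume n: "\<not> 4 dvd n"
  have "fps_nth f i * fps_nth g (n - i) = 0" if "i \<le> n" for i
  proof (cases "4 dvd i")
    case True
    then have "\<not> 4 dvd (n - i)" using n that by (metis dvd_diffD)
    then show ?thesis using assms(2) by simp
  qed (use assms(1) in simp)
  then show "fps_nth (f * g) n = 0" by (simp add: fps_mult_nth)
qed

lemma germ_binary:
  fixes p :: "'a::field mpol"
  assumes "is_germ A \<xi>" "p \<in> forms UNIV 1 e"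
  shows "\<forall>n. \<not> 4 dvd n \<longrightarrow> fps_nth (germ \<xi> p) n = 0"
proof -
  define S where "S = {f :: 'a fps. \<forall>n. \<not> 4 dvd n \<longrightarrow> fps_nth f n = 0}"
  have mult: "f * g \<in> S" if "f \<in> S" "g \<in> S" for f g
    using that fps_nth_mult_four unfolding S_def by blast
  have const: "fps_const c \<in> S" for c by (auto simp: S_def)
  then have one: "1 \<in> S" using fps_const_1_eq_1 by metis
  have \<xi>: "\<xi> \<in> S" using assms(1) by (auto simp: S_def is_germ_def)
  have power: "f ^ n \<in> S" if "f \<in> S" for f n by (induction n) (auto intro: mult one that)
  have "monom_eval m (vec3 \<xi> 1 fps_X) \<in> S" if "m \<in> Poly_Mapping.keys p" for m
  proof -
    have m: "Poly_Mapping.keys m \<subseteq> {..1}" using assms(2) that by (auto simp: forms_iff)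
    have "monom_eval m (vec3 \<xi> 1 fps_X) = \<xi> ^ Poly_Mapping.lookup m 0"
    proof -
      have "{..1} = {0, 1::nat}" by auto
      then show ?thesis using monom_eval_superset[OF _ m, of "vec3 \<xi> 1 fps_X"] by simp
    qed
    then show ?thesis using power \<xi> by simp
  qed
  then have "fps_const (Poly_Mapping.lookup p m) * monom_eval m (vec3 \<xi> 1 fps_X) \<in> S"
    if "m \<in> Poly_Mapping.keys p" for m
    using mult const that by blast
  moreover have "sum f I \<in> S" if "\<And>i. i \<in> I \<Longrightarrow> f i \<in> S" for f :: "(nat \<Rightarrow>\<^sub>0 nat) \<Rightarrow> 'a fps" and I
    using that by (auto simp: S_def fps_sum_nth intro!: sum.neutral)
  ultimately have "germ \<xi> p \<in> S" by (simp add: germ_def hom_eval_def)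
  then show ?thesis by (simp add: S_def)
qed

lemma sum_lessThan_4: "(\<Sum>i<4. f i) = f 0 + f 1 + f 2 + f (3::nat)"
  by (simp add: eval_nat_numeral)

text \<open>The terms \<open>germ B\<^sub>i \<cdot> t\<^sup>i\<close> with \<open>i < 4\<close> have exponents in different classes modulo \<open>4\<close>.\<close>

lemma germ_reduced_nth:
  fixes B :: "nat \<Rightarrow> 'a::field mpol"
  assumes "is_germ A \<xi>" "\<And>i. i < 4 \<Longrightarrow> B i \<in> forms UNIV 1 (d i)" "i < 4"
  shows "fps_nth (germ \<xi> (\<Sum>i<4. B i * Var 2 ^ i)) (4 * n + i) = fps_nth (germ \<xi> (B i)) (4 * n)"
proof -
  have "fps_nth (germ \<xi> (B j) * fps_X ^ j) (4 * n + i) = (if j = i then fps_nth (germ \<xi> (B i)) (4 * n) else 0)"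
    if "j < 4" for j
  proof (cases "j = i")
    case False
    have "\<not> 4 dvd (4 * n + i - j)" if "j \<le> 4 * n + i"
    proof
      assume "4 dvd (4 * n + i - j)"
      then have "(4 * n + i) mod 4 = j mod 4" using that by (metis mod_eq_dvd_iff_nat)
      then show False using False assms(3) \<open>j < 4\<close> by simp
    qed
    then show ?thesis using False germ_binary[OF assms(1) assms(2)[OF \<open>j < 4\<close>]]
      by (simp add: fps_X_power_mult_right_nth)
  qed (simp add: fps_X_power_mult_right_nth)
  then have "(\<Sum>j<4. fps_nth (germ \<xi> (B j) * fps_X ^ j) (4 * n + i)) =
      (\<Sum>j<4. if j = i then fps_nth (germ \<xi> (B i)) (4 * n) else 0)"
    by (intro sum.cong) auto
  then show ?thesis using assms(3) by (simp add: germ_simps fps_sum_nth)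
qed

text \<open>A binary form is a product of linear ones, and \<open>\<xi>\<close> is not constant.\<close>

lemma germ_binary_injective:
  fixes p :: "'a::{alg_closed_field, field_char_0} mpol"
  assumes A: "A 2 \<noteq> 0" and \<xi>: "is_germ A \<xi>" and "p \<in> forms UNIV 1 e" "germ \<xi> p = 0"
  shows "p = 0"
  using assms(3,4)
proof (induction e arbitrary: p)
  case 0
  then have c: "p = Const (Poly_Mapping.lookup p 0)" using constant_form by blast
  have "fps_const (Poly_Mapping.lookup p 0) = 0"
    using 0(2) by (subst (asm) c) (simp add: germ_simps)
  then show ?case using c by simp
next
  case (Suc e)
  obtain x0 y0 where xy: "x0 \<noteq> 0 \<or> y0 \<noteq> 0" "mpol_eval p (vec3 x0 y0 0) = 0"
    using binary_form_root[OF Suc.prems(1)] by blast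
  obtain p' where p': "p' \<in> forms UNIV 1 e" "p = (Const y0 * Var 0 - Const x0 * Var 1) * p'"
    using binary_form_factor[OF Suc.prems(1) xy] by blast
  have "germ \<xi> (Const y0 * Var 0 - Const x0 * Var 1) \<noteq> 0"
  proof
    assume "germ \<xi> (Const y0 * Var 0 - Const x0 * Var 1) = 0"
    then have eq: "fps_const y0 * \<xi> = fps_const x0" by (simp add: germ_simps)
    show False
    proof (cases "y0 = 0")
      case True then show ?thesis using eq xy by simp
    next
      case False
      have "\<xi> = fps_const (inverse y0) * (fps_const y0 * \<xi>)"
        using False by (simp flip: mult.assoc)
      then have "\<xi> = fps_const (inverse y0 * x0)" by (simp add: eq)
      then have "fps_const (A 0) * fps_const ((inverse y0 * x0) ^ 4) + fps_const (A 1) + fps_const (A 2) * fps_X ^ 4 = 0"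
        using \<xi> unfolding is_germ_def by (metis fps_const_power)
      from arg_cong[OF this, of "\<lambda>f. fps_nth f 4"] show False
        using A by (simp add: fps_X_power_nth fps_const_power)
    qed
  qed
  then have "germ \<xi> p' = 0" using Suc.prems(2) unfolding p'(2) by (simp add: germ_simps(2))
  then show ?case using Suc.IH p' by simp
qed

lemma on_cone_vec3:
  fixes A :: "nat \<Rightarrow> 'a::field"
  shows "A 2 \<noteq> 0 \<Longrightarrow> z ^ 4 = - (A 0 * x ^ 4 + A 1 * y ^ 4) / A 2 \<Longrightarrow> x \<noteq> 0 \<or> y \<noteq> 0 \<or> z \<noteq> 0 \<Longrightarrow> on_cone A (vec3 x y z)"
  unfolding on_cone_def by (auto simp: field_simps intro: exI[of _ 0] exI[of _ 1] exI[of _ 2])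

text \<open>Over a general point \<open>(x : 1)\<close> of the projective line lie four points of the curve, with distinct
  values of \<open>z\<close>.\<close>

lemma vanishes_reduced:
  fixes B :: "nat \<Rightarrow> 'a::{alg_closed_field, field_char_0} mpol"
  assumes A: "A 0 \<noteq> 0" "A 2 \<noteq> 0" and B: "\<And>i. i < 4 \<Longrightarrow> B i \<in> forms UNIV 1 (d i)"
    and van: "vanishes A (\<Sum>i<4. B i * Var 2 ^ i)" and "i < 4"
  shows "B i = 0"
proof (rule binary_form_infinite_zeros[OF B[OF \<open>i < 4\<close>]])
  have "{x. A 0 * x ^ 4 + A 1 \<noteq> 0} \<subseteq> {x. mpol_eval (B i) (vec3 x 1 0) = 0}"
  proof (intro subsetI CollectI)
    fix x assume "x \<in> {x. A 0 * x ^ 4 + A 1 \<noteq> 0}"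
    then have "A 0 * x ^ 4 + A 1 * 1 ^ 4 \<noteq> 0" by simp
    then have s: "- (A 0 * x ^ 4 + A 1 * 1 ^ 4) / A 2 \<noteq> 0"
      using A by (simp only: divide_eq_0_iff neg_equal_0_iff_equal) simp
    show "mpol_eval (B i) (vec3 x 1 0) = 0"
    proof (rule cubic_zero_on_fourth_roots[OF s _ \<open>i < 4\<close>])
      fix w assume "w ^ 4 = - (A 0 * x ^ 4 + A 1 * 1 ^ 4) / A 2"
      then have "on_cone A (vec3 x 1 w)" using A by (intro on_cone_vec3) auto
      then have "mpol_eval (\<Sum>i<4. B i * Var 2 ^ i) (vec3 x 1 w) = 0"
        using van by (simp add: vanishes_def)
      then have "(\<Sum>i<4. mpol_eval (B i) (vec3 x 1 w) * w ^ i) = 0"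
        by (simp add: mpol_eval_sum mpol_eval_mult mpol_eval_power)
      moreover have "mpol_eval (B i) (vec3 x 1 w) = mpol_eval (B i) (vec3 x 1 0)" if "i < 4" for i
        by (rule binary_eval_vec3[OF B[OF that]]) auto
      ultimately show "(\<Sum>i<4. mpol_eval (B i) (vec3 x 1 0) * w ^ i) = 0" by simp
    qed
  qed
  moreover have "finite {x. A 0 * x ^ 4 + A 1 = 0}"
  proof -
    have "{x. A 0 * x ^ 4 + A 1 = 0} = {x. poly (monom (A 0) 4 + [:A 1:]) x = 0}"
      by (simp add: poly_monom)
    moreover have "monom (A 0) 4 + [:A 1:] \<noteq> 0"
    proof
      assume "monom (A 0) 4 + [:A 1:] = 0"
      then have "coeff (monom (A 0) 4 + [:A 1:]) 4 = 0" by simp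
      then show False using A by (simp add: coeff_pCons eval_nat_numeral)
    qed
    ultimately show ?thesis using poly_roots_finite by metis
  qed
  then have "infinite {x. A 0 * x ^ 4 + A 1 \<noteq> 0}"
    using infinite_UNIV_char_0[where 'a = 'a] by (metis Collect_neg_eq finite_compl)
  ultimately show "infinite {x. mpol_eval (B i) (vec3 x 1 0) = 0}" using finite_subset by blast
qed

text \<open>By division the form may be assumed to have degree less than \<open>4\<close> in \<open>z\<close>, and then vanishing on the
  curve and vanishing along a single germ both force all of its coefficients to be zero. So the
  coordinate ring of the curve embeds into the power series.\<close>

theorem vanishes_iff_germ:
  fixes p :: "'a::{alg_closed_field, field_char_0} mpol"
  assumes A: "A 0 \<noteq> 0" "A 2 \<noteq> 0" and \<xi>: "is_germ A \<xi>" and p: "p \<in> forms UNIV 2 d"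
  shows "vanishes A p \<longleftrightarrow> germ \<xi> p = 0"
proof -
  obtain B q where B: "\<And>i. i < 4 \<Longrightarrow> B i \<in> forms UNIV 1 (d - i)"
    and pB: "p = (\<Sum>i<4. B i * Var 2 ^ i) + q * quartic_form A"
    by (rule quartic_division[of A p d, OF A(2) p]) blast
  have 1: "vanishes A p \<longleftrightarrow> vanishes A (\<Sum>i<4. B i * Var 2 ^ i)"
    unfolding pB by (simp add: vanishes_def mpol_eval_add mpol_eval_mult mpol_eval_quartic_form on_cone_def)
  have 2: "germ \<xi> p = germ \<xi> (\<Sum>i<4. B i * Var 2 ^ i)"
    unfolding pB by (simp add: germ_simps(1,2) germ_quartic_form[OF \<xi>])
  show ?thesis
  proof
    assume "vanishes A p"
    then have "B i = 0" if "i < 4" for i using vanishes_reduced[of A B "\<lambda>i. d - i"] A B 1 that by blast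
    then show "germ \<xi> p = 0" unfolding 2 by (simp add: germ_def)
  next
    assume zero: "germ \<xi> p = 0"
    have "B i = 0" if i: "i < 4" for i
    proof (rule germ_binary_injective[OF A(2) \<xi> B[OF i]])
      have "fps_nth (germ \<xi> (B i)) (4 * n) = 0" for n
        using germ_reduced_nth[where B = B and d = "\<lambda>i. d - i" and n = n, OF \<xi> B i] zero 2 by simp
      then show "germ \<xi> (B i) = 0"
        using germ_binary[OF \<xi> B[OF i]] by (intro fps_ext) (metis dvdE fps_zero_nth)
    qed
    then show "vanishes A p" unfolding 1 by (simp add: vanishes_def mpol_eval_def)
  qed
qed


section \<open>Diagonal quartics as projective curves\<close>

definition quartic :: "(nat \<Rightarrow> 'a::field) \<Rightarrow> 'a ppoint set" where
  "quartic A = {P \<in> proj_space 2. \<forall>v\<in>P. A 0 * v 0 ^ 4 + A 1 * v 1 ^ 4 + A 2 * v 2 ^ 4 = 0}"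

lemma diagonal_quartic_eq: "diagonal_quartic a b = quartic (vec3 a b 1)"
  by (simp add: diagonal_quartic_def quartic_def)

lemma fermat_quartic_eq: "fermat_quartic = quartic (\<lambda>_. 1)"
  by (simp add: fermat_quartic_def quartic_def)

lemma quartic_subset: "quartic A \<subseteq> proj_space 2"
  by (auto simp: quartic_def)

lemma quartic_memD:
  assumes "P \<in> quartic A" "v \<in> P" shows "on_cone A v"
  using assms proj_spaceD(2)[of P 2 v] unfolding quartic_def on_cone_def by blast

lemma on_cone_scale:
  assumes "on_cone A v" "c \<noteq> 0" shows "on_cone A (\<lambda>i. c * v i)"
proof -
  have "A 0 * (c * v 0) ^ 4 + A 1 * (c * v 1) ^ 4 + A 2 * (c * v 2) ^ 4 =
      c ^ 4 * (A 0 * v 0 ^ 4 + A 1 * v 1 ^ 4 + A 2 * v 2 ^ 4)"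
    by (simp add: power_mult_distrib algebra_simps)
  then show ?thesis using assms by (auto simp: on_cone_def)
qed

lemma quartic_memI:
  assumes "on_cone A v" "\<And>i. i > 2 \<Longrightarrow> v i = 0" shows "proj_point v \<in> quartic A"
proof -
  obtain i where "i \<le> 2" "v i \<noteq> 0" using assms(1) by (auto simp: on_cone_def)
  then have "proj_point v \<in> proj_space 2" using assms(2) by (rule proj_spaceI)
  moreover have "on_cone A w" if "w \<in> proj_point v" for w
    using that on_cone_scale[OF assms(1)] by (auto simp: proj_point_mem_iff)
  ultimately show ?thesis by (auto simp: quartic_def on_cone_def)
qed

lemma on_cone_iff: "on_cone A v \<longleftrightarrow>
    A 0 * v 0 ^ 4 + A 1 * v 1 ^ 4 + A 2 * v 2 ^ 4 = 0 \<and> (v 0 \<noteq> 0 \<or> v 1 \<noteq> 0 \<or> v 2 \<noteq> 0)"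
proof -
  have "(\<exists>i\<le>2. v i \<noteq> 0) \<longleftrightarrow> (\<exists>i\<in>{..2}. v i \<noteq> 0)" by auto
  then show ?thesis unfolding on_cone_def atMost_2 by simp
qed

lemma le_2_cases: "i \<le> (2::nat) \<Longrightarrow> i = 0 \<or> i = 1 \<or> i = 2" by auto

lemma on_cone_trunc: "on_cone A v \<Longrightarrow> on_cone A (vec3 (v 0) (v 1) (v 2))"
  by (simp add: on_cone_iff)

lemma mpol_eval_trunc: "p \<in> forms E 2 d \<Longrightarrow> mpol_eval p (vec3 (v 0) (v 1) (v 2)) = mpol_eval p v"
  using le_2_cases by (intro mpol_eval_cong[of p E 2 d]) (auto simp: vec3_def)

lemma vanishes_iff_quartic:
  assumes "p \<in> forms UNIV 2 d"
  shows "vanishes A p \<longleftrightarrow> (\<forall>P\<in>quartic A. \<forall>v\<in>P. mpol_eval p v = 0)"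
proof
  assume *: "\<forall>P\<in>quartic A. \<forall>v\<in>P. mpol_eval p v = 0"
  show "vanishes A p" unfolding vanishes_def
  proof (intro allI impI)
    fix v assume "on_cone A v"
    then have "proj_point (vec3 (v 0) (v 1) (v 2)) \<in> quartic A"
      by (intro quartic_memI on_cone_trunc) auto
    then have "mpol_eval p (vec3 (v 0) (v 1) (v 2)) = 0" using * proj_point_self by blast
    then show "mpol_eval p v = 0" using mpol_eval_trunc[OF assms] by simp
  qed
next
  assume "vanishes A p"
  then show "\<forall>P\<in>quartic A. \<forall>v\<in>P. mpol_eval p v = 0"
    using quartic_memD unfolding vanishes_def by blast
qed

lemma forms_quartic_form:
  assumes "is_subfield E" "\<And>i. i \<le> 2 \<Longrightarrow> A i \<in> E"
  shows "quartic_form A \<in> forms E 2 4"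
proof -
  have i: "Const (A i) * Var i ^ 4 \<in> forms E 2 4" if "i \<le> 2" for i
    using forms_mult[OF assms(1) forms_Const[OF assms(1) assms(2)[OF that]]
        forms_power[OF assms(1) forms_Var[OF assms(1) that], of 4]] by simp
  show ?thesis
    unfolding quartic_form_def by (rule forms_add[OF assms(1) forms_add[OF assms(1) i i] i]) simp_all
qed

lemma proj_closed_quartic:
  assumes "is_subfield k" "\<And>i. i \<le> 2 \<Longrightarrow> A i \<in> k"
  shows "proj_closed k 2 (quartic A)"
  unfolding proj_closed_def
proof (intro exI[of _ "{quartic_form A}"] conjI)
  show "{quartic_form A} \<subseteq> (\<Union>d. forms k 2 d)" using forms_quartic_form[of k A, OF assms] by auto
qed (simp add: quartic_def mpol_eval_quartic_form)

lemma ex_germ_quartic: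
  fixes A :: "nat \<Rightarrow> 'a::{alg_closed_field, field_char_0}"
  assumes "A 0 \<noteq> 0" "A 1 \<noteq> 0"
  shows "\<exists>\<xi>. is_germ A \<xi>"
proof -
  obtain \<zeta> where "\<zeta> ^ 4 = - A 1 / A 0" using nth_root_exists[of 4 "- A 1 / A 0"] by auto
  then have "A 0 * \<zeta> ^ 4 + A 1 = 0" using assms by simp
  then show ?thesis using ex_germ[of A \<zeta>, OF assms] by blast
qed

text \<open>As the homogeneous coordinate ring of the quartic embeds into power series, it is a domain.\<close>

lemma vanishes_mult:
  fixes A :: "nat \<Rightarrow> 'a::{alg_closed_field, field_char_0}"
  assumes A: "A 0 \<noteq> 0" "A 1 \<noteq> 0" "A 2 \<noteq> 0"
    and p: "p \<in> forms UNIV 2 d" and q: "q \<in> forms UNIV 2 e" and van: "vanishes A (p * q)"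
  shows "vanishes A p \<or> vanishes A q"
proof -
  obtain \<xi> where \<xi>: "is_germ A \<xi>" using ex_germ_quartic[of A, OF A(1,2)] by blast
  note iff = vanishes_iff_germ[where A = A, OF A(1) A(3) \<xi>]
  have "germ \<xi> (p * q) = 0"
    by (rule iffD1[OF iff[OF forms_mult[OF is_subfield_UNIV p q]] van])
  then have "germ \<xi> p * germ \<xi> q = 0" unfolding germ_simps(2) .
  then show ?thesis using iff[OF p] iff[OF q] by simp
qed

text \<open>The norm to binary forms: the product of the conjugates of \<open>p\<close> under \<open>z \<mapsto> \<iota> z\<close> is invariant,
  hence involves \<open>z\<close> only through \<open>z\<^sup>4\<close>, which the equation of the curve eliminates.\<close>

lemma norm_form:
  fixes A :: "nat \<Rightarrow> 'a::{alg_closed_field, field_char_0}"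
  assumes A: "A 0 \<noteq> 0" "A 1 \<noteq> 0" "A 2 \<noteq> 0"
    and p: "p \<in> forms UNIV 2 d" and nv: "\<not> vanishes A p"
  obtains n p' where "n \<in> forms UNIV 1 (4 * d)" "p' \<in> forms UNIV 2 (3 * d)"
    "\<not> vanishes A n" "vanishes A (p * p' - n)"
proof -
  obtain \<iota> :: 'a where "\<iota> ^ 2 = -1" using nth_root_exists[of 2 "-1::'a"] by auto
  then have i2: "\<iota> * \<iota> = -1" by (simp add: power2_eq_square)
  define conj where "conj u = scale_vars (vec3 1 1 u) p" for u
  have conj_eval: "mpol_eval (conj u) (vec3 x y z) = mpol_eval p (vec3 x y (u * z))" for u x y z
  proof -
    have "(\<lambda>i. vec3 1 1 u i * vec3 x y z i) = vec3 x y (u * z)" by (auto simp: vec3_def)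
    then show ?thesis by (simp add: conj_def mpol_eval_scale_vars)
  qed
  have conj_form: "conj u \<in> forms UNIV 2 d" for u
    unfolding conj_def by (rule forms_UNIV_scale[OF p])
  have conj_nv: "\<not> vanishes A (conj u)" if "u ^ 4 = 1" for u
  proof
    assume v: "vanishes A (conj u)"
    have "u \<noteq> 0" using that by auto
    have "mpol_eval p v = 0" if "on_cone A v" for v
    proof -
      have "on_cone A (vec3 (v 0) (v 1) (v 2 / u))"
        using \<open>on_cone A v\<close> \<open>u ^ 4 = 1\<close> \<open>u \<noteq> 0\<close>
        by (auto simp: on_cone_iff power_divide)
      then have "mpol_eval (conj u) (vec3 (v 0) (v 1) (v 2 / u)) = 0"
        using v by (simp add: vanishes_def)
      then show ?thesis using \<open>u \<noteq> 0\<close> mpol_eval_trunc[OF p, of v] by (simp add: conj_eval)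
    qed
    then show False using nv by (simp add: vanishes_def)
  qed
  define p' where "p' = conj \<iota> * conj (-1) * conj (- \<iota>)"
  have "p' \<in> forms UNIV 2 (d + d + d)"
    unfolding p'_def
    by (rule forms_mult[OF is_subfield_UNIV forms_mult[OF is_subfield_UNIV conj_form conj_form] conj_form])
  moreover have "d + d + d = 3 * d" by simp
  ultimately have p'f: "p' \<in> forms UNIV 2 (3 * d)" by (rule subst[rotated])
  have "p * p' \<in> forms UNIV 2 (d + 3 * d)" by (rule forms_mult[OF is_subfield_UNIV p p'f])
  moreover have "d + 3 * d = 4 * d" by simp
  ultimately have qf: "p * p' \<in> forms UNIV 2 (4 * d)" by (rule subst[rotated])
  obtain B r where B: "\<And>i. i < 4 \<Longrightarrow> B i \<in> forms UNIV 1 (4 * d - i)"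
    and qB: "p * p' = (\<Sum>i<4. B i * Var 2 ^ i) + r * quartic_form A"
    by (rule quartic_division[of A "p * p'" "4 * d", OF A(3) qf]) blast
  have B0: "B 0 \<in> forms UNIV 1 (4 * d)" using B[of 0] by simp
  have B02: "B 0 \<in> forms UNIV 2 (4 * d)" using B0 forms_mono[of UNIV UNIV 1 2 "4 * d"] by auto
  have key: "mpol_eval (p * p') v = mpol_eval (B 0) v" if v: "on_cone A v" for v
  proof -
    define x y z where "x = v 0" and "y = v 1" and "z = v 2"
    define F where "F w = mpol_eval p (vec3 x y w)" for w
    define b where "b i = mpol_eval (B i) (vec3 x y 0)" for i
    have expand: "F w * (F (\<iota> * w) * F (- w) * F (- (\<iota> * w))) = b 0 + b 1 * w + b 2 * w ^ 2 + b 3 * w ^ 3"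
      if "w ^ 4 = z ^ 4" for w
    proof -
      have "on_cone A (vec3 x y w)"
        using v that by (auto simp: on_cone_iff x_def y_def z_def)
      then have "mpol_eval (p * p') (vec3 x y w) = (\<Sum>i<4. mpol_eval (B i) (vec3 x y w) * w ^ i)"
        unfolding qB by (simp add: mpol_eval_add mpol_eval_sum mpol_eval_mult mpol_eval_power
            mpol_eval_quartic_form on_cone_def)
      also have "\<dots> = (\<Sum>i<4. b i * w ^ i)"
        unfolding b_def by (intro sum.cong refl arg_cong2[where f="(*)"] binary_eval_vec3[OF B]) auto
      finally show ?thesis
        by (simp add: sum_lessThan_4 p'_def mpol_eval_mult conj_eval F_def)
    qed
    define N where "N = F z * (F (\<iota> * z) * F (- z) * F (- (\<iota> * z)))"
    have i4: "\<iota> ^ 4 = 1" "\<iota> ^ 3 = - \<iota>" "\<iota> ^ 2 = -1"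
      using i2 by (simp_all add: power2_eq_square eval_nat_numeral mult.assoc)
    have i2': "\<iota> * (\<iota> * w) = - w" for w using i2 by (simp flip: mult.assoc)
    have "N = b 0 + b 1 * z + b 2 * z ^ 2 + b 3 * z ^ 3"
      unfolding N_def by (rule expand) simp
    moreover have "N = b 0 - b 1 * z + b 2 * z ^ 2 - b 3 * z ^ 3"
      using expand[of "- z"] by (simp add: N_def mult_ac)
    moreover have "N = b 0 + \<iota> * (b 1 * z) - b 2 * z ^ 2 - \<iota> * (b 3 * z ^ 3)"
      using expand[of "\<iota> * z"] i4 by (simp add: N_def power_mult_distrib i2' mult_ac)
    moreover have "N = b 0 - \<iota> * (b 1 * z) - b 2 * z ^ 2 + \<iota> * (b 3 * z ^ 3)"
      using expand[of "- (\<iota> * z)"] i4 by (simp add: N_def power_mult_distrib i2' mult_ac)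
    ultimately have "N + N + N + N = 4 * b 0" by algebra
    then have "N = b 0" by simp
    moreover have "mpol_eval (p * p') v = N"
    proof -
      have "mpol_eval (p * p') v = mpol_eval (p * p') (vec3 x y z)"
        unfolding x_def y_def z_def using mpol_eval_trunc[OF qf, of v] by simp
      then show ?thesis by (simp add: N_def p'_def mpol_eval_mult conj_eval F_def)
    qed
    moreover have "mpol_eval (B 0) v = b 0"
      unfolding b_def x_def y_def by (rule binary_eval_vec3[OF B0]) auto
    ultimately show ?thesis by simp
  qed
  show thesis
  proof (rule that[OF B0 p'f])
    show "vanishes A (p * p' - B 0)" using key by (simp add: vanishes_def mpol_eval_diff)
    show "\<not> vanishes A (B 0)"
    proof
      assume "vanishes A (B 0)"
      then have "vanishes A (p * p')" using key by (simp add: vanishes_def)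
      then have "vanishes A p'" using vanishes_mult[of A, OF A p p'f] nv by blast
      then have "vanishes A (conj \<iota> * conj (-1)) \<or> vanishes A (conj (- \<iota>))"
        unfolding p'_def
        by (intro vanishes_mult[of A, OF A forms_mult[OF is_subfield_UNIV conj_form conj_form] conj_form])
      then have "vanishes A (conj \<iota>) \<or> vanishes A (conj (-1)) \<or> vanishes A (conj (- \<iota>))"
        using vanishes_mult[of A, OF A conj_form conj_form] by blast
      moreover have "\<iota> ^ 4 = 1" using i2 by (simp add: eval_nat_numeral mult.assoc)
      ultimately show False using conj_nv by fastforce
    qed
  qed
qed


section \<open>Diagonal quartics are smooth projective curves\<close>

lemma proj_closed_proj_space: "proj_closed E n V \<Longrightarrow> V \<subseteq> proj_space n"
  by (auto simp: proj_closed_def)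

lemma proj_irreducibleD:
  assumes "proj_irreducible n Z"
  shows "proj_closed UNIV n Z" "Z \<noteq> {}" "Z \<subseteq> proj_space n"
    "proj_closed UNIV n X \<Longrightarrow> proj_closed UNIV n Y \<Longrightarrow> Z \<subseteq> X \<union> Y \<Longrightarrow> Z \<subseteq> X \<or> Z \<subseteq> Y"
proof -
  show "proj_closed UNIV n Z" "Z \<noteq> {}"
    "proj_closed UNIV n X \<Longrightarrow> proj_closed UNIV n Y \<Longrightarrow> Z \<subseteq> X \<union> Y \<Longrightarrow> Z \<subseteq> X \<or> Z \<subseteq> Y"
    using assms by (simp_all add: proj_irreducible_def)
  then show "Z \<subseteq> proj_space n" by (intro proj_closed_proj_space)
qed

lemma proj_irreducible_quartic:
  fixes A :: "nat \<Rightarrow> 'a::{alg_closed_field, field_char_0}"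
  assumes A: "A 0 \<noteq> 0" "A 1 \<noteq> 0" "A 2 \<noteq> 0"
  shows "proj_irreducible 2 (quartic A)"
  unfolding proj_irreducible_def
proof (intro conjI allI impI)
  show "proj_closed UNIV 2 (quartic A)" by (intro proj_closed_quartic is_subfield_UNIV) auto
  obtain \<zeta> where z: "\<zeta> ^ 4 = - (A 0 * 1 ^ 4 + A 1 * 0 ^ 4) / A 2"
    using nth_root_exists[of 4 "- (A 0 * 1 ^ 4 + A 1 * 0 ^ 4) / A 2"] by auto
  have "on_cone A (vec3 1 0 \<zeta>)" using on_cone_vec3[of A, OF A(3) z] by simp
  then have "proj_point (vec3 1 0 \<zeta>) \<in> quartic A" by (rule quartic_memI) simp
  then show "quartic A \<noteq> {}" by blast
next
  fix X Y assume *: "proj_closed UNIV 2 X \<and> proj_closed UNIV 2 Y \<and> quartic A \<subseteq> X \<union> Y"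
  obtain S where S: "S \<subseteq> (\<Union>d. forms UNIV 2 d)" "X = {P \<in> proj_space 2. \<forall>f\<in>S. \<forall>v\<in>P. mpol_eval f v = 0}"
    using * by (auto simp: proj_closed_def)
  obtain T where T: "T \<subseteq> (\<Union>d. forms UNIV 2 d)" "Y = {P \<in> proj_space 2. \<forall>f\<in>T. \<forall>v\<in>P. mpol_eval f v = 0}"
    using * by (auto simp: proj_closed_def)
  show "quartic A \<subseteq> X \<or> quartic A \<subseteq> Y"
  proof (rule ccontr)
    assume "\<not> ?thesis"
    then obtain P Q where P: "P \<in> quartic A" "P \<notin> X" and Q: "Q \<in> quartic A" "Q \<notin> Y" by blast
    then obtain f v where f: "f \<in> S" "v \<in> P" "mpol_eval f v \<noteq> 0"
      using S(2) quartic_subset[of A] by blast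
    obtain g w where g: "g \<in> T" "w \<in> Q" "mpol_eval g w \<noteq> 0"
      using Q T(2) quartic_subset[of A] by blast
    obtain d e where d: "f \<in> forms UNIV 2 d" "g \<in> forms UNIV 2 e" using S(1) T(1) f(1) g(1) by blast
    have "vanishes A (f * g)"
      unfolding vanishes_iff_quartic[OF forms_mult[OF is_subfield_UNIV d]] mpol_eval_mult
    proof (intro ballI)
      fix R u assume R: "R \<in> quartic A" "u \<in> R"
      then have "R \<in> X \<or> R \<in> Y" using * by blast
      then show "mpol_eval f u * mpol_eval g u = 0" using R(2) f(1) g(1) S(2) T(2) by auto
    qed
    then have "vanishes A f \<or> vanishes A g" by (rule vanishes_mult[of A, OF A d])
    then show False
      using P(1) Q(1) f(2,3) g(2,3) vanishes_iff_quartic[OF d(1), of A] vanishes_iff_quartic[OF d(2), of A]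
      by metis
  qed
qed

lemma proj_irreducible_mult:
  assumes Z: "proj_irreducible n Z"
    and f: "f \<in> forms UNIV n d" and g: "g \<in> forms UNIV n e"
    and fg: "\<And>P v. P \<in> Z \<Longrightarrow> v \<in> P \<Longrightarrow> mpol_eval f v * mpol_eval g v = 0"
  shows "(\<forall>P\<in>Z. \<forall>v\<in>P. mpol_eval f v = 0) \<or> (\<forall>P\<in>Z. \<forall>v\<in>P. mpol_eval g v = 0)"
proof -
  define V where "V f = {P \<in> proj_space n. \<forall>f\<in>{f}. \<forall>v\<in>P. mpol_eval f v = 0}" for f :: "'a mpol"
  have sub: "Z \<subseteq> proj_space n"
    by (rule proj_irreducibleD(3)[OF Z])
  have cl: "proj_closed UNIV n (V f)" if "f \<in> forms UNIV n d" for f d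
    unfolding proj_closed_def V_def by (intro exI[of _ "{f}"]) (use that in auto)
  have all: "mpol_eval f w = 0" if "f \<in> forms UNIV n d" "P \<in> proj_space n" "v \<in> P" "w \<in> P" "mpol_eval f v = 0"
    for f d P v w
  proof -
    have "w \<in> proj_point v" using proj_spaceD(1)[OF that(2,3)] that(4) by simp
    then obtain c where "w = (\<lambda>i. c * v i)" by (auto simp: proj_point_mem_iff)
    then show ?thesis using mpol_eval_homogeneous[OF that(1), of c v] that(5) by simp
  qed
  have "Z \<subseteq> V f \<union> V g"
  proof
    fix P assume P: "P \<in> Z"
    then have PS: "P \<in> proj_space n" using sub by blast
    then obtain v where v: "v \<in> P" using proj_space_nonempty by blast
    then have "mpol_eval f v = 0 \<or> mpol_eval g v = 0" using fg[OF P v] by simp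
    then show "P \<in> V f \<union> V g" using all[OF f PS v] all[OF g PS v] PS by (auto simp: V_def)
  qed
  then have "Z \<subseteq> V f \<or> Z \<subseteq> V g" by (rule proj_irreducibleD(4)[OF Z cl[OF f] cl[OF g]])
  then show ?thesis by (auto simp: V_def)
qed

text \<open>Binary forms split into linear factors, and the irreducibility of \<open>Z\<close> singles out one of them.\<close>

lemma irreducible_binary_zero:
  fixes Z :: "'a::{alg_closed_field, field_char_0} ppoint set"
  assumes Z: "proj_irreducible 2 Z"
    and "n \<in> forms UNIV 1 e" "n \<noteq> 0" "\<And>P v. P \<in> Z \<Longrightarrow> v \<in> P \<Longrightarrow> mpol_eval n v = 0"
  shows "\<exists>x0 y0. (x0 \<noteq> 0 \<or> y0 \<noteq> 0) \<and> (\<forall>P\<in>Z. \<forall>v\<in>P. y0 * v 0 = x0 * v 1)"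
  using assms(2-)
proof (induction e arbitrary: n)
  case 0
  have c: "n = Const (Poly_Mapping.lookup n 0)" using constant_form 0 by blast
  obtain P where P: "P \<in> Z" using proj_irreducibleD(2)[OF Z] by blast
  moreover have "P \<in> proj_space 2" using proj_irreducibleD(3)[OF Z] P by (rule subsetD)
  then obtain v where "v \<in> P" using proj_space_nonempty by blast
  ultimately have "mpol_eval n v = 0" using 0 by blast
  then have "Poly_Mapping.lookup n 0 = 0" by (subst (asm) c) simp
  then show ?case using c 0 by simp
next
  case (Suc e)
  obtain x0 y0 where xy: "x0 \<noteq> 0 \<or> y0 \<noteq> 0" "mpol_eval n (vec3 x0 y0 0) = 0"
    using binary_form_root[OF Suc.prems(1)] by blast
  obtain n' where n': "n' \<in> forms UNIV 1 e" "n = (Const y0 * Var 0 - Const x0 * Var 1) * n'"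
    using binary_form_factor[OF Suc.prems(1) xy] by blast
  define l where "l = Const y0 * Var 0 - Const x0 * (Var 1 :: 'a mpol)"
  have "l \<in> forms UNIV 2 (0 + 1)"
    unfolding l_def by (intro forms_diff forms_mult forms_Const forms_Var is_subfield_UNIV) auto
  moreover have "n' \<in> forms UNIV 2 e" using n'(1) forms_mono[of UNIV UNIV 1 2 e] by auto
  ultimately have "(\<forall>P\<in>Z. \<forall>v\<in>P. mpol_eval l v = 0) \<or> (\<forall>P\<in>Z. \<forall>v\<in>P. mpol_eval n' v = 0)"
    using Suc.prems(3) by (intro proj_irreducible_mult[OF Z]) (auto simp: n'(2) l_def mpol_eval_mult)
  then show ?case
  proof
    assume "\<forall>P\<in>Z. \<forall>v\<in>P. mpol_eval l v = 0"
    then show ?thesis using xy(1)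
      by (intro exI[of _ x0] exI[of _ y0]) (auto simp: l_def mpol_eval_diff mpol_eval_mult)
  next
    assume "\<forall>P\<in>Z. \<forall>v\<in>P. mpol_eval n' v = 0"
    then show ?thesis using Suc.IH[OF n'(1)] n'(2) Suc.prems(2) by auto
  qed
qed

text \<open>Some form vanishes on \<open>Z\<close> but not on the quartic. Its norm splits into linear forms in \<open>x\<close> and
  \<open>y\<close>, one of which vanishes on \<open>Z\<close>, so that the equation of the quartic splits over \<open>Z\<close> as well.\<close>

lemma irreducible_proper_subset_quartic:
  fixes A :: "nat \<Rightarrow> 'a::{alg_closed_field, field_char_0}"
  assumes A: "A 0 \<noteq> 0" "A 1 \<noteq> 0" "A 2 \<noteq> 0"
    and Z: "proj_irreducible 2 Z" "Z \<subset> quartic A"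
  shows "\<exists>P. Z = {P}"
proof -
  obtain S where S: "S \<subseteq> (\<Union>d. forms UNIV 2 d)" "Z = {P \<in> proj_space 2. \<forall>f\<in>S. \<forall>v\<in>P. mpol_eval f v = 0}"
    using Z(1) by (auto simp: proj_irreducible_def proj_closed_def)
  obtain Q where Q: "Q \<in> quartic A" "Q \<notin> Z" using Z(2) by blast
  then obtain f v where f: "f \<in> S" "v \<in> Q" "mpol_eval f v \<noteq> 0"
    using S(2) quartic_subset[of A] by blast
  obtain d where d: "f \<in> forms UNIV 2 d" using S(1) f(1) by blast
  have "\<not> vanishes A f" using vanishes_iff_quartic[OF d, of A] Q(1) f(2,3) by metis
  then obtain n f' where n: "n \<in> forms UNIV 1 (4 * d)" "f' \<in> forms UNIV 2 (3 * d)"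
    "\<not> vanishes A n" "vanishes A (f * f' - n)"
    by (rule norm_form[of A, OF A d]) blast
  have on: "on_cone A v" if "P \<in> Z" "v \<in> P" for P v using quartic_memD Z(2) that by blast
  have "mpol_eval n v = 0" if "P \<in> Z" "v \<in> P" for P v
  proof -
    have "mpol_eval f v = 0" using S(2) f(1) that by blast
    moreover have "mpol_eval (f * f' - n) v = 0" using n(4) on[OF that] by (simp add: vanishes_def)
    ultimately show ?thesis by (simp add: mpol_eval_diff mpol_eval_mult)
  qed
  moreover have "n \<noteq> 0" using n(3) by (auto simp: vanishes_def mpol_eval_def)
  ultimately obtain x0 y0 where xy: "x0 \<noteq> 0 \<or> y0 \<noteq> 0"
    and lin: "\<And>P v. P \<in> Z \<Longrightarrow> v \<in> P \<Longrightarrow> y0 * v 0 = x0 * v 1"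
    using irreducible_binary_zero[OF Z(1) n(1)] by blast
  obtain r s where rs: "r * x0 + s * y0 = 1"
  proof (cases "x0 = 0")
    case True then show ?thesis using xy that[of 0 "1 / y0"] by simp
  next
    case False then show ?thesis using that[of "1 / x0" 0] by simp
  qed
  define m where "m v = r * v 0 + s * v 1" for v :: "nat \<Rightarrow> 'a"
  have xm: "v 0 = x0 * m v" "v 1 = y0 * m v" if "P \<in> Z" "v \<in> P" for P v
  proof -
    have "v 0 = (r * x0 + s * y0) * v 0" "v 1 = (r * x0 + s * y0) * v 1" using rs by simp_all
    then show "v 0 = x0 * m v" "v 1 = y0 * m v" using lin[OF that] unfolding m_def by algebra+
  qed
  obtain \<rho> where rho: "\<rho> ^ 4 = - (A 0 * x0 ^ 4 + A 1 * y0 ^ 4) / A 2"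
    using nth_root_exists[of 4 "- (A 0 * x0 ^ 4 + A 1 * y0 ^ 4) / A 2"] by auto
  obtain \<iota> :: 'a where i: "\<iota> ^ 2 = -1" using nth_root_exists[of 2 "-1::'a"] by auto
  define g where "g u = Var 2 - Const u * (Const r * Var 0 + Const s * Var 1 :: 'a mpol)" for u
  have g_eval: "mpol_eval (g u) v = v 2 - u * m v" for u v
    by (simp add: g_def m_def mpol_eval_diff mpol_eval_mult mpol_eval_add)
  have g_form: "g u \<in> forms UNIV 2 1" for u
  proof -
    have "Const u * (Const r * Var 0 + Const s * Var 1) \<in> forms UNIV 2 (0 + (0 + 1))"
      by (intro forms_mult forms_add forms_Const forms_Var is_subfield_UNIV) auto
    then show ?thesis unfolding g_def by (intro forms_diff forms_Var is_subfield_UNIV) auto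
  qed
  have prod: "(mpol_eval (g \<rho>) v * mpol_eval (g (- \<rho>)) v) * (mpol_eval (g (\<iota> * \<rho>)) v * mpol_eval (g (- (\<iota> * \<rho>))) v) = 0"
    if "P \<in> Z" "v \<in> P" for P v
  proof -
    have "A 0 * v 0 ^ 4 + A 1 * v 1 ^ 4 + A 2 * v 2 ^ 4 = 0"
      using on[OF that] by (simp add: on_cone_def)
    then have "A 2 * v 2 ^ 4 = - (A 0 * x0 ^ 4 + A 1 * y0 ^ 4) * m v ^ 4"
      unfolding xm[OF that] by (simp add: power_mult_distrib) algebra
    also have "\<dots> = A 2 * (\<rho> ^ 4 * m v ^ 4)" using A(3) by (simp add: rho)
    finally have "v 2 ^ 4 = \<rho> ^ 4 * m v ^ 4" using A(3) by simp
    then show ?thesis unfolding g_eval using i by algebra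
  qed
  note irr = proj_irreducible_mult[OF Z(1)]
  have split: "\<exists>u. \<forall>P\<in>Z. \<forall>v\<in>P. mpol_eval (g u) v = 0"
    if "\<forall>P\<in>Z. \<forall>v\<in>P. mpol_eval (g a * g b) v = 0" for a b
  proof -
    have "(\<forall>P\<in>Z. \<forall>v\<in>P. mpol_eval (g a) v = 0) \<or> (\<forall>P\<in>Z. \<forall>v\<in>P. mpol_eval (g b) v = 0)"
      by (rule irr[OF g_form g_form]) (use that in \<open>simp add: mpol_eval_mult\<close>)
    then show ?thesis by auto
  qed
  have "(\<forall>P\<in>Z. \<forall>v\<in>P. mpol_eval (g \<rho> * g (- \<rho>)) v = 0) \<or>
      (\<forall>P\<in>Z. \<forall>v\<in>P. mpol_eval (g (\<iota> * \<rho>) * g (- (\<iota> * \<rho>))) v = 0)"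
    by (rule irr[OF forms_mult[OF is_subfield_UNIV g_form g_form] forms_mult[OF is_subfield_UNIV g_form g_form]])
      (unfold mpol_eval_mult, rule prod)
  then have "\<exists>u. \<forall>P\<in>Z. \<forall>v\<in>P. mpol_eval (g u) v = 0" using split by (elim disjE)
  then obtain u where u: "\<And>P v. P \<in> Z \<Longrightarrow> v \<in> P \<Longrightarrow> v 2 = u * m v" by (auto simp: g_eval)
  have "P = proj_point (vec3 x0 y0 u)" if P: "P \<in> Z" for P
  proof -
    have PS: "P \<in> proj_space 2" using P S(2) by blast
    then obtain v where v: "v \<in> P" using proj_space_nonempty by blast
    have eq: "v = (\<lambda>i. m v * vec3 x0 y0 u i)"
    proof
      fix i
      show "v i = m v * vec3 x0 y0 u i"
        using xm[OF P v] u[OF P v] proj_spaceD(3)[OF PS v, of i] le_2_cases[of i]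
        by (cases "i \<le> 2") (auto simp: mult.commute)
    qed
    then have "m v \<noteq> 0" using proj_spaceD(2)[OF PS v] by (metis mult_zero_left)
    then show ?thesis using proj_spaceD(1)[OF PS v] eq proj_point_scale by metis
  qed
  moreover have "Z \<noteq> {}" by (rule proj_irreducibleD(2)[OF Z(1)])
  ultimately show ?thesis by blast
qed


lemma proj_irreducible_point:
  fixes P :: "'a::field ppoint"
  assumes P: "P \<in> proj_space 2"
  shows "proj_irreducible 2 {P}"
proof -
  obtain u where u: "u \<in> P" using proj_space_nonempty[OF P] by blast
  note d = proj_spaceD[OF P u]
  define S where "S = {Const (u j) * Var i - Const (u i) * (Var j :: 'a mpol) | i j. i \<le> 2 \<and> j \<le> 2}"
  have "{P} = {Q \<in> proj_space 2. \<forall>f\<in>S. \<forall>v\<in>Q. mpol_eval f v = 0}"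
  proof (intro set_eqI iffI)
    fix Q assume "Q \<in> {P}"
    moreover have "mpol_eval f v = 0" if "f \<in> S" "v \<in> P" for f v
    proof -
      have "v \<in> proj_point u" using d(1) that(2) by simp
      then obtain c where "v = (\<lambda>i. c * u i)" by (auto simp: proj_point_mem_iff)
      then show ?thesis using that(1) by (auto simp: S_def mpol_eval_diff mpol_eval_mult)
    qed
    ultimately show "Q \<in> {Q \<in> proj_space 2. \<forall>f\<in>S. \<forall>v\<in>Q. mpol_eval f v = 0}" using P by blast
  next
    fix Q assume "Q \<in> {Q \<in> proj_space 2. \<forall>f\<in>S. \<forall>v\<in>Q. mpol_eval f v = 0}"
    then have Q: "Q \<in> proj_space 2" and zero: "\<And>f v. f \<in> S \<Longrightarrow> v \<in> Q \<Longrightarrow> mpol_eval f v = 0" by auto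
    obtain v where v: "v \<in> Q" using proj_space_nonempty[OF Q] by blast
    note dv = proj_spaceD[OF Q v]
    obtain j where j: "j \<le> 2" "u j \<noteq> 0" using d(2) by blast
    have eq: "u j * v i = u i * v j" if "i \<le> 2" for i
    proof -
      have "Const (u j) * Var i - Const (u i) * Var j \<in> S" using that j(1) by (auto simp: S_def)
      from zero[OF this v] show ?thesis by (simp add: mpol_eval_diff mpol_eval_mult)
    qed
    have v_eq: "v = (\<lambda>i. v j / u j * u i)"
    proof
      fix i show "v i = v j / u j * u i"
        using eq[of i] j(2) d(3)[of i] dv(3)[of i] by (cases "i \<le> 2") (auto simp: field_simps)
    qed
    have "v j / u j \<noteq> 0"
    proof
      assume "v j / u j = 0"
      then have "v i = 0" for i using v_eq by (metis mult_zero_left)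
      then show False using dv(2) by simp
    qed
    then have "proj_point v = proj_point u" using v_eq proj_point_scale by metis
    then show "Q \<in> {P}" using dv(1) d(1) by simp
  qed
  moreover have "S \<subseteq> (\<Union>d. forms UNIV 2 d)"
  proof
    fix f assume "f \<in> S"
    then obtain i j where "i \<le> 2" "j \<le> 2" and f: "f = Const (u j) * Var i - Const (u i) * Var j"
      by (auto simp: S_def)
    then have "f \<in> forms UNIV 2 (0 + 1)"
      unfolding f by (intro forms_diff forms_mult forms_Const forms_Var is_subfield_UNIV) auto
    then show "f \<in> (\<Union>d. forms UNIV 2 d)" by blast
  qed
  ultimately have "proj_closed UNIV 2 {P}" unfolding proj_closed_def by (intro exI[of _ S] conjI)
  then show ?thesis by (simp add: proj_irreducible_def)
qed

lemma two_points_quartic: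
  fixes A :: "nat \<Rightarrow> 'a::{alg_closed_field, field_char_0}"
  assumes A: "A 0 \<noteq> 0" "A 1 \<noteq> 0" "A 2 \<noteq> 0"
  shows "\<exists>P\<in>quartic A. \<exists>Q\<in>quartic A. P \<noteq> Q"
proof -
  obtain \<zeta> where z: "\<zeta> ^ 4 = - (A 0 * 1 ^ 4 + A 1 * 0 ^ 4) / A 2"
    using nth_root_exists[of 4 "- (A 0 * 1 ^ 4 + A 1 * 0 ^ 4) / A 2"] by auto
  then have "\<zeta> \<noteq> 0" using A by auto
  have "(- \<zeta>) ^ 4 = - (A 0 * 1 ^ 4 + A 1 * 0 ^ 4) / A 2" using z by simp
  from on_cone_vec3[of A, OF A(3) this] on_cone_vec3[of A, OF A(3) z]
  have "on_cone A (vec3 1 0 (- \<zeta>))" "on_cone A (vec3 1 0 \<zeta>)" by simp_all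
  then have "proj_point (vec3 1 0 (- \<zeta>)) \<in> quartic A" "proj_point (vec3 1 0 \<zeta>) \<in> quartic A"
    by (auto intro: quartic_memI)
  moreover have "proj_point (vec3 1 0 (- \<zeta>)) \<noteq> proj_point (vec3 1 0 \<zeta>)"
  proof
    assume "proj_point (vec3 1 0 (- \<zeta>)) = proj_point (vec3 1 0 \<zeta>)"
    then obtain c where c: "vec3 1 0 (- \<zeta>) = (\<lambda>i. c * vec3 1 0 \<zeta> i)" unfolding proj_point_eq_iff by blast
    have "c = 1" using fun_cong[OF c, of 0] by simp
    then have "- \<zeta> = \<zeta>" using fun_cong[OF c, of 2] by simp
    then have "2 * \<zeta> = 0" by (metis add.right_inverse mult_2)
    then show False using \<open>\<zeta> \<noteq> 0\<close> by simp
  qed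
  ultimately show ?thesis by blast
qed

text \<open>A chain of length \<open>2\<close> would contain two irreducible proper subsets of the quartic, one strictly
  inside the other, but both are points.\<close>

lemma has_dimension_quartic:
  fixes A :: "nat \<Rightarrow> 'a::{alg_closed_field, field_char_0}"
  assumes A: "A 0 \<noteq> 0" "A 1 \<noteq> 0" "A 2 \<noteq> 0"
  shows "has_dimension 2 (quartic A) 1"
  unfolding has_dimension_def
proof
  obtain P Q where P: "P \<in> quartic A" "Q \<in> quartic A" "P \<noteq> Q" using two_points_quartic[of A, OF A] by blast
  have "P \<in> proj_space 2" using P(1) quartic_subset[of A] by blast
  from proj_irreducible_point[OF this] proj_irreducible_quartic[of A, OF A]
  show "irreducible_chain 2 (quartic A) 1"
    unfolding irreducible_chain_def using P
    by (intro exI[of _ "\<lambda>i. if i = 0 then {P} else quartic A"]) auto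
  show "\<not> irreducible_chain 2 (quartic A) (Suc 1)"
  proof
    assume "irreducible_chain 2 (quartic A) (Suc 1)"
    then obtain Z where Z: "\<And>i. i \<le> Suc 1 \<Longrightarrow> proj_irreducible 2 (Z i) \<and> Z i \<subseteq> quartic A"
      and lt: "\<And>i. i < Suc 1 \<Longrightarrow> Z i \<subset> Z (Suc i)" unfolding irreducible_chain_def by blast
    have "Z 1 \<subset> quartic A" using Z[of "Suc 1"] lt[of 1] by auto
    then obtain R where R: "Z 1 = {R}"
      using irreducible_proper_subset_quartic[of A "Z 1", OF A] Z[of 1] by auto
    have "Z 0 \<subset> {R}" using lt[of 0] R by simp
    then have "Z 0 = {}" by auto
    then show False using proj_irreducibleD(2) Z[of 0] by blast
  qed
qed

text \<open>The three derivations of the coordinate ring that are obtained by omitting one coordinate. Along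
  the germ they are multiples of \<open>d/dt\<close> up to multiples of the form itself, which come from Euler's
  relation.\<close>

definition tangent_deriv :: "(nat \<Rightarrow> 'a::field) \<Rightarrow> nat \<Rightarrow> 'a mpol \<Rightarrow> 'a mpol" where
  "tangent_deriv A l p = vec3
     (Const (A 1) * Var 1 ^ 3 * mpol_pderiv 2 p - Const (A 2) * Var 2 ^ 3 * mpol_pderiv 1 p)
     (Const (A 2) * Var 2 ^ 3 * mpol_pderiv 0 p - Const (A 0) * Var 0 ^ 3 * mpol_pderiv 2 p)
     (Const (A 0) * Var 0 ^ 3 * mpol_pderiv 1 p - Const (A 1) * Var 1 ^ 3 * mpol_pderiv 0 p) l"

lemma forms_tangent_deriv:
  assumes p: "p \<in> forms UNIV 2 d"
  shows "tangent_deriv A l p \<in> forms UNIV 2 (d + 2)"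
proof -
  have "Const (A j) * Var j ^ 3 \<in> forms UNIV 2 (0 + 3 * 1)" if "j \<le> 2" for j
    using that by (intro forms_mult[OF is_subfield_UNIV forms_Const[OF is_subfield_UNIV UNIV_I]
          forms_power[OF is_subfield_UNIV forms_Var[OF is_subfield_UNIV]]])
  then have "Const (A j) * Var j ^ 3 * mpol_pderiv i p \<in> forms UNIV 2 (d + 2)" if "j \<le> 2" for i j
    using that by (intro forms_mult_pderiv[OF p]) simp
  then show ?thesis unfolding tangent_deriv_def
    by (auto simp: vec3_def forms_zero is_subfield_UNIV intro!: forms_diff[OF is_subfield_UNIV])
qed

lemma germ_tangent_deriv:
  fixes p :: "'a::field_char_0 mpol"
  assumes \<xi>: "is_germ A \<xi>" and p: "p \<in> forms UNIV 2 d"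
  shows "germ \<xi> (tangent_deriv A 1 p) = - fps_const (A 0) * \<xi> ^ 3 * fps_deriv (germ \<xi> p)"
    "germ \<xi> (tangent_deriv A 0 p) =
       \<xi> * germ \<xi> (tangent_deriv A 1 p) - fps_const (A 2) * fps_X ^ 3 * of_nat d * germ \<xi> p"
    "germ \<xi> (tangent_deriv A 2 p) =
       fps_X * germ \<xi> (tangent_deriv A 1 p) + fps_const (A 0) * \<xi> ^ 3 * of_nat d * germ \<xi> p"
proof -
  define x y z where "x = germ \<xi> (mpol_pderiv 0 p)" and "y = germ \<xi> (mpol_pderiv 1 p)"
    and "z = germ \<xi> (mpol_pderiv 2 p)"
  define a b c where "a = fps_const (A 0)" and "b = fps_const (A 1)" and "c = fps_const (A 2)"
  have t: "germ \<xi> (tangent_deriv A 0 p) = b * z - c * fps_X ^ 3 * y"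
    "germ \<xi> (tangent_deriv A 1 p) = c * fps_X ^ 3 * x - a * \<xi> ^ 3 * z"
    "germ \<xi> (tangent_deriv A 2 p) = a * \<xi> ^ 3 * y - b * x"
    by (simp_all add: tangent_deriv_def germ_simps x_def y_def z_def a_def b_def c_def)
  have eq: "a * \<xi> ^ 4 + b + c * fps_X ^ 4 = 0"
    using \<xi> by (simp add: is_germ_def a_def b_def c_def)
  have euler: "\<xi> * x + y + fps_X * z = of_nat d * germ \<xi> p"
    using euler_relation[OF is_ring_hom_fps_const p, of "vec3 \<xi> 1 fps_X"]
    by (simp add: x_def y_def z_def germ_def)
  have der: "fps_deriv (germ \<xi> p) = x * fps_deriv \<xi> + z"
    using fps_deriv_hom_eval[OF p, of "vec3 \<xi> 1 fps_X"] by (simp add: x_def y_def z_def germ_def)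
  have "fps_deriv (a * \<xi> ^ 4 + b + c * fps_X ^ 4) = 0" unfolding eq by simp
  then have "fps_const 4 * (a * \<xi> ^ 3 * fps_deriv \<xi> + c * fps_X ^ 3) = 0"
    by (simp add: a_def b_def c_def fps_deriv_power algebra_simps)
  then have dx: "a * \<xi> ^ 3 * fps_deriv \<xi> + c * fps_X ^ 3 = 0"
    by (simp only: mult_eq_0_iff fps_const_eq_0_iff) simp
  show "germ \<xi> (tangent_deriv A 1 p) = - fps_const (A 0) * \<xi> ^ 3 * fps_deriv (germ \<xi> p)"
    unfolding t der a_def[symmetric] using dx by algebra
  show "germ \<xi> (tangent_deriv A 0 p) =
       \<xi> * germ \<xi> (tangent_deriv A 1 p) - fps_const (A 2) * fps_X ^ 3 * of_nat d * germ \<xi> p"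
    unfolding t mult.assoc[of _ "of_nat d"] euler[symmetric] c_def[symmetric] using eq by algebra
  show "germ \<xi> (tangent_deriv A 2 p) =
       fps_X * germ \<xi> (tangent_deriv A 1 p) + fps_const (A 0) * \<xi> ^ 3 * of_nat d * germ \<xi> p"
    unfolding t mult.assoc[of _ "of_nat d"] euler[symmetric] a_def[symmetric] using eq by algebra
qed

lemma pderiv_quartic_form:
  fixes A :: "nat \<Rightarrow> 'a::field"
  assumes "i \<le> 2"
  shows "mpol_eval (mpol_pderiv i (quartic_form A)) v = 4 * A i * v i ^ 3"
proof -
  define e where "e j = Poly_Mapping.single j (4::nat)" for j :: nat
  have inj: "e j = e j' \<longleftrightarrow> j = j'" for j j'
    by (metis e_def keys_single numeral_neq_zero singleton_inject[of j j'] singletonI)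
  have q: "quartic_form A = (\<Sum>j\<le>2. Poly_Mapping.single (e j) (A j))"
    by (simp add: quartic_form_def Var_power Const_def mult_single e_def atMost_2)
  have lk: "Poly_Mapping.lookup (quartic_form A) (e j) = A j" if "j \<le> 2" for j
    using that unfolding q lookup_sum by (simp add: lookup_single when_def inj)
  have keys: "Poly_Mapping.keys (quartic_form A) \<subseteq> e ` {..2}"
    unfolding q using keys_sum[of "\<lambda>j. Poly_Mapping.single (e j) (A j)" "{..2}"] by (auto split: if_splits)
  have "mpol_eval (mpol_pderiv i (quartic_form A)) v =
    (\<Sum>m\<in>Poly_Mapping.keys (quartic_form A). Poly_Mapping.lookup (quartic_form A) m *
      of_nat (Poly_Mapping.lookup m i) * monom_eval (m - Poly_Mapping.single i 1) v)"
    unfolding mpol_eval_hom_eval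
    by (rule hom_eval_pderiv[OF is_ring_hom_id forms_quartic_form[OF is_subfield_UNIV UNIV_I]])
  also have "\<dots> = (\<Sum>m\<in>e ` {..2}. Poly_Mapping.lookup (quartic_form A) m *
      of_nat (Poly_Mapping.lookup m i) * monom_eval (m - Poly_Mapping.single i 1) v)"
    using keys by (intro sum.mono_neutral_left) (auto simp: in_keys_iff)
  also have "\<dots> = (\<Sum>j\<le>2. A j * of_nat (Poly_Mapping.lookup (e j) i) * monom_eval (e j - Poly_Mapping.single i 1) v)"
    by (subst sum.reindex) (auto simp: inj inj_on_def lk)
  also have "\<dots> = (\<Sum>j\<le>2. if j = i then 4 * A i * v i ^ 3 else 0)"
    by (intro sum.cong) (auto simp: e_def lookup_single when_def simp flip: single_diff)
  also have "\<dots> = 4 * A i * v i ^ 3" using assms by simp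
  finally show ?thesis .
qed

text \<open>If \<open>p\<close> vanishes on the curve, so do its tangential derivatives, which says that the gradient of
  \<open>p\<close> is parallel to that of the quartic.\<close>

lemma jacobian_rank_quartic:
  fixes A :: "nat \<Rightarrow> 'a::{alg_closed_field, field_char_0}"
  assumes A: "A 0 \<noteq> 0" "A 1 \<noteq> 0" "A 2 \<noteq> 0" and P: "P \<in> quartic A" "v \<in> P"
  shows "jacobian_rank 2 (quartic A) v = 1"
proof -
  have v: "on_cone A v" using quartic_memD P by blast
  obtain \<xi> where \<xi>: "is_germ A \<xi>" using ex_germ_quartic[of A, OF A(1,2)] by blast
  note iff = vanishes_iff_germ[where A = A, OF A(1) A(3) \<xi>]
  define w where "w = gradient 2 (quartic_form A) v"
  have wi: "w i = 4 * A i * v i ^ 3" if "i \<le> 2" for i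
    using that pderiv_quartic_form[OF that, of A v] by (simp add: w_def gradient_def)
  define G where "G = {gradient 2 f v | f d. f \<in> forms UNIV 2 d \<and> (\<forall>P\<in>quartic A. \<forall>w\<in>P. mpol_eval f w = 0)}"
  have "\<exists>c. g = (\<lambda>i. c * w i)" if g_G: "g \<in> G" for g
  proof -
    obtain f d where g: "g = gradient 2 f v" and f: "f \<in> forms UNIV 2 d"
      and zero: "\<forall>P\<in>quartic A. \<forall>w\<in>P. mpol_eval f w = 0"
      using g_G unfolding G_def by blast
    then have "vanishes A f" using vanishes_iff_quartic[OF f, of A] by simp
    then have z: "germ \<xi> f = 0" using iff[OF f] by simp
    have "germ \<xi> (tangent_deriv A 1 f) = 0" using germ_tangent_deriv(1)[OF \<xi> f] z by simp
    then have "germ \<xi> (tangent_deriv A l f) = 0" if "l \<le> 2" for l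
      using germ_tangent_deriv(2,3)[OF \<xi> f] z le_2_cases[OF that] by auto
    then have "vanishes A (tangent_deriv A l f)" if "l \<le> 2" for l
      using iff[OF forms_tangent_deriv[OF f]] that by blast
    then have t: "mpol_eval (tangent_deriv A l f) v = 0" if "l \<le> 2" for l
      using v that by (simp add: vanishes_def)
    define x y z where "x = mpol_eval (mpol_pderiv 0 f) v" and "y = mpol_eval (mpol_pderiv 1 f) v"
      and "z = mpol_eval (mpol_pderiv 2 f) v"
    define w' where "w' i = A i * v i ^ 3" for i
    have e: "w' 1 * z = w' 2 * y" "w' 2 * x = w' 0 * z" "w' 0 * y = w' 1 * x"
      using t[of 0] t[of 1] t[of 2]
      by (simp_all add: tangent_deriv_def mpol_eval_diff mpol_eval_mult mpol_eval_power x_def y_def z_def w'_def)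
    obtain i where i: "i \<le> 2" "w' i \<noteq> 0"
      using v A le_2_cases unfolding on_cone_def w'_def by (metis mult_eq_0_iff power_eq_0_iff)
    have "\<exists>c. x = c * w' 0 \<and> y = c * w' 1 \<and> z = c * w' 2"
    proof -
      have "i = 0 \<or> i = 1 \<or> i = 2" using le_2_cases[OF i(1)] .
      then show ?thesis
      proof (elim disjE)
        assume "i = 0"
        then show ?thesis using i(2) e by (intro exI[of _ "x / w' 0"]) (simp add: field_simps)
      next
        assume "i = 1"
        then show ?thesis using i(2) e by (intro exI[of _ "y / w' 1"]) (simp add: field_simps)
      next
        assume "i = 2"
        then show ?thesis using i(2) e by (intro exI[of _ "z / w' 2"]) (simp add: field_simps)
      qed
    qed
    then obtain c where c: "x = c * w' 0" "y = c * w' 1" "z = c * w' 2" by blast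
    have "g = (\<lambda>i. c / 4 * w i)"
    proof
      fix i
      show "g i = c / 4 * w i"
      proof (cases "i \<le> 2")
        case True
        then show ?thesis using le_2_cases[OF True] c wi[OF True]
          by (auto simp: g gradient_def x_def y_def z_def w'_def)
      next
        case False then show ?thesis by (simp add: g gradient_def w_def)
      qed
    qed
    then show ?thesis by blast
  qed
  then have sub: "G \<subseteq> coord_vs.span {w}" by (auto simp: coord_vs.span_singleton)
  have wG: "w \<in> G"
  proof -
    have q: "quartic_form A \<in> forms UNIV 2 4" by (intro forms_quartic_form is_subfield_UNIV) auto
    have "vanishes A (quartic_form A)"
      by (simp add: vanishes_def mpol_eval_quartic_form on_cone_def)
    then show ?thesis using q vanishes_iff_quartic[OF q, of A] unfolding G_def w_def by blast
  qed
  have "w \<noteq> 0"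
  proof
    assume "w = 0"
    then have "A i * v i ^ 3 = 0" if "i \<le> 2" for i using wi[OF that] by (simp add: zero_fun_def)
    then have "v i = 0" if "i \<le> 2" for i using that A le_2_cases[OF that] by fastforce
    then show False using v by (auto simp: on_cone_def)
  qed
  have "coord_vs.dim G = card {w}"
    by (rule coord_vs.dim_unique[OF _ sub _ refl]) (use wG \<open>w \<noteq> 0\<close> in \<open>auto simp: coord_vs.dependent_single\<close>)
  then show ?thesis by (simp add: jacobian_rank_def G_def)
qed

theorem smooth_projective_curve_quartic:
  fixes A :: "nat \<Rightarrow> 'a::{alg_closed_field, field_char_0}"
  assumes A: "A 0 \<noteq> 0" "A 1 \<noteq> 0" "A 2 \<noteq> 0" and k: "is_subfield k" "\<And>i. i \<le> 2 \<Longrightarrow> A i \<in> k"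
  shows "smooth_projective_curve k 2 (quartic A)"
  unfolding smooth_projective_curve_def
  using proj_closed_quartic[of k A, OF k] proj_irreducible_quartic[of A, OF A] has_dimension_quartic[of A, OF A]
    jacobian_rank_quartic[of A, OF A] by simp


section \<open>Everywhere regular sections are forms\<close>

lemma fps_nth_germ_0: "fps_nth (germ \<xi> p) 0 = mpol_eval p (vec3 (fps_nth \<xi> 0) 1 (0::'a::field))"
proof -
  have "is_ring_hom (\<lambda>f :: 'a fps. fps_nth f 0)" by (simp add: is_ring_hom_def)
  from hom_eval_hom[OF this, of fps_const p "vec3 \<xi> 1 fps_X"]
  have "fps_nth (germ \<xi> p) 0 = mpol_eval p ((\<lambda>f. fps_nth f 0) \<circ> vec3 \<xi> 1 fps_X)"
    by (simp add: germ_def mpol_eval_hom_eval comp_def)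
  also have "(\<lambda>f. fps_nth f 0) \<circ> vec3 \<xi> 1 fps_X = vec3 (fps_nth \<xi> 0) 1 0"
    by (auto simp: vec3_def fun_eq_iff)
  finally show ?thesis .
qed

lemma fps_nth_mult_low:
  fixes f h :: "'a::field fps"
  assumes "\<And>i. i < m \<Longrightarrow> fps_nth f i = 0" "i < m"
  shows "fps_nth (f * h) i = 0"
  unfolding fps_mult_nth using assms by (intro sum.neutral) auto

text \<open>Let \<open>U/n\<close> be regular everywhere. If the line \<open>x\<^sub>0 y = y\<^sub>0 x\<close> is a zero of the binary form \<open>n\<close>, then
  \<open>U\<close> vanishes at the points of the curve on this line. If there are four of them, all coefficients
  \<open>B\<^sub>i\<close> of \<open>U\<close> vanish on the line. Otherwise the line is tangent to the curve of order \<open>4\<close> at a single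
  point, \<open>U\<close> vanishes to order \<open>4\<close> there, and the conclusion is the same.\<close>

lemma regular_coefficients_vanish:
  fixes A :: "nat \<Rightarrow> 'a::{alg_closed_field, field_char_0}"
  assumes A: "A 0 \<noteq> 0" "A 1 \<noteq> 0" "A 2 \<noteq> 0"
    and n: "n \<in> forms UNIV 1 e" and xy: "x0 \<noteq> 0 \<or> y0 \<noteq> 0"
    and n_eq: "n = (Const y0 * Var 0 - Const x0 * Var 1) * n'"
    and B: "\<And>i. i < 4 \<Longrightarrow> B i \<in> forms UNIV 1 (d i)"
    and U: "U \<in> forms UNIV 2 (e + r)" "U = (\<Sum>i<4. B i * Var 2 ^ i) + q * quartic_form A"
    and regular: "\<And>v. on_cone A v \<Longrightarrow> \<exists>e' N D. N \<in> forms UNIV 2 (e' + r) \<and> D \<in> forms UNIV 2 e' \<and>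
        mpol_eval D v \<noteq> 0 \<and> vanishes A (U * D - n * N)"
    and i: "i < 4"
  shows "mpol_eval (B i) (vec3 x0 y0 0) = 0"
proof (cases "A 0 * x0 ^ 4 + A 1 * y0 ^ 4 = 0")
  case False
  then have s: "- (A 0 * x0 ^ 4 + A 1 * y0 ^ 4) / A 2 \<noteq> 0"
    using A by (simp only: divide_eq_0_iff neg_equal_0_iff_equal) simp
  show ?thesis
  proof (rule cubic_zero_on_fourth_roots[OF s _ i])
    fix w assume "w ^ 4 = - (A 0 * x0 ^ 4 + A 1 * y0 ^ 4) / A 2"
    then have on: "on_cone A (vec3 x0 y0 w)" using A xy by (intro on_cone_vec3) auto
    obtain e' N D where D: "mpol_eval D (vec3 x0 y0 w) \<noteq> 0" and van: "vanishes A (U * D - n * N)"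
      using regular[OF on] by blast
    have "mpol_eval (U * D - n * N) (vec3 x0 y0 w) = 0" using van on by (simp add: vanishes_def)
    moreover have "mpol_eval n (vec3 x0 y0 w) = 0" by (simp add: n_eq mpol_eval_mult mpol_eval_diff)
    ultimately have "mpol_eval U (vec3 x0 y0 w) = 0" using D by (simp add: mpol_eval_diff mpol_eval_mult)
    then have "(\<Sum>i<4. mpol_eval (B i) (vec3 x0 y0 w) * w ^ i) = 0"
      using on unfolding U(2)
      by (simp add: mpol_eval_add mpol_eval_sum mpol_eval_mult mpol_eval_power mpol_eval_quartic_form on_cone_iff)
    moreover have "mpol_eval (B i) (vec3 x0 y0 w) = mpol_eval (B i) (vec3 x0 y0 0)" if "i < 4" for i
      by (rule binary_eval_vec3[OF B[OF that]]) auto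
    ultimately show "(\<Sum>i<4. mpol_eval (B i) (vec3 x0 y0 0) * w ^ i) = 0" by simp
  qed
next
  case True
  then have y0: "y0 \<noteq> 0" using xy A by auto
  define \<zeta> where "\<zeta> = x0 / y0"
  have "A 0 * \<zeta> ^ 4 + A 1 = (A 0 * x0 ^ 4 + A 1 * y0 ^ 4) / y0 ^ 4"
    using y0 by (simp add: \<zeta>_def power_divide field_simps)
  then have zeta: "A 0 * \<zeta> ^ 4 + A 1 = 0" using True by simp
  obtain \<xi> where \<xi>: "is_germ A \<xi>" "fps_nth \<xi> 0 = \<zeta>" using ex_germ[of A \<zeta>, OF A(1,2) zeta] by blast
  have on: "on_cone A (vec3 \<zeta> 1 0)" using zeta by (simp add: on_cone_iff)
  obtain e' N D where N: "N \<in> forms UNIV 2 (e' + r)" and D: "D \<in> forms UNIV 2 e'"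
    and Dv: "mpol_eval D (vec3 \<zeta> 1 0) \<noteq> 0" and van: "vanishes A (U * D - n * N)"
    using regular[OF on] by blast
  have n2: "n \<in> forms UNIV 2 e" using n forms_mono[of UNIV UNIV 1 2 e] by auto
  have "n * N \<in> forms UNIV 2 (e + (e' + r))" by (rule forms_mult[OF is_subfield_UNIV n2 N])
  moreover have "e + (e' + r) = (e + r) + e'" by simp
  ultimately have "n * N \<in> forms UNIV 2 ((e + r) + e')" by (rule subst[rotated])
  then have form: "U * D - n * N \<in> forms UNIV 2 ((e + r) + e')"
    by (rule forms_diff[OF is_subfield_UNIV forms_mult[OF is_subfield_UNIV U(1) D]])
  have "germ \<xi> (U * D - n * N) = 0"
    using van vanishes_iff_germ[where A = A, OF A(1) A(3) \<xi>(1) form] by simp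
  then have eq: "germ \<xi> U * germ \<xi> D = germ \<xi> n * germ \<xi> N" by (simp add: germ_simps)
  have "germ \<xi> n = (fps_const y0 * \<xi> - fps_const x0) * germ \<xi> n'" by (simp add: n_eq germ_simps)
  moreover have "fps_nth (fps_const y0 * \<xi> - fps_const x0) j = 0" if "j < 4" for j
  proof (cases "j = 0")
    case True then show ?thesis using \<xi>(2) y0 by (simp add: \<zeta>_def)
  next
    case False
    then have "\<not> 4 dvd j" using that by (auto dest: dvd_imp_le)
    then show ?thesis using \<xi>(1) False by (simp add: is_germ_def)
  qed
  ultimately have low: "fps_nth (germ \<xi> U * germ \<xi> D) j = 0" if "j < 4" for j
    unfolding eq using that by (simp add: mult.assoc fps_nth_mult_low[of 4])
  have "fps_nth (germ \<xi> D) 0 \<noteq> 0" using Dv \<xi>(2) by (simp add: fps_nth_germ_0)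
  then have "germ \<xi> U = germ \<xi> U * germ \<xi> D * inverse (germ \<xi> D)"
    by (simp add: mult.assoc inverse_mult_eq_1')
  then have "fps_nth (germ \<xi> U) i = 0" using fps_nth_mult_low[OF low i] by metis
  moreover have "germ \<xi> U = germ \<xi> (\<Sum>i<4. B i * Var 2 ^ i)"
    unfolding U(2) by (simp add: germ_simps(1,2) germ_quartic_form[OF \<xi>(1)])
  ultimately have "fps_nth (germ \<xi> (B i)) 0 = 0"
    using germ_reduced_nth[where B = B and d = d and n = 0, OF \<xi>(1) B i] by simp
  then have "mpol_eval (B i) (vec3 \<zeta> 1 0) = 0" using \<xi>(2) by (simp add: fps_nth_germ_0)
  moreover have "vec3 x0 y0 0 = (\<lambda>i. y0 * vec3 \<zeta> 1 0 i)"
    using y0 by (auto simp: vec3_def \<zeta>_def)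
  ultimately show ?thesis using mpol_eval_homogeneous[OF B[OF i], of y0 "vec3 \<zeta> 1 0"] by simp
qed

text \<open>A section of degree \<open>r\<close> that is locally a quotient \<open>N/D\<close> of forms. By the norm it has the form
  \<open>U/n\<close> with a binary form \<open>n\<close>, whose linear factors can be cancelled one by one.\<close>

theorem regular_section_is_form:
  fixes A :: "nat \<Rightarrow> 'a::{alg_closed_field, field_char_0}" and s :: "'a fls"
  assumes A: "A 0 \<noteq> 0" "A 1 \<noteq> 0" "A 2 \<noteq> 0" and \<xi>: "is_germ A \<xi>"
    and regular: "\<And>v. on_cone A v \<Longrightarrow> \<exists>e N D. N \<in> forms UNIV 2 (e + r) \<and> D \<in> forms UNIV 2 e \<and>
        mpol_eval D v \<noteq> 0 \<and> fps_to_fls (germ \<xi> N) = fps_to_fls (germ \<xi> D) * s"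
  shows "\<exists>L\<in>forms UNIV 2 r. fps_to_fls (germ \<xi> L) = s"
proof -
  let ?g = "\<lambda>p. fps_to_fls (germ \<xi> p)"
  note iff = vanishes_iff_germ[where A = A, OF A(1) A(3) \<xi>]
  have mult: "?g (p * q) = ?g p * ?g q" for p q
    by (simp add: germ_simps fls_times_fps_to_fls)
  have main: "\<exists>L\<in>forms UNIV 2 r. ?g L = s"
    if "n \<in> forms UNIV 1 e" "n \<noteq> 0" "U \<in> forms UNIV 2 (e + r)" "?g U = ?g n * s" for n e U
    using that
  proof (induction e arbitrary: n U)
    case 0
    define c where "c = Poly_Mapping.lookup n 0"
    have c: "n = Const c" using constant_form[OF 0(1)] by (simp add: c_def)
    then have "c \<noteq> 0" using 0 by auto
    have "Const (inverse c) * U \<in> forms UNIV 2 (0 + (0 + r))"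
      by (rule forms_mult[OF is_subfield_UNIV forms_Const[OF is_subfield_UNIV UNIV_I] 0(3)])
    moreover have "?g (Const (inverse c) * U) = s"
    proof -
      have "?g (Const (inverse c) * U) = ?g (Const (inverse c) * Const c) * s"
        unfolding mult 0(4) c by (simp only: mult.assoc)
      then show ?thesis using \<open>c \<noteq> 0\<close> by (simp add: Const_mult[symmetric] germ_def is_ring_hom_fps_const)
    qed
    ultimately show ?case by (intro bexI[of _ "Const (inverse c) * U"]) simp_all
  next
    case (Suc e)
    obtain x0 y0 where xy: "x0 \<noteq> 0 \<or> y0 \<noteq> 0" "mpol_eval n (vec3 x0 y0 0) = 0"
      using binary_form_root[OF Suc.prems(1)] by blast
    obtain n' where n': "n' \<in> forms UNIV 1 e" "n = (Const y0 * Var 0 - Const x0 * Var 1) * n'"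
      using binary_form_factor[OF Suc.prems(1) xy] by blast
    define l where "l = Const y0 * Var 0 - Const x0 * (Var 1 :: 'a mpol)"
    have n_l: "n = l * n'" by (simp add: n'(2) l_def)
    have n2: "n \<in> forms UNIV 2 (Suc e)" using Suc.prems(1) forms_mono[of UNIV UNIV 1 2 "Suc e"] by auto
    obtain B q where B: "\<And>i. i < 4 \<Longrightarrow> B i \<in> forms UNIV 1 (Suc e + r - i)"
      and UB: "U = (\<Sum>i<4. B i * Var 2 ^ i) + q * quartic_form A"
      by (rule quartic_division[of A U "Suc e + r", OF A(3) Suc.prems(3)]) blast
    have reg: "\<exists>e' N D. N \<in> forms UNIV 2 (e' + r) \<and> D \<in> forms UNIV 2 e' \<and>
        mpol_eval D v \<noteq> 0 \<and> vanishes A (U * D - n * N)" if v: "on_cone A v" for v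
    proof -
      obtain e' N D where *: "N \<in> forms UNIV 2 (e' + r)" "D \<in> forms UNIV 2 e'" "mpol_eval D v \<noteq> 0"
        "?g N = ?g D * s" using regular[OF v] by blast
      have "?g (U * D) = ?g (n * N)" unfolding mult *(4) Suc.prems(4) by (simp add: mult_ac)
      then have "germ \<xi> (U * D - n * N) = 0" by (simp add: germ_simps)
      moreover have "n * N \<in> forms UNIV 2 (Suc e + (e' + r))" by (rule forms_mult[OF is_subfield_UNIV n2 *(1)])
      then have "n * N \<in> forms UNIV 2 ((Suc e + r) + e')" by (simp add: add_ac)
      then have "U * D - n * N \<in> forms UNIV 2 ((Suc e + r) + e')"
        by (rule forms_diff[OF is_subfield_UNIV forms_mult[OF is_subfield_UNIV Suc.prems(3) *(2)]])
      ultimately have "vanishes A (U * D - n * N)" using iff by simp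
      then show ?thesis using * by blast
    qed
    have zero: "mpol_eval (B i) (vec3 x0 y0 0) = 0" if "i < 4" for i
      by (rule regular_coefficients_vanish[of A n "Suc e" x0 y0 n' B "\<lambda>i. Suc e + r - i" U r q,
            OF A Suc.prems(1) xy(1) n'(2) B Suc.prems(3) UB reg that])
    have "\<exists>C. C * Var 2 ^ i \<in> forms UNIV 2 (e + r) \<and> B i = l * C" if i: "i < 4" for i
    proof (cases "Suc e + r - i")
      case 0
      then have b: "B i = Const (Poly_Mapping.lookup (B i) 0)" using B[OF i] constant_form by metis
      have "Poly_Mapping.lookup (B i) 0 = 0" using zero[OF i] by (subst (asm) b) simp
      then show ?thesis using b by (intro exI[of _ 0]) (simp add: forms_zero is_subfield_UNIV)
    next
      case (Suc j)
      then obtain C where C: "C \<in> forms UNIV 1 j" "B i = l * C"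
        using binary_form_factor[of "B i" j x0 y0] B[OF i] xy(1) zero[OF i] by (auto simp: l_def)
      have "C \<in> forms UNIV 2 j" using C(1) forms_mono[of UNIV UNIV 1 2 j] by auto
      then have "C * Var 2 ^ i \<in> forms UNIV 2 (j + i * 1)"
        by (rule forms_mult[OF is_subfield_UNIV _
              forms_power[OF is_subfield_UNIV forms_Var[OF is_subfield_UNIV order.refl]]])
      moreover have "j + i * 1 = e + r" using Suc by simp
      ultimately show ?thesis using C(2) by auto
    qed
    then obtain C where C: "\<And>i. i < 4 \<Longrightarrow> C i * Var 2 ^ i \<in> forms UNIV 2 (e + r) \<and> B i = l * C i" by metis
    define U' where "U' = (\<Sum>i<4. C i * Var 2 ^ i)"
    have U': "U' \<in> forms UNIV 2 (e + r)" unfolding U'_def by (rule forms_sum[OF is_subfield_UNIV]) (use C in simp)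
    have "U = l * U' + q * quartic_form A"
      unfolding UB U'_def sum_distrib_left using C by (simp add: mult.assoc)
    then have "germ \<xi> U = germ \<xi> (l * U')" by (simp add: germ_simps(1,2) germ_quartic_form[OF \<xi>])
    then have "?g l * ?g U' = ?g l * (?g n' * s)"
      using Suc.prems(4) by (simp add: mult n_l mult.assoc flip: mult)
    moreover have "?g l \<noteq> 0"
    proof
      assume "?g l = 0"
      then have "germ \<xi> n = 0" by (simp add: n_l germ_simps)
      then show False
        using germ_binary_injective[where A = A, OF A(3) \<xi> Suc.prems(1)] Suc.prems(2) by simp
    qed
    ultimately have "?g U' = ?g n' * s" by simp
    moreover have "n' \<noteq> 0" using Suc.prems(2) n_l by auto
    ultimately show ?case using Suc.IH n'(1) U' by blast
  qed
  have "on_cone A (vec3 (fps_nth \<xi> 0) 1 0)"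
  proof -
    have "fps_nth (fps_const (A 0) * \<xi> ^ 4 + fps_const (A 1) + fps_const (A 2) * fps_X ^ 4) 0 = 0"
      using \<xi> by (simp add: is_germ_def)
    then show ?thesis by (simp add: on_cone_iff fps_nth_power_0)
  qed
  then obtain e N D where N: "N \<in> forms UNIV 2 (e + r)" and D: "D \<in> forms UNIV 2 e" and nv: "\<not> vanishes A D"
    and s: "?g N = ?g D * s"
    using regular unfolding vanishes_def by blast
  obtain n D' where n: "n \<in> forms UNIV 1 (4 * e)" "D' \<in> forms UNIV 2 (3 * e)"
    "\<not> vanishes A n" "vanishes A (D * D' - n)"
    by (rule norm_form[of A, OF A D nv]) blast
  have n2: "n \<in> forms UNIV 2 (4 * e)" using n(1) forms_mono[of UNIV UNIV 1 2 "4 * e"] by auto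
  have "D * D' \<in> forms UNIV 2 (e + 3 * e)" by (rule forms_mult[OF is_subfield_UNIV D n(2)])
  then have "D * D' \<in> forms UNIV 2 (4 * e)" by simp
  then have "D * D' - n \<in> forms UNIV 2 (4 * e)" using n2 by (rule forms_diff[OF is_subfield_UNIV])
  then have "germ \<xi> (D * D' - n) = 0" using iff n(4) by blast
  then have "?g n = ?g D * ?g D'" by (simp add: mult germ_simps(4) flip: mult)
  then have "?g (N * D') = ?g n * s" by (simp add: mult s mult_ac)
  moreover have "N * D' \<in> forms UNIV 2 (e + r + 3 * e)" by (rule forms_mult[OF is_subfield_UNIV N n(2)])
  then have "N * D' \<in> forms UNIV 2 (4 * e + r)" by (simp add: algebra_simps)
  moreover have "n \<noteq> 0" using n(3) by (auto simp: vanishes_def mpol_eval_def)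
  ultimately show ?thesis using main n(1) by blast
qed


section \<open>Isomorphisms of diagonal quartics are monomial\<close>

lemma sum_atMost_2: "(\<Sum>j\<le>2. f j) = f 0 + f 1 + f (2::nat)"
  by (simp add: atMost_2 add.assoc)

lemma all_le_2: "(\<forall>i\<le>2. Q i) \<longleftrightarrow> Q 0 \<and> Q 1 \<and> Q (2::nat)"
  using le_2_cases by auto

text \<open>The components of the cross product of \<open>f\<close> and its derivative.\<close>

definition wronskian :: "(nat \<Rightarrow> 'a::field fls) \<Rightarrow> nat \<Rightarrow> 'a fls" where
  "wronskian f = vec3 (f 1 * fls_deriv (f 2) - f 2 * fls_deriv (f 1))
     (f 2 * fls_deriv (f 0) - f 0 * fls_deriv (f 2)) (f 0 * fls_deriv (f 1) - f 1 * fls_deriv (f 0))"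

text \<open>Both the wronskian of \<open>f\<close> and the gradient of the quartic at \<open>f\<close> are orthogonal to \<open>f\<close> and \<open>f'\<close>.\<close>

lemma wronskian_gradient:
  fixes f :: "nat \<Rightarrow> 'a::field_char_0 fls"
  assumes eq: "(\<Sum>j\<le>2. fls_const (a j) * f j ^ 4) = 0" and j0: "j0 \<le> 2" "f j0 \<noteq> 0" "a j0 \<noteq> 0"
  shows "\<exists>h. \<forall>j\<le>2. wronskian f j = h * (fls_const (a j) * f j ^ 3)"
proof -
  define b where "b j = fls_const (a j)" for j
  define D where "D j = fls_deriv (f j)" for j
  have eq': "b 0 * f 0 ^ 4 + b 1 * f 1 ^ 4 + b 2 * f 2 ^ 4 = 0"
    using eq by (simp add: sum_atMost_2 b_def)
  have "fls_deriv (b j * f j ^ 4) = of_nat 4 * (b j * f j ^ 3 * D j)" for j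
    by (simp add: b_def D_def fls_deriv_power algebra_simps)
  then have "of_nat 4 * (b 0 * f 0 ^ 3 * D 0 + b 1 * f 1 ^ 3 * D 1 + b 2 * f 2 ^ 3 * D 2) = fls_deriv 0"
    unfolding eq'[symmetric] fls_deriv_add distrib_left by simp
  then have d: "b 0 * f 0 ^ 3 * D 0 + b 1 * f 1 ^ 3 * D 1 + b 2 * f 2 ^ 3 * D 2 = 0"
    by (simp only: fls_deriv_zero mult_eq_0_iff of_nat_eq_0_iff) simp
  have w: "wronskian f = vec3 (f 1 * D 2 - f 2 * D 1) (f 2 * D 0 - f 0 * D 2) (f 0 * D 1 - f 1 * D 0)"
    by (simp add: wronskian_def D_def)
  have 01: "wronskian f 0 * (b 1 * f 1 ^ 3) = wronskian f 1 * (b 0 * f 0 ^ 3)"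
    unfolding w vec3_simps using eq' d by algebra
  have 02: "wronskian f 0 * (b 2 * f 2 ^ 3) = wronskian f 2 * (b 0 * f 0 ^ 3)"
    unfolding w vec3_simps using eq' d by algebra
  have 12: "wronskian f 1 * (b 2 * f 2 ^ 3) = wronskian f 2 * (b 1 * f 1 ^ 3)"
    unfolding w vec3_simps using eq' d by algebra
  have "wronskian f i * (b j * f j ^ 3) = wronskian f j * (b i * f i ^ 3)" if "i \<le> 2" "j \<le> 2" for i j
    using le_2_cases[OF that(1)] le_2_cases[OF that(2)] 01 02 12 by (elim disjE) simp_all
  moreover have "b j0 * f j0 ^ 3 \<noteq> 0" using j0 by (simp add: b_def)
  ultimately have "\<forall>j\<le>2. wronskian f j = wronskian f j0 / (b j0 * f j0 ^ 3) * (b j * f j ^ 3)"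
    using j0(1) by (simp add: eq_divide_eq)
  then show ?thesis unfolding b_def by blast
qed

lemma wronskian_scale:
  assumes "\<And>j. j \<le> 2 \<Longrightarrow> g j = u * f j" "j \<le> 2"
  shows "wronskian g j = u ^ 2 * wronskian f j"
  using le_2_cases[OF assms(2)] assms(1)
  by (elim disjE) (simp_all add: wronskian_def power2_eq_square algebra_simps)

lemma fls_constant_ratio:
  fixes f g :: "'a::field_char_0 fls"
  assumes "f * fls_deriv g = g * fls_deriv f" "g \<noteq> 0"
  shows "\<exists>c. f = fls_const c * g"
proof -
  define q where "q = f / g"
  have f: "f = q * g" using assms(2) by (simp add: q_def)
  have "(q * g) * fls_deriv g = g * (q * fls_deriv g + fls_deriv q * g)"
    using assms(1) unfolding f by simp
  then have "g * (fls_deriv q * g) = 0" by (simp add: algebra_simps)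
  then have "fls_deriv q = 0" using assms(2) by simp
  then obtain c where "q = fls_const c" unfolding fls_deriv_eq_0_iff by blast
  then show ?thesis using f by blast
qed

lemma linear_form_eval:
  assumes p: "p \<in> forms UNIV 2 1"
  shows "mpol_eval p v = (\<Sum>l\<le>2. Poly_Mapping.lookup p (Poly_Mapping.single l 1) * v l)"
proof -
  define e where "e l = Poly_Mapping.single l (1::nat)" for l :: nat
  have inj: "inj_on e {..2}" unfolding inj_on_def e_def
    by (metis lookup_single_eq lookup_single_not_eq zero_neq_one)
  have "Poly_Mapping.keys p \<subseteq> e ` {..2}"
  proof
    fix m assume "m \<in> Poly_Mapping.keys p"
    then have m: "Poly_Mapping.keys m \<subseteq> {..2}" "mdeg m = 1" using p by (auto simp: forms_iff)
    have "1 = Poly_Mapping.lookup m 0 + Poly_Mapping.lookup m 1 + Poly_Mapping.lookup m 2"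
      using mdeg_ternary[OF m(1)] m(2) by simp
    then have "\<exists>l\<le>2. Poly_Mapping.lookup m l = 1 \<and> (\<forall>i\<le>2. i \<noteq> l \<longrightarrow> Poly_Mapping.lookup m i = 0)"
      unfolding all_le_2 by (cases "Poly_Mapping.lookup m 0 = 1"; cases "Poly_Mapping.lookup m 1 = 1")
        (auto intro: exI[of _ 0] exI[of _ 1] exI[of _ 2])
    then obtain l where l: "l \<le> 2" "Poly_Mapping.lookup m l = 1"
      "\<And>i. i \<le> 2 \<Longrightarrow> i \<noteq> l \<Longrightarrow> Poly_Mapping.lookup m i = 0" by blast
    have "m = e l"
    proof (rule poly_mapping_eqI)
      fix i
      have "\<not> i \<le> 2 \<Longrightarrow> Poly_Mapping.lookup m i = 0" using m(1) by (force simp: in_keys_iff subset_iff)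
      then show "Poly_Mapping.lookup m i = Poly_Mapping.lookup (e l) i"
        using l by (cases "i = l"; cases "i \<le> 2") (auto simp: e_def lookup_single when_def)
    qed
    then show "m \<in> e ` {..2}" using l(1) by blast
  qed
  then have "mpol_eval p v = (\<Sum>m\<in>e ` {..2}. Poly_Mapping.lookup p m * monom_eval m v)"
    unfolding mpol_eval_hom_eval by (intro hom_eval_superset) auto
  then show ?thesis unfolding sum.reindex[OF inj] by (simp add: e_def)
qed

text \<open>Among the monomials of degree \<open>4\<close>, only the fourth powers have the same exponents modulo \<open>4\<close>.
  Hence the symmetries \<open>x \<mapsto> \<iota> x\<close> and \<open>z \<mapsto> \<iota> z\<close> of the curve isolate all mixed coefficients of a
  quartic form that vanishes on it.\<close>

lemma mixed_coefficients_zero: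
  fixes A a :: "nat \<Rightarrow> 'a::{alg_closed_field, field_char_0}" and M :: "nat \<Rightarrow> nat \<Rightarrow> 'a"
  assumes A: "A 0 \<noteq> 0" "A 1 \<noteq> 0" "A 2 \<noteq> 0"
    and zero: "\<And>v. on_cone A v \<Longrightarrow> (\<Sum>j\<le>2. a j * (\<Sum>l\<le>2. M j l * v l) ^ 4) = 0"
    and lm: "l \<le> 2" "m \<le> 2" "l \<noteq> m" "p \<le> 2" "q \<le> 2"
  shows "(\<Sum>j\<le>2. a j * M j l * M j m * M j p * M j q) = 0"
proof -
  define S where "S \<alpha> \<beta> \<gamma> = (\<Sum>j\<le>2. a j * M j 0 ^ \<alpha> * M j 1 ^ \<beta> * M j 2 ^ \<gamma>)" for \<alpha> \<beta> \<gamma> :: nat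
  \<comment> \<open>With \<open>y = 1\<close>, \<open>x\<^sup>4 = s'\<close> and \<open>z\<^sup>4 = s\<close>, the point is on the curve and has no zero coordinate.\<close>
  define s' where "s' = A 1 / A 0"
  define s where "s = - (A 0 * s' + A 1) / A 2"
  have s': "s' \<noteq> 0" using A by (simp add: s'_def)
  have "A 0 * s' + A 1 = 2 * A 1" using A by (simp add: s'_def)
  then have s: "s \<noteq> 0" using A by (simp add: s_def)
  define c where "c x = (\<lambda>i::nat. if i = 0 then S 0 4 0 + S 4 0 0 * s' + S 0 0 4 * s + 4 * S 1 3 0 * x + 6 * S 2 2 0 * x ^ 2 + 4 * S 3 1 0 * x ^ 3
    else if i = 1 then 4 * (S 0 3 1 + 3 * S 1 2 1 * x + 3 * S 2 1 1 * x ^ 2 + S 3 0 1 * x ^ 3)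
    else if i = 2 then 6 * (S 0 2 2 + 2 * S 1 1 2 * x + S 2 0 2 * x ^ 2)
    else 4 * (S 0 1 3 + S 1 0 3 * x))" for x
  have "(\<Sum>i<4. c x i * w ^ i) = 0" if x: "x ^ 4 = s'" and w: "w ^ 4 = s" for x w
  proof -
    have "on_cone A (vec3 x 1 w)"
      using A x w by (intro on_cone_vec3) (auto simp: s_def)
    then have "(\<Sum>j\<le>2. a j * (M j 0 * x + M j 1 + M j 2 * w) ^ 4) = 0"
      using zero by (fastforce simp: sum_atMost_2)
    moreover have "(\<Sum>j\<le>2. a j * (M j 0 * x + M j 1 + M j 2 * w) ^ 4) = (\<Sum>i<4. c x i * w ^ i)"
    proof -
      have e: "a j * (M j 0 * x + M j 1 + M j 2 * w) ^ 4 =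
        a j * M j 1 ^ 4 + a j * M j 0 ^ 4 * s' + a j * M j 2 ^ 4 * s
        + 4 * (a j * M j 0 * M j 1 ^ 3) * x + 6 * (a j * M j 0 ^ 2 * M j 1 ^ 2) * x ^ 2 + 4 * (a j * M j 0 ^ 3 * M j 1) * x ^ 3
        + 4 * (a j * M j 1 ^ 3 * M j 2 + 3 * (a j * M j 0 * M j 1 ^ 2 * M j 2) * x + 3 * (a j * M j 0 ^ 2 * M j 1 * M j 2) * x ^ 2 + a j * M j 0 ^ 3 * M j 2 * x ^ 3) * w
        + 6 * (a j * M j 1 ^ 2 * M j 2 ^ 2 + 2 * (a j * M j 0 * M j 1 * M j 2 ^ 2) * x + a j * M j 0 ^ 2 * M j 2 ^ 2 * x ^ 2) * w ^ 2
        + 4 * (a j * M j 1 * M j 2 ^ 3 + a j * M j 0 * M j 2 ^ 3 * x) * w ^ 3" for j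
        unfolding x[symmetric] w[symmetric] by algebra
      show ?thesis
        unfolding e sum_lessThan_4 sum_atMost_2 S_def c_def by (simp add: algebra_simps)
    qed
    ultimately show ?thesis by simp
  qed
  then have c0: "c x i = 0" if "x ^ 4 = s'" "i < 4" for x i
    using cubic_zero_on_fourth_roots[OF s, of "c x" i] that by blast
  have co: "e 0 = 0 \<and> e 1 = 0 \<and> e 2 = 0 \<and> e 3 = 0"
    if "\<And>x. x ^ 4 = s' \<Longrightarrow> e 0 + e 1 * x + e 2 * x ^ 2 + e 3 * x ^ 3 = 0" for e :: "nat \<Rightarrow> 'a"
  proof -
    have "(\<Sum>i<4. e i * w ^ i) = 0" if "w ^ 4 = s'" for w
      using \<open>\<And>x. x ^ 4 = s' \<Longrightarrow> _\<close>[OF that] by (simp add: sum_lessThan_4)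
    from cubic_zero_on_fourth_roots[OF s' this] show ?thesis by simp
  qed
  have "S 0 4 0 + S 4 0 0 * s' + S 0 0 4 * s + 4 * S 1 3 0 * x + 6 * S 2 2 0 * x ^ 2 + 4 * S 3 1 0 * x ^ 3 = 0"
    if "x ^ 4 = s'" for x
    using c0[OF that, of 0] by (simp add: c_def)
  then have z: "S 1 3 0 = 0" "S 2 2 0 = 0" "S 3 1 0 = 0"
    using co[of "\<lambda>i. if i = 0 then S 0 4 0 + S 4 0 0 * s' + S 0 0 4 * s else if i = 1 then 4 * S 1 3 0
      else if i = 2 then 6 * S 2 2 0 else 4 * S 3 1 0"] by simp_all
  have "S 0 3 1 + 3 * S 1 2 1 * x + 3 * S 2 1 1 * x ^ 2 + S 3 0 1 * x ^ 3 = 0" if "x ^ 4 = s'" for x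
    using c0[OF that, of 1] by (simp add: c_def del: distrib_left_numeral)
  then have z1: "S 0 3 1 = 0" "S 1 2 1 = 0" "S 2 1 1 = 0" "S 3 0 1 = 0"
    using co[of "\<lambda>i. if i = 0 then S 0 3 1 else if i = 1 then 3 * S 1 2 1
      else if i = 2 then 3 * S 2 1 1 else S 3 0 1"] by simp_all
  have "S 0 2 2 + 2 * S 1 1 2 * x + S 2 0 2 * x ^ 2 = 0" if "x ^ 4 = s'" for x
    using c0[OF that, of 2] by (simp add: c_def del: distrib_left_numeral)
  then have z2: "S 0 2 2 = 0" "S 1 1 2 = 0" "S 2 0 2 = 0"
    using co[of "\<lambda>i. if i = 0 then S 0 2 2 else if i = 1 then 2 * S 1 1 2
      else if i = 2 then S 2 0 2 else 0"] by simp_all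
  have "S 0 1 3 + S 1 0 3 * x = 0" if "x ^ 4 = s'" for x
    using c0[OF that, of 3] by (simp add: c_def del: distrib_left_numeral)
  then have z3: "S 0 1 3 = 0" "S 1 0 3 = 0"
    using co[of "\<lambda>i. if i = 0 then S 0 1 3 else if i = 1 then S 1 0 3 else 0"] by simp_all
  define cnt where "cnt t = (if l = t then 1 else 0) + (if m = t then 1 else 0) + (if p = t then 1 else 0)
      + (if q = t then 1 else (0::nat))" for t
  have "a j * M j l * M j m * M j p * M j q = a j * M j 0 ^ cnt 0 * M j 1 ^ cnt 1 * M j 2 ^ cnt 2" for j
    using le_2_cases[OF lm(1)] le_2_cases[OF lm(2)] le_2_cases[OF lm(4)] le_2_cases[OF lm(5)]
    by (elim disjE) (simp_all add: cnt_def eval_nat_numeral mult_ac)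
  then have "(\<Sum>j\<le>2. a j * M j l * M j m * M j p * M j q) = S (cnt 0) (cnt 1) (cnt 2)"
    by (simp only: S_def)
  also have "\<dots> = 0"
  proof -
    have mixed: "S \<alpha> \<beta> \<gamma> = 0" if "\<alpha> + \<beta> + \<gamma> = 4" "\<alpha> < 4" "\<beta> < 4" "\<gamma> < 4" for \<alpha> \<beta> \<gamma>
    proof -
      have "\<alpha> = 0 \<or> \<alpha> = 1 \<or> \<alpha> = 2 \<or> \<alpha> = 3" "\<beta> = 0 \<or> \<beta> = 1 \<or> \<beta> = 2 \<or> \<beta> = 3"
        "\<gamma> = 0 \<or> \<gamma> = 1 \<or> \<gamma> = 2 \<or> \<gamma> = 3"
        using that by auto
      then show ?thesis using that(1) z z1 z2 z3 by (elim disjE) simp_all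
    qed
    have "cnt 0 + cnt 1 + cnt 2 = 4" "cnt 0 < 4" "cnt 1 < 4" "cnt 2 < 4"
      using le_2_cases[OF lm(1)] le_2_cases[OF lm(2)] le_2_cases[OF lm(4)] le_2_cases[OF lm(5)] lm(3)
      by (auto simp: cnt_def)
    then show ?thesis by (rule mixed)
  qed
  finally show ?thesis .
qed

text \<open>A local representation of a map, which a morphism has near every point. As points are sets of
  vectors, the value of the forms is an element of the image point.\<close>

definition represents ::
  "(nat \<Rightarrow> 'a::field) \<Rightarrow> nat \<Rightarrow> (nat \<Rightarrow> 'a mpol) \<Rightarrow> ('a ppoint \<Rightarrow> 'a ppoint) \<Rightarrow> bool" where
  "represents A d F \<phi> \<longleftrightarrow> (\<forall>j\<le>2. F j \<in> forms UNIV 2 d) \<and>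
     (\<forall>P\<in>quartic A. \<forall>v\<in>P. (\<exists>j\<le>2. mpol_eval (F j) v \<noteq> 0) \<longrightarrow>
        (\<lambda>j. if j \<le> 2 then mpol_eval (F j) v else 0) \<in> \<phi> P)"

lemma representsD:
  assumes "represents A d F \<phi>"
  shows "j \<le> 2 \<Longrightarrow> F j \<in> forms UNIV 2 d"
    "P \<in> quartic A \<Longrightarrow> v \<in> P \<Longrightarrow> j \<le> 2 \<Longrightarrow> mpol_eval (F j) v \<noteq> 0 \<Longrightarrow>
       (\<lambda>j. if j \<le> 2 then mpol_eval (F j) v else 0) \<in> \<phi> P"
  using assms unfolding represents_def by blast+

lemma ex_represents:
  assumes "morphism_over E 2 (quartic A) 2 W \<phi>" "P \<in> quartic A"
  obtains d F where "represents A d F \<phi>" "\<And>v. v \<in> P \<Longrightarrow> \<exists>j\<le>2. mpol_eval (F j) v \<noteq> 0"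
    "\<And>j. j \<le> 2 \<Longrightarrow> F j \<in> forms E 2 d"
proof -
  obtain d F where F: "\<And>j. j \<le> 2 \<Longrightarrow> F j \<in> forms E 2 d"
    and nz: "\<And>v. v \<in> P \<Longrightarrow> \<exists>j\<le>2. mpol_eval (F j) v \<noteq> 0"
    and rep: "\<And>Q v j. Q \<in> quartic A \<Longrightarrow> v \<in> Q \<Longrightarrow> j \<le> 2 \<Longrightarrow> mpol_eval (F j) v \<noteq> 0 \<Longrightarrow>
       \<phi> Q = proj_point (\<lambda>j. if j \<le> 2 then mpol_eval (F j) v else 0)"
    by (rule morphism_over_rep[OF assms]) (assumption | blast)+
  have "forms E 2 d \<subseteq> forms UNIV 2 d" by (rule forms_mono) auto
  then have "represents A d F \<phi>"
    unfolding represents_def using F rep proj_point_self by auto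
  then show thesis using that nz F by blast
qed

text \<open>Both sides give homogeneous coordinates of the same image point, unless one of them is zero.\<close>

lemma represents_proportional:
  fixes A A' :: "nat \<Rightarrow> 'a::{alg_closed_field, field_char_0}"
  assumes F: "represents A d F \<phi>" and G: "represents A e G \<phi>" and im: "\<phi> ` quartic A \<subseteq> proj_space 2"
    and ij: "i \<le> 2" "j \<le> 2"
  shows "vanishes A (F i * G j - F j * G i)"
proof -
  have form: "F i * G j \<in> forms UNIV 2 (d + e)" if "i \<le> 2" "j \<le> 2" for i j
    by (rule forms_mult[OF is_subfield_UNIV representsD(1)[OF F that(1)] representsD(1)[OF G that(2)]])
  have "mpol_eval (F i) v * mpol_eval (G j) v = mpol_eval (F j) v * mpol_eval (G i) v"
    if P: "P \<in> quartic A" "v \<in> P" for P v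
  proof (cases "(\<exists>j\<le>2. mpol_eval (F j) v \<noteq> 0) \<and> (\<exists>j\<le>2. mpol_eval (G j) v \<noteq> 0)")
    case True
    let ?f = "\<lambda>j. if j \<le> 2 then mpol_eval (F j) v else 0" and ?g = "\<lambda>j. if j \<le> 2 then mpol_eval (G j) v else 0"
    have "?f \<in> \<phi> P" "?g \<in> \<phi> P" using representsD(2)[OF F P] representsD(2)[OF G P] True by blast+
    moreover have "\<phi> P \<in> proj_space 2" using im P(1) by blast
    ultimately have "?f \<in> proj_point ?g" using proj_spaceD(1) by blast
    then obtain c where "?f = (\<lambda>j. c * ?g j)" by (auto simp: proj_point_mem_iff)
    from fun_cong[OF this, of i] fun_cong[OF this, of j] ij show ?thesis by simp
  qed (use ij in auto)
  then show ?thesis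
    using vanishes_iff_quartic[OF forms_diff[OF is_subfield_UNIV form[OF ij] form[OF ij(2,1)]], of A]
    by (simp add: mpol_eval_diff mpol_eval_mult)
qed

lemma vanishes_at:
  "vanishes A p \<Longrightarrow> P \<in> quartic A \<Longrightarrow> v \<in> P \<Longrightarrow> mpol_eval p v = 0"
  using quartic_memD unfolding vanishes_def by blast

text \<open>For an isomorphism given locally by forms \<open>F\<^sub>0, F\<^sub>1, F\<^sub>2\<close>, the pullbacks of the three regular
  differentials are multiples of \<open>F\<^sub>i h\<close>, where \<open>h\<close> is the ratio of the wronskian to the gradient of
  the quartic at \<open>F\<close>. These are everywhere regular of degree \<open>1\<close>, hence linear forms, and they
  represent the same map as \<open>F\<^sub>0, F\<^sub>1, F\<^sub>2\<close>. They are independent because the target is not contained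
  in a line.\<close>

theorem isomorphism_is_linear:
  fixes A A' :: "nat \<Rightarrow> 'a::{alg_closed_field, field_char_0}"
  assumes A: "A 0 \<noteq> 0" "A 1 \<noteq> 0" "A 2 \<noteq> 0" and A': "A' 0 \<noteq> 0" "A' 1 \<noteq> 0" "A' 2 \<noteq> 0"
    and iso: "bij_betw \<phi> (quartic A) (quartic A')" "morphism_over UNIV 2 (quartic A) 2 (quartic A') \<phi>"
  shows "\<exists>L. represents A 1 L \<phi> \<and> (\<forall>u. vanishes A (\<Sum>j\<le>2. Const (u j) * L j) \<longrightarrow> (\<forall>j\<le>2. u j = 0))"
proof -
  obtain \<xi> where \<xi>: "is_germ A \<xi>" using ex_germ_quartic[of A, OF A(1,2)] by blast
  note iff = vanishes_iff_germ[where A = A, OF A(1) A(3) \<xi>]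
  define g where "g p = fps_to_fls (germ \<xi> p)" for p
  have g: "g (p * q) = g p * g q" "g (p - q) = g p - g q" "g (p ^ n) = g p ^ n"
    "g (sum p' I) = (\<Sum>i\<in>I. g (p' i))" "g (Const c) = fls_const c" "g (p + q) = g p + g q" for p q n p' c and I :: "nat set"
  proof -
    show "g (sum p' I) = (\<Sum>i\<in>I. g (p' i))"
      by (induction I rule: infinite_finite_induct) (auto simp: g_def germ_simps(1,8))
  qed (simp_all add: g_def germ_simps fls_times_fps_to_fls fps_to_fls_power)
  have g_iff: "vanishes A p \<longleftrightarrow> g p = 0" if "p \<in> forms UNIV 2 d" for p d
    using iff[OF that] by (simp add: g_def)
  have im: "\<phi> ` quartic A \<subseteq> proj_space 2" using iso(1) quartic_subset by (auto simp: bij_betw_def)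
  obtain P0 where P0: "P0 \<in> quartic A" using two_points_quartic[of A, OF A] by blast
  then obtain v0 where v0: "v0 \<in> P0" using proj_space_nonempty quartic_subset by blast
  obtain d F where F: "represents A d F \<phi>" "\<And>v. v \<in> P0 \<Longrightarrow> \<exists>j\<le>2. mpol_eval (F j) v \<noteq> 0"
    by (rule ex_represents[OF iso(2) P0]) blast
  obtain j0 where j0: "j0 \<le> 2" "mpol_eval (F j0) v0 \<noteq> 0" using F(2)[OF v0] by blast
  define f where "f j = g (F j)" for j
  have fj0: "f j0 \<noteq> 0"
    using g_iff[OF representsD(1)[OF F(1) j0(1)]] vanishes_at[OF _ P0 v0] j0(2) unfolding f_def by blast
  have ratio: "\<exists>u. \<forall>j\<le>2. g (G j) = u * f j" if G: "represents A e G \<phi>" for e G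
  proof -
    have "g (F j0 * G j - F j * G j0) = 0" if "j \<le> 2" for j
      using represents_proportional[OF F(1) G im j0(1) that]
        g_iff[OF forms_diff[OF is_subfield_UNIV
            forms_mult[OF is_subfield_UNIV representsD(1)[OF F(1) j0(1)] representsD(1)[OF G that]]
            forms_mult[OF is_subfield_UNIV representsD(1)[OF F(1) that] representsD(1)[OF G j0(1)]]]]
      by blast
    then have "\<forall>j\<le>2. g (G j) = g (G j0) / f j0 * f j"
      using fj0 by (simp add: g f_def field_simps)
    then show ?thesis by blast
  qed
  have on_curve: "(\<Sum>j\<le>2. fls_const (A' j) * f j ^ 4) = 0"
  proof -
    define E where "E = (\<Sum>j\<le>2. Const (A' j) * F j ^ 4)"
    have Ef: "E \<in> forms UNIV 2 (0 + 4 * d)" unfolding E_def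
      by (intro forms_sum[OF is_subfield_UNIV] forms_mult[OF is_subfield_UNIV]
          forms_Const[OF is_subfield_UNIV UNIV_I] forms_power[OF is_subfield_UNIV] representsD(1)[OF F(1)]) simp
    have "mpol_eval E v = 0" if P: "P \<in> quartic A" "v \<in> P" for P v
    proof (cases "\<exists>j\<le>2. mpol_eval (F j) v \<noteq> 0")
      case True
      then have "(\<lambda>j. if j \<le> 2 then mpol_eval (F j) v else 0) \<in> \<phi> P"
        using representsD(2)[OF F(1) P] by blast
      moreover have "\<phi> P \<in> quartic A'" using iso(1) P(1) by (auto simp: bij_betw_def)
      ultimately have "on_cone A' (\<lambda>j. if j \<le> 2 then mpol_eval (F j) v else 0)" by (rule quartic_memD[rotated])
      then show ?thesis
        by (simp add: on_cone_iff E_def mpol_eval_add mpol_eval_mult mpol_eval_power sum_atMost_2)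
    qed (simp add: E_def mpol_eval_sum mpol_eval_mult mpol_eval_power)
    then have "vanishes A E" using vanishes_iff_quartic[OF Ef, of A] by blast
    then show ?thesis using g_iff[OF Ef] by (simp add: E_def g f_def)
  qed
  have A'j: "A' j \<noteq> 0" if "j \<le> 2" for j using le_2_cases[OF that] A' by auto
  obtain h where h: "\<And>j. j \<le> 2 \<Longrightarrow> wronskian f j = h * (fls_const (A' j) * f j ^ 3)"
    using wronskian_gradient[of A' f j0, OF on_curve j0(1) fj0 A'j[OF j0(1)]] by blast
  \<comment> \<open>A constant map is not injective.\<close>
  have h0: "h \<noteq> 0"
  proof
    assume "h = 0"
    then have w: "wronskian f 0 = 0" "wronskian f 1 = 0" "wronskian f 2 = 0" using h by simp_all
    have "f j * fls_deriv (f j0) = f j0 * fls_deriv (f j)" if "j \<le> 2" for j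
      using le_2_cases[OF that] le_2_cases[OF j0(1)] w by (elim disjE) (simp_all add: wronskian_def)
    then have "\<exists>c. f j = fls_const c * f j0" if "j \<le> 2" for j
      using fls_constant_ratio[OF _ fj0] that by blast
    then obtain c where c: "\<And>j. j \<le> 2 \<Longrightarrow> f j = fls_const (c j) * f j0" by metis
    have "\<phi> P = proj_point (\<lambda>j. if j \<le> 2 then c j else 0)" if P: "P \<in> quartic A" for P
    proof -
      obtain e G where G: "represents A e G \<phi>" "\<And>v. v \<in> P \<Longrightarrow> \<exists>j\<le>2. mpol_eval (G j) v \<noteq> 0"
        by (rule ex_represents[OF iso(2) P]) blast
      obtain v where v: "v \<in> P" using P proj_space_nonempty quartic_subset by blast
      obtain u where u: "\<And>j. j \<le> 2 \<Longrightarrow> g (G j) = u * f j" using ratio[OF G(1)] by blast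
      have eq: "mpol_eval (G j) v = c j * mpol_eval (G j0) v" if j: "j \<le> 2" for j
      proof -
        have form: "G j - Const (c j) * G j0 \<in> forms UNIV 2 e"
          using forms_diff[OF is_subfield_UNIV representsD(1)[OF G(1) j]
              forms_mult[OF is_subfield_UNIV forms_Const[OF is_subfield_UNIV UNIV_I] representsD(1)[OF G(1) j0(1)], of "c j", simplified]] .
        have "g (G j - Const (c j) * G j0) = 0" using c[OF j] u[OF j] u[OF j0(1)] by (simp add: g)
        then have "vanishes A (G j - Const (c j) * G j0)" using g_iff[OF form] by blast
        then show ?thesis using vanishes_at[OF _ P v] by (force simp: mpol_eval_diff mpol_eval_mult)
      qed
      obtain j where "j \<le> 2" "mpol_eval (G j) v \<noteq> 0" using G(2)[OF v] by blast
      then have nz: "mpol_eval (G j0) v \<noteq> 0" using eq[of j] by auto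
      have "(\<lambda>j. if j \<le> 2 then mpol_eval (G j) v else 0) \<in> \<phi> P"
        using representsD(2)[OF G(1) P v j0(1) nz] .
      moreover have "(\<lambda>j. if j \<le> 2 then mpol_eval (G j) v else 0) =
          (\<lambda>j. mpol_eval (G j0) v * (if j \<le> 2 then c j else 0))" using eq by (auto simp: mult.commute)
      ultimately show ?thesis
        using proj_spaceD(1) im P nz proj_point_scale by (metis image_subset_iff)
    qed
    then have "\<phi> P = \<phi> Q" if "P \<in> quartic A" "Q \<in> quartic A" for P Q using that by simp
    then show False
      using two_points_quartic[of A, OF A] iso(1) unfolding bij_betw_def inj_on_def by metis
  qed
  \<comment> \<open>The factor \<open>- A\<^sub>0 \<xi>\<^sup>3\<close> relates \<open>d/dt\<close> to the tangential derivations, which are given by forms.\<close>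
  define \<kappa> where "\<kappa> = - fls_const (A 0) * fps_to_fls \<xi> ^ 3 * h"
  have "\<xi> \<noteq> 0"
  proof
    assume "\<xi> = 0"
    then have "fps_const (A 1) + fps_const (A 2) * fps_X ^ 4 = 0" using \<xi> by (simp add: is_germ_def)
    from arg_cong[OF this, of "\<lambda>f. fps_nth f 0"] show False using A(2) by simp
  qed
  then have \<kappa>0: "\<kappa> \<noteq> 0" using h0 A(1) by (simp add: \<kappa>_def)
  have "\<exists>L\<in>forms UNIV 2 1. fps_to_fls (germ \<xi> L) = \<kappa> * f i" if i: "i \<le> 2" for i
  proof (rule regular_section_is_form[of A, OF A \<xi>])
    fix v assume v: "on_cone A v"
    define v' where "v' = vec3 (v 0) (v 1) (v 2)"
    define P where "P = proj_point v'"
    have P: "P \<in> quartic A" unfolding P_def v'_def using on_cone_trunc[OF v] by (rule quartic_memI) simp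
    have v'P: "v' \<in> P" by (simp add: P_def proj_point_self)
    obtain e G where G: "represents A e G \<phi>" "\<And>v. v \<in> P \<Longrightarrow> \<exists>j\<le>2. mpol_eval (G j) v \<noteq> 0"
      by (rule ex_represents[OF iso(2) P]) blast
    obtain c where c: "c \<le> 2" "mpol_eval (G c) v' \<noteq> 0" using G(2)[OF v'P] by blast
    obtain u where u: "\<And>j. j \<le> 2 \<Longrightarrow> g (G j) = u * f j" using ratio[OF G(1)] by blast
    obtain l where l: "l \<le> 2" "v l \<noteq> 0" using v by (auto simp: on_cone_def)
    have Gf: "G j \<in> forms UNIV 2 e" if "j \<le> 2" for j using representsD(1)[OF G(1) that] .
    \<comment> \<open>\<open>(a, b, c)\<close> is a cyclic permutation of \<open>(0, 1, 2)\<close>, and neither \<open>G\<^sub>c\<close> nor the coordinate \<open>l\<close>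
      vanishes at \<open>v\<close>.\<close>
    define a b :: nat where "a = vec3 1 2 0 c" and "b = vec3 2 0 1 c"
    have ab: "a \<le> 2" "b \<le> 2" using le_2_cases[OF c(1)] by (auto simp: a_def b_def)
    define W where "W = G a * tangent_deriv A l (G b) - G b * tangent_deriv A l (G a)"
    define N where "N = G i * W"
    define D where "D = Const (A' c) * Var l * G c ^ 3"
    have Wf: "W \<in> forms UNIV 2 (e + (e + 2))" unfolding W_def
      by (intro forms_diff[OF is_subfield_UNIV] forms_mult[OF is_subfield_UNIV] Gf forms_tangent_deriv ab)
    have "N \<in> forms UNIV 2 (e + (e + (e + 2)))" unfolding N_def
      by (rule forms_mult[OF is_subfield_UNIV Gf[OF i] Wf])
    moreover have "e + (e + (e + 2)) = (0 + 1 + 3 * e) + 1" by simp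
    ultimately have Nf: "N \<in> forms UNIV 2 ((0 + 1 + 3 * e) + 1)" by (rule subst[rotated])
    have Df: "D \<in> forms UNIV 2 (0 + 1 + 3 * e)" unfolding D_def
      by (intro forms_mult[OF is_subfield_UNIV] forms_Const[OF is_subfield_UNIV UNIV_I]
          forms_Var[OF is_subfield_UNIV l(1)] forms_power[OF is_subfield_UNIV] Gf c(1))
    have "mpol_eval D v \<noteq> 0"
      using mpol_eval_trunc[OF Gf[OF c(1)], of v] c l(2) A'j
      by (simp add: D_def mpol_eval_mult mpol_eval_power v'_def)
    moreover have "fps_to_fls (germ \<xi> N) = fps_to_fls (germ \<xi> D) * (\<kappa> * f i)"
    proof -
      define x where "x = fps_to_fls \<xi>"
      define t where "t = vec3 x 1 (fps_to_fls fps_X) l"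
      have gVar: "g (Var l) = t"
        using le_2_cases[OF l(1)] by (auto simp: g_def germ_simps t_def x_def)
      have deriv: "g (tangent_deriv A 1 (G j)) = - fls_const (A 0) * x ^ 3 * fls_deriv (g (G j))" if "j \<le> 2" for j
        unfolding g_def x_def germ_tangent_deriv(1)[OF \<xi> Gf[OF that]] fls_deriv_fps_to_fls
        by (simp add: fls_times_fps_to_fls fps_to_fls_power)
      define E where "E = vec3 (- fps_to_fls (fps_const (A 2) * fps_X ^ 3 * of_nat e)) 0
          (fps_to_fls (fps_const (A 0) * \<xi> ^ 3 * of_nat e)) l"
      have all: "g (tangent_deriv A l (G j)) = t * g (tangent_deriv A 1 (G j)) + E * g (G j)" if "j \<le> 2" for j
        using le_2_cases[OF l(1)] germ_tangent_deriv(2,3)[OF \<xi> Gf[OF that]]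
        by (auto simp: g_def t_def x_def E_def fls_times_fps_to_fls)
      have "g W = - t * fls_const (A 0) * x ^ 3 * (g (G a) * fls_deriv (g (G b)) - g (G b) * fls_deriv (g (G a)))"
        unfolding W_def g all[OF ab(1)] all[OF ab(2)] deriv[OF ab(1)] deriv[OF ab(2)] by (simp add: algebra_simps)
      also have "g (G a) * fls_deriv (g (G b)) - g (G b) * fls_deriv (g (G a)) = wronskian (\<lambda>j. g (G j)) c"
        using le_2_cases[OF c(1)] by (auto simp: wronskian_def a_def b_def)
      also have "\<dots> = u ^ 2 * wronskian f c" by (rule wronskian_scale[OF u c(1)])
      also have "\<dots> = u ^ 2 * (h * (fls_const (A' c) * f c ^ 3))" by (simp add: h[OF c(1)])
      finally have "g N = fls_const (A' c) * t * (u * f c) ^ 3 * (\<kappa> * f i)"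
        unfolding N_def g u[OF i] \<kappa>_def x_def by (simp add: power2_eq_square power3_eq_cube mult_ac)
      also have "\<dots> = g D * (\<kappa> * f i)" unfolding D_def g gVar u[OF c(1)] by simp
      finally show ?thesis unfolding g_def .
    qed
    ultimately show "\<exists>e N D. N \<in> forms UNIV 2 (e + 1) \<and> D \<in> forms UNIV 2 e \<and>
        mpol_eval D v \<noteq> 0 \<and> fps_to_fls (germ \<xi> N) = fps_to_fls (germ \<xi> D) * (\<kappa> * f i)"
      using Nf Df by blast
  qed
  then have "\<forall>i. \<exists>L. i \<le> 2 \<longrightarrow> L \<in> forms UNIV 2 1 \<and> g L = \<kappa> * f i" unfolding g_def by blast
  then obtain L where Lf: "\<And>i. i \<le> 2 \<Longrightarrow> L i \<in> forms UNIV 2 1" and gL: "\<And>i. i \<le> 2 \<Longrightarrow> g (L i) = \<kappa> * f i"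
    by metis
  have proportional: "mpol_eval (L i) v * mpol_eval (G j) v = mpol_eval (L j) v * mpol_eval (G i) v"
    if G: "represents A e G \<phi>" and ij: "i \<le> 2" "j \<le> 2" and P: "P \<in> quartic A" "v \<in> P" for e G i j P v
  proof -
    obtain u where u: "\<And>j. j \<le> 2 \<Longrightarrow> g (G j) = u * f j" using ratio[OF G] by blast
    have form: "L i * G j - L j * G i \<in> forms UNIV 2 (1 + e)"
      by (intro forms_diff[OF is_subfield_UNIV] forms_mult[OF is_subfield_UNIV] Lf representsD(1)[OF G] ij)
    have "g (L i * G j - L j * G i) = 0" using ij by (simp add: g gL u)
    then have "vanishes A (L i * G j - L j * G i)" using g_iff[OF form] by blast
    from vanishes_at[OF this P] show ?thesis by (simp add: mpol_eval_diff mpol_eval_mult)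
  qed
  have "represents A 1 L \<phi>"
    unfolding represents_def
  proof (intro conjI allI impI ballI)
    fix P v assume P: "P \<in> quartic A" "v \<in> P" and "\<exists>j\<le>2. mpol_eval (L j) v \<noteq> 0"
    then obtain j where j: "j \<le> 2" "mpol_eval (L j) v \<noteq> 0" by blast
    obtain e G where G: "represents A e G \<phi>" "\<And>v. v \<in> P \<Longrightarrow> \<exists>j\<le>2. mpol_eval (G j) v \<noteq> 0"
      by (rule ex_represents[OF iso(2) P(1)]) blast
    obtain i where i: "i \<le> 2" "mpol_eval (G i) v \<noteq> 0" using G(2)[OF P(2)] by blast
    let ?g = "\<lambda>j. if j \<le> 2 then mpol_eval (G j) v else 0"
    have mem: "?g \<in> \<phi> P" using representsD(2)[OF G(1) P i] .
    define c where "c = mpol_eval (L i) v / mpol_eval (G i) v"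
    have eq: "(\<lambda>j. if j \<le> 2 then mpol_eval (L j) v else 0) = (\<lambda>j. c * ?g j)"
      using proportional[OF G(1) _ i(1) P] i(2) by (auto simp: c_def field_simps)
    have "c \<noteq> 0" using fun_cong[OF eq, of j] j by auto
    then show "(\<lambda>j. if j \<le> 2 then mpol_eval (L j) v else 0) \<in> \<phi> P"
    proof -
      have "\<phi> P \<in> proj_space 2" using im P(1) by blast
      from proj_spaceD(1)[OF this mem] show ?thesis
        unfolding eq using \<open>c \<noteq> 0\<close> by (auto simp: proj_point_mem_iff)
    qed
  qed (rule Lf)
  moreover have "\<forall>j\<le>2. u j = 0" if van: "vanishes A (\<Sum>j\<le>2. Const (u j) * L j)" for u
  proof -
    have "(\<Sum>j\<le>2. Const (u j) * L j) \<in> forms UNIV 2 (0 + 1)"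
      by (intro forms_sum[OF is_subfield_UNIV] forms_mult[OF is_subfield_UNIV]
          forms_Const[OF is_subfield_UNIV UNIV_I] Lf) simp
    then have "g (\<Sum>j\<le>2. Const (u j) * L j) = 0" using van g_iff by blast
    then have "\<kappa> * (\<Sum>j\<le>2. fls_const (u j) * f j) = 0"
      by (simp add: g gL sum_atMost_2 algebra_simps)
    then have uf: "(\<Sum>j\<le>2. fls_const (u j) * f j) = 0" using \<kappa>0 by simp
    have line: "u 0 * w 0 + u 1 * w 1 + u 2 * w 2 = 0" if w: "on_cone A' w" "\<And>i. i > 2 \<Longrightarrow> w i = 0" for w
    proof -
      have "proj_point w \<in> \<phi> ` quartic A" using quartic_memI[OF w] iso(1) by (auto simp: bij_betw_def)
      then obtain P where P: "P \<in> quartic A" "\<phi> P = proj_point w" by auto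
      obtain e G where G: "represents A e G \<phi>" "\<And>v. v \<in> P \<Longrightarrow> \<exists>j\<le>2. mpol_eval (G j) v \<noteq> 0"
        by (rule ex_represents[OF iso(2) P(1)]) blast
      obtain r where r: "\<And>j. j \<le> 2 \<Longrightarrow> g (G j) = r * f j" using ratio[OF G(1)] by blast
      obtain v where v: "v \<in> P" using P proj_space_nonempty quartic_subset by blast
      have "(\<Sum>j\<le>2. Const (u j) * G j) \<in> forms UNIV 2 (0 + e)"
        by (intro forms_sum[OF is_subfield_UNIV] forms_mult[OF is_subfield_UNIV]
            forms_Const[OF is_subfield_UNIV UNIV_I] representsD(1)[OF G(1)]) simp
      moreover have "g (\<Sum>j\<le>2. Const (u j) * G j) = r * (\<Sum>j\<le>2. fls_const (u j) * f j)"
        by (simp add: g r sum_atMost_2 algebra_simps)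
      ultimately have "vanishes A (\<Sum>j\<le>2. Const (u j) * G j)" using g_iff uf by simp
      from vanishes_at[OF this P(1) v]
      have z: "u 0 * mpol_eval (G 0) v + u 1 * mpol_eval (G 1) v + u 2 * mpol_eval (G 2) v = 0"
        by (simp add: mpol_eval_add mpol_eval_mult sum_atMost_2)
      obtain i where i: "i \<le> 2" "mpol_eval (G i) v \<noteq> 0" using G(2)[OF v] by blast
      have "(\<lambda>j. if j \<le> 2 then mpol_eval (G j) v else 0) \<in> proj_point w"
        using representsD(2)[OF G(1) P(1) v i] P(2) by simp
      then obtain c where c: "c \<noteq> 0" "(\<lambda>j. if j \<le> 2 then mpol_eval (G j) v else 0) = (\<lambda>i. c * w i)"
        by (auto simp: proj_point_mem_iff)
      have "c * (u 0 * w 0 + u 1 * w 1 + u 2 * w 2) = 0"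
        using z fun_cong[OF c(2), of 0] fun_cong[OF c(2), of 1] fun_cong[OF c(2), of 2] by (simp add: algebra_simps)
      then show ?thesis using c(1) by simp
    qed
    obtain \<zeta> where \<zeta>: "\<zeta> ^ 4 = - A' 1 / A' 0" using nth_root_exists[of 4 "- A' 1 / A' 0"] by auto
    obtain \<eta> where \<eta>: "\<eta> ^ 4 = - A' 2 / A' 0" using nth_root_exists[of 4 "- A' 2 / A' 0"] by auto
    have nz: "\<zeta> \<noteq> 0" using \<zeta> A' by auto
    have "on_cone A' (vec3 \<zeta> 1 0)" "on_cone A' (vec3 (- \<zeta>) 1 0)" "on_cone A' (vec3 \<eta> 0 1)"
      using A'(1) by (simp_all add: on_cone_iff \<zeta> \<eta>)
    then have e: "u 0 * \<zeta> + u 1 = 0" "- (u 0 * \<zeta>) + u 1 = 0" "u 0 * \<eta> + u 2 = 0"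
      using line[of "vec3 \<zeta> 1 0"] line[of "vec3 (- \<zeta>) 1 0"] line[of "vec3 \<eta> 0 1"] by simp_all
    then have "2 * (u 0 * \<zeta>) = 0" by algebra
    then have "u 0 = 0" using nz by simp
    then show ?thesis using e unfolding all_le_2 by simp
  qed
  ultimately show ?thesis by blast
qed

definition monomial_map :: "(nat \<Rightarrow> nat) \<Rightarrow> (nat \<Rightarrow> 'a::field) \<Rightarrow> (nat \<Rightarrow> 'a) \<Rightarrow> nat \<Rightarrow> 'a" where
  "monomial_map \<pi> c v j = (if j \<le> 2 then c j * v (\<pi> j) else 0)"

text \<open>A linear map between the quartics takes the sum of the \<open>A'\<^sub>j x\<^sub>j\<^sup>4\<close> to a multiple of the sum of the
  \<open>A\<^sub>j x\<^sub>j\<^sup>4\<close>. As mixed coefficients vanish and the rows are independent, every row of the matrix has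
  exactly one nonzero entry.\<close>

theorem isomorphism_is_monomial:
  fixes A A' :: "nat \<Rightarrow> 'a::{alg_closed_field, field_char_0}"
  assumes A: "A 0 \<noteq> 0" "A 1 \<noteq> 0" "A 2 \<noteq> 0" and A': "A' 0 \<noteq> 0" "A' 1 \<noteq> 0" "A' 2 \<noteq> 0"
    and iso: "isomorphism_over UNIV 2 (quartic A) 2 (quartic A') \<phi>"
  shows "\<exists>\<pi> c. \<pi> permutes {..2} \<and> (\<forall>j\<le>2. c j \<noteq> 0) \<and>
    (\<forall>P\<in>quartic A. \<forall>v\<in>P. \<phi> P = proj_point (monomial_map \<pi> c v))"
proof -
  have bij: "bij_betw \<phi> (quartic A) (quartic A')" and mor: "morphism_over UNIV 2 (quartic A) 2 (quartic A') \<phi>"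
    using iso by (auto simp: isomorphism_over_def)
  obtain L where L: "represents A 1 L \<phi>"
    and indep: "\<And>u. vanishes A (\<Sum>j\<le>2. Const (u j) * L j) \<Longrightarrow> \<forall>j\<le>2. u j = 0"
    using isomorphism_is_linear[of A A' \<phi>, OF A A' bij mor] by blast
  define M where "M j l = Poly_Mapping.lookup (L j) (Poly_Mapping.single l 1)" for j l
  have ev: "mpol_eval (L j) v = (\<Sum>l\<le>2. M j l * v l)" if "j \<le> 2" for j v
    unfolding M_def by (rule linear_form_eval[OF representsD(1)[OF L that]])
  have indep': "u j = 0" if z: "\<And>l. l \<le> 2 \<Longrightarrow> (\<Sum>j\<le>2. u j * M j l) = 0" and "j \<le> 2" for u j
  proof -
    have "mpol_eval (\<Sum>j\<le>2. Const (u j) * L j) v = (\<Sum>l\<le>2. (\<Sum>j\<le>2. u j * M j l) * v l)" for v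
      by (simp add: mpol_eval_add mpol_eval_mult ev sum_atMost_2 algebra_simps)
    also have "\<dots> v = 0" for v using z by simp
    finally have "vanishes A (\<Sum>j\<le>2. Const (u j) * L j)" by (simp add: vanishes_def)
    then show ?thesis using indep \<open>j \<le> 2\<close> by blast
  qed
  have quart: "(\<Sum>j\<le>2. A' j * (\<Sum>l\<le>2. M j l * v l) ^ 4) = 0" if v: "on_cone A v" for v
  proof (cases "\<exists>j\<le>2. mpol_eval (L j) v \<noteq> 0")
    case True
    define v' where "v' = vec3 (v 0) (v 1) (v 2)"
    have P: "proj_point v' \<in> quartic A" unfolding v'_def using on_cone_trunc[OF v] by (rule quartic_memI) simp
    have ev': "mpol_eval (L j) v' = mpol_eval (L j) v" if "j \<le> 2" for j
      unfolding v'_def by (rule mpol_eval_trunc[OF representsD(1)[OF L that]])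
    obtain j where "j \<le> 2" "mpol_eval (L j) v' \<noteq> 0" using True ev' by auto
    then have mem: "(\<lambda>j. if j \<le> 2 then mpol_eval (L j) v' else 0) \<in> \<phi> (proj_point v')"
      by (rule representsD(2)[OF L P proj_point_self])
    have "\<phi> (proj_point v') \<in> quartic A'" using bij P by (auto simp: bij_betw_def)
    from quartic_memD[OF this mem] show ?thesis
      using ev'[of 0] ev'[of 1] ev'[of 2] ev[of 0 v] ev[of 1 v] ev[of 2 v] by (simp add: on_cone_iff sum_atMost_2)
  next
    case False
    then have "(\<Sum>l\<le>2. M j l * v l) = 0" if "j \<le> 2" for j using ev[OF that] that by auto
    then show ?thesis by simp
  qed
  have row_nz: "\<exists>l\<le>2. M j l \<noteq> 0" if j: "j \<le> 2" for j
  proof (rule ccontr)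
    assume "\<not> ?thesis"
    then have "(\<Sum>i\<le>2. (if i = j then 1 else 0) * M i l) = 0" if "l \<le> 2" for l
      using that by (intro sum.neutral) auto
    from indep'[OF this j] show False by simp
  qed
  have row: "M j l * M j m = 0" if j: "j \<le> 2" and lm: "l \<le> 2" "m \<le> 2" "l \<noteq> m" for j l m
  proof -
    obtain q where q: "q \<le> 2" "M j q \<noteq> 0" using row_nz[OF j] by blast
    have "(\<Sum>i\<le>2. (A' i * M i l * M i m * M i q) * M i p) = 0" if p: "p \<le> 2" for p
      using mixed_coefficients_zero[of A A' M, OF A quart lm q(1) p] .
    from indep'[of "\<lambda>i. A' i * M i l * M i m * M i q", OF this j]
    show ?thesis using q(2) le_2_cases[OF j] A' by auto
  qed
  define \<pi> where "\<pi> j = (if j \<le> 2 then (SOME l. l \<le> 2 \<and> M j l \<noteq> 0) else j)" for j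
  have \<pi>: "\<pi> j \<le> 2" "M j (\<pi> j) \<noteq> 0" if "j \<le> 2" for j
    using someI_ex[OF row_nz[OF that, unfolded Bex_def]] that unfolding \<pi>_def by auto
  have zero: "M j l = 0" if "j \<le> 2" "l \<le> 2" "l \<noteq> \<pi> j" for j l
    using row[OF that(1) that(2) \<pi>(1)[OF that(1)] that(3)] \<pi>(2)[OF that(1)] by simp
  have inj: "inj_on \<pi> {..2}"
  proof (rule inj_onI, rule ccontr)
    fix i j assume ij: "i \<in> {..2}" "j \<in> {..2}" "\<pi> i = \<pi> j" "i \<noteq> j"
    define u where "u = (\<lambda>t. if t = i then M j (\<pi> j) else if t = j then - M i (\<pi> i) else 0)"
    have "(\<Sum>t\<le>2. u t * M t l) = 0" if "l \<le> 2" for l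
    proof -
      have "(\<Sum>t\<le>2. u t * M t l) = (\<Sum>t\<in>{i, j}. u t * M t l)"
        using ij by (intro sum.mono_neutral_right) (auto simp: u_def)
      also have "\<dots> = M j (\<pi> j) * M i l - M i (\<pi> i) * M j l" using ij by (simp add: u_def)
      also have "\<dots> = 0" using zero[of i l] zero[of j l] ij that by (cases "l = \<pi> i") auto
      finally show ?thesis .
    qed
    from indep'[OF this, of i] show False using ij \<pi>(2)[of j] by (simp add: u_def)
  qed
  have perm: "\<pi> permutes {..2}"
  proof (rule bij_imp_permutes)
    have "\<pi> ` {..2} \<subseteq> {..2}" using \<pi>(1) by auto
    then have "\<pi> ` {..2} = {..2}" using inj by (simp add: endo_inj_surj)
    then show "bij_betw \<pi> {..2} {..2}" using inj by (simp add: bij_betw_def)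
  qed (simp add: \<pi>_def)
  define c where "c j = M j (\<pi> j)" for j
  have Lc: "mpol_eval (L j) v = c j * v (\<pi> j)" if j: "j \<le> 2" for j v
  proof -
    have "(\<Sum>l\<le>2. M j l * v l) = (\<Sum>l\<le>2. if l = \<pi> j then c j * v (\<pi> j) else 0)"
      using zero[OF j] by (intro sum.cong) (auto simp: c_def)
    then show ?thesis using ev[OF j] \<pi>(1)[OF j] by simp
  qed
  have "\<phi> P = proj_point (monomial_map \<pi> c v)" if P: "P \<in> quartic A" "v \<in> P" for P v
  proof -
    have PS: "P \<in> proj_space 2" using P(1) quartic_subset by blast
    obtain i where i: "i \<le> 2" "v i \<noteq> 0" using proj_spaceD(2)[OF PS P(2)] by blast
    obtain j where j: "\<pi> j = i" "j \<le> 2" using permutes_image[OF perm] i(1) by (metis atMost_iff imageE)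
    have "mpol_eval (L j) v \<noteq> 0" using Lc[OF j(2)] \<pi>(2)[OF j(2)] i(2) j(1) by (simp add: c_def)
    from representsD(2)[OF L P j(2) this]
    have mem: "(\<lambda>j. if j \<le> 2 then mpol_eval (L j) v else 0) \<in> \<phi> P" .
    have "\<phi> P \<in> proj_space 2" using bij P(1) quartic_subset by (auto simp: bij_betw_def)
    from proj_spaceD(1)[OF this mem] show ?thesis
      using Lc by (simp add: monomial_map_def[abs_def] cong: if_cong)
  qed
  then show ?thesis
    using perm \<pi>(2) by (intro exI[of _ \<pi>] exI[of _ c] conjI) (auto simp: c_def)
qed


section \<open>Isomorphisms over subfields\<close>

lemma morphism_over_monomial:
  fixes E :: "'a::field set"
  assumes E: "is_subfield E" "\<And>j. j \<le> 2 \<Longrightarrow> c j \<in> E" and c: "\<And>j. j \<le> 2 \<Longrightarrow> c j \<noteq> 0"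
    and \<pi>: "\<pi> permutes {..2}" and V: "V \<subseteq> proj_space 2" and im: "\<phi> ` V \<subseteq> W"
    and \<phi>: "\<And>P v. P \<in> V \<Longrightarrow> v \<in> P \<Longrightarrow> \<phi> P = proj_point (monomial_map \<pi> c v)"
  shows "morphism_over E 2 V 2 W \<phi>"
  unfolding morphism_over_def
proof (intro conjI ballI)
  fix P assume P: "P \<in> V"
  define F where "F j = Const (c j) * Var (\<pi> j)" for j
  have ev: "mpol_eval (F j) v = c j * v (\<pi> j)" for j v by (simp add: F_def mpol_eval_mult)
  have \<pi>2: "\<pi> j \<le> 2" if "j \<le> 2" for j using permutes_in_image[OF \<pi>, of j] that by simp
  show "\<exists>d F. (\<forall>j\<le>2. F j \<in> forms E 2 d) \<and> (\<forall>v\<in>P. \<exists>j\<le>2. mpol_eval (F j) v \<noteq> 0) \<and>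
        (\<forall>Q\<in>V. \<forall>v\<in>Q. (\<exists>j\<le>2. mpol_eval (F j) v \<noteq> 0) \<longrightarrow>
           \<phi> Q = proj_point (\<lambda>j. if j \<le> 2 then mpol_eval (F j) v else 0))"
  proof (rule exI[of _ "0 + 1"], rule exI[of _ F], intro conjI allI ballI impI)
    show "F j \<in> forms E 2 (0 + 1)" if "j \<le> 2" for j
      unfolding F_def by (rule forms_mult[OF E(1) forms_Const[OF E(1) E(2)[OF that]] forms_Var[OF E(1) \<pi>2[OF that]]])
    show "\<exists>j\<le>2. mpol_eval (F j) v \<noteq> 0" if v: "v \<in> P" for v
    proof -
      obtain i where i: "i \<le> 2" "v i \<noteq> 0" using proj_spaceD(2)[OF subsetD[OF V P] v] by blast
      obtain j where "\<pi> j = i" "j \<le> 2" using permutes_image[OF \<pi>] i(1) by (metis atMost_iff imageE)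
      then show ?thesis using c i(2) ev by (intro exI[of _ j]) auto
    qed
    show "\<phi> Q = proj_point (\<lambda>j. if j \<le> 2 then mpol_eval (F j) v else 0)" if "Q \<in> V" "v \<in> Q" for Q v
      unfolding \<phi>[OF that] monomial_map_def[abs_def] ev ..
  qed
qed (rule im)

lemma sum_permutes_2:
  fixes f :: "nat \<Rightarrow> 'b::comm_monoid_add"
  assumes "\<pi> permutes {..2}" shows "f (\<pi> 0) + f (\<pi> 1) + f (\<pi> 2) = f 0 + f 1 + f 2"
  using sum.permute[OF assms, of f] by (simp add: sum_atMost_2)

lemma on_cone_monomial_map:
  assumes \<pi>: "\<pi> permutes {..2}" and c: "\<And>j. j \<le> 2 \<Longrightarrow> c j \<noteq> 0"
    and eq: "\<And>j. j \<le> 2 \<Longrightarrow> A' j * c j ^ 4 = \<mu> * A (\<pi> j)" and v: "on_cone A v"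
  shows "on_cone A' (monomial_map \<pi> c v)"
proof -
  have "A' 0 * (c 0 * v (\<pi> 0)) ^ 4 + A' 1 * (c 1 * v (\<pi> 1)) ^ 4 + A' 2 * (c 2 * v (\<pi> 2)) ^ 4 =
      (A' 0 * c 0 ^ 4) * v (\<pi> 0) ^ 4 + (A' 1 * c 1 ^ 4) * v (\<pi> 1) ^ 4 + (A' 2 * c 2 ^ 4) * v (\<pi> 2) ^ 4"
    by (simp add: power_mult_distrib mult_ac)
  also have "\<dots> = \<mu> * (A (\<pi> 0) * v (\<pi> 0) ^ 4 + A (\<pi> 1) * v (\<pi> 1) ^ 4 + A (\<pi> 2) * v (\<pi> 2) ^ 4)"
    by (simp add: eq algebra_simps)
  also have "\<dots> = 0" using sum_permutes_2[OF \<pi>, of "\<lambda>l. A l * v l ^ 4"] v by (simp add: on_cone_iff)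
  finally have "A' 0 * (c 0 * v (\<pi> 0)) ^ 4 + A' 1 * (c 1 * v (\<pi> 1)) ^ 4 + A' 2 * (c 2 * v (\<pi> 2)) ^ 4 = 0" .
  moreover obtain i where i: "i \<le> 2" "v i \<noteq> 0" using v by (auto simp: on_cone_def)
  obtain j where "\<pi> j = i" "j \<le> 2" using permutes_image[OF \<pi>] i(1) by (metis atMost_iff imageE)
  then have "\<exists>j\<le>2. monomial_map \<pi> c v j \<noteq> 0" using c i(2) by (auto simp: monomial_map_def)
  ultimately show ?thesis by (simp add: on_cone_def monomial_map_def)
qed

lemma monomial_map_inverse:
  assumes \<pi>: "\<pi> permutes {..2}" and c: "\<And>j. j \<le> 2 \<Longrightarrow> c j \<noteq> 0" and v: "\<And>i. i > 2 \<Longrightarrow> v i = 0"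
  shows "monomial_map (inv \<pi>) (\<lambda>l. inverse (c (inv \<pi> l))) (monomial_map \<pi> c v) = v"
    "monomial_map \<pi> c (monomial_map (inv \<pi>) (\<lambda>l. inverse (c (inv \<pi> l))) v) = v"
proof -
  have p: "\<pi> (inv \<pi> l) = l" "inv \<pi> (\<pi> l) = l" for l using permutes_inverses[OF \<pi>] by auto
  have le: "\<pi> j \<le> 2" "inv \<pi> j \<le> 2" if "j \<le> 2" for j
    using permutes_in_image[OF \<pi>, of j] permutes_in_image[OF permutes_inv[OF \<pi>], of j] that by auto
  show "monomial_map (inv \<pi>) (\<lambda>l. inverse (c (inv \<pi> l))) (monomial_map \<pi> c v) = v"
    using le c v by (auto simp: monomial_map_def fun_eq_iff p not_le)
  show "monomial_map \<pi> c (monomial_map (inv \<pi>) (\<lambda>l. inverse (c (inv \<pi> l))) v) = v"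
    using le c v by (auto simp: monomial_map_def fun_eq_iff p not_le)
qed

lemma monomial_map_scale:
  assumes "t \<noteq> 0"
  shows "proj_point (monomial_map \<pi> c (\<lambda>i. t * v i)) = proj_point (monomial_map \<pi> c v)"
    "proj_point (monomial_map \<pi> (\<lambda>i. t * c i) v) = proj_point (monomial_map \<pi> c v)"
proof -
  have "monomial_map \<pi> c (\<lambda>i. t * v i) = (\<lambda>j. t * monomial_map \<pi> c v j)"
    "monomial_map \<pi> (\<lambda>i. t * c i) v = (\<lambda>j. t * monomial_map \<pi> c v j)"
    by (auto simp: monomial_map_def fun_eq_iff)
  then show "proj_point (monomial_map \<pi> c (\<lambda>i. t * v i)) = proj_point (monomial_map \<pi> c v)"
    "proj_point (monomial_map \<pi> (\<lambda>i. t * c i) v) = proj_point (monomial_map \<pi> c v)"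
    using proj_point_scale[OF assms] by simp_all
qed

theorem isomorphism_over_monomial:
  fixes E :: "'a::field set"
  assumes E: "is_subfield E" "\<And>j. j \<le> 2 \<Longrightarrow> c j \<in> E" and c: "\<And>j. j \<le> 2 \<Longrightarrow> c j \<noteq> 0"
    and \<pi>: "\<pi> permutes {..2}" and \<mu>: "\<mu> \<noteq> 0"
    and eq: "\<And>j. j \<le> 2 \<Longrightarrow> A' j * c j ^ 4 = \<mu> * A (\<pi> j)"
    and \<phi>: "\<And>P v. P \<in> quartic A \<Longrightarrow> v \<in> P \<Longrightarrow> \<phi> P = proj_point (monomial_map \<pi> c v)"
  shows "isomorphism_over E 2 (quartic A) 2 (quartic A') \<phi>"
proof -
  define c' where "c' l = inverse (c (inv \<pi> l))" for l
  have \<pi>': "inv \<pi> permutes {..2}" by (rule permutes_inv[OF \<pi>])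
  have le: "inv \<pi> j \<le> 2" if "j \<le> 2" for j using permutes_in_image[OF \<pi>', of j] that by simp
  have c': "c' j \<in> E" "c' j \<noteq> 0" if "j \<le> 2" for j
    using E c le[OF that] subfield_closed(5)[OF E(1)] by (auto simp: c'_def)
  have eq': "A j * c' j ^ 4 = inverse \<mu> * A' (inv \<pi> j)" if "j \<le> 2" for j
    using eq[OF le[OF that]] permutes_inverses(1)[OF \<pi>, of j] c[OF le[OF that]] \<mu>
    by (simp add: c'_def field_simps)
  have supp: "v i = 0" if "P \<in> quartic B" "v \<in> P" "i > 2" for P B v and i :: nat
    using proj_spaceD(3)[OF subsetD[OF quartic_subset that(1)] that(2,3)] .
  have point: "P = proj_point v" if "P \<in> quartic B" "v \<in> P" for P B v
    using proj_spaceD(1)[OF subsetD[OF quartic_subset that(1)] that(2)] .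
  have ex: "\<exists>v. v \<in> P" if "P \<in> quartic B" for P B
    using proj_space_nonempty[OF subsetD[OF quartic_subset that]] .
  define \<psi> where "\<psi> Q = proj_point (monomial_map (inv \<pi>) c' (SOME w. w \<in> Q))" for Q
  have \<psi>: "\<psi> Q = proj_point (monomial_map (inv \<pi>) c' w)" if Q: "Q \<in> quartic A'" "w \<in> Q" for Q w
  proof -
    have "(SOME w. w \<in> Q) \<in> proj_point w" using point[OF Q] Q(2) by (metis someI)
    then obtain t where "t \<noteq> 0" "(SOME w. w \<in> Q) = (\<lambda>i. t * w i)" by (auto simp: proj_point_mem_iff)
    then show ?thesis unfolding \<psi>_def using monomial_map_scale(1) by metis
  qed
  have im: "\<phi> ` quartic A \<subseteq> quartic A'"
  proof
    fix Q assume "Q \<in> \<phi> ` quartic A"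
    then obtain P where P: "P \<in> quartic A" "Q = \<phi> P" by blast
    obtain v where v: "v \<in> P" using ex[OF P(1)] by blast
    have "on_cone A' (monomial_map \<pi> c v)"
      using on_cone_monomial_map[of \<pi> c A' \<mu> A, OF \<pi> c eq quartic_memD[OF P(1) v]] by simp
    then show "Q \<in> quartic A'" unfolding P(2) \<phi>[OF P(1) v]
      by (rule quartic_memI) (simp add: monomial_map_def)
  qed
  have im': "\<psi> ` quartic A' \<subseteq> quartic A"
  proof
    fix Q assume "Q \<in> \<psi> ` quartic A'"
    then obtain P where P: "P \<in> quartic A'" "Q = \<psi> P" by blast
    obtain v where v: "v \<in> P" using ex[OF P(1)] by blast
    have "on_cone A (monomial_map (inv \<pi>) c' v)"
      using on_cone_monomial_map[of "inv \<pi>" c' A "inverse \<mu>" A', OF \<pi>' c'(2) eq' quartic_memD[OF P(1) v]] by simp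
    then show "Q \<in> quartic A" unfolding P(2) \<psi>[OF P(1) v]
      by (rule quartic_memI) (simp add: monomial_map_def)
  qed
  have 1: "\<psi> (\<phi> P) = P" if P: "P \<in> quartic A" for P
  proof -
    obtain v where v: "v \<in> P" using ex[OF P] by blast
    have "\<phi> P \<in> quartic A'" using im P by blast
    moreover have "monomial_map \<pi> c v \<in> \<phi> P" unfolding \<phi>[OF P v] by (rule proj_point_self)
    ultimately have "\<psi> (\<phi> P) = proj_point (monomial_map (inv \<pi>) c' (monomial_map \<pi> c v))" by (rule \<psi>)
    also have "\<dots> = proj_point v"
      using monomial_map_inverse(1)[of \<pi> c v, OF \<pi> c supp[OF P v]] by (simp add: c'_def[abs_def])
    finally show ?thesis using point[OF P v] by simp
  qed
  have 2: "\<phi> (\<psi> Q) = Q" if Q: "Q \<in> quartic A'" for Q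
  proof -
    obtain w where w: "w \<in> Q" using ex[OF Q] by blast
    have "\<psi> Q \<in> quartic A" using im' Q by blast
    moreover have "monomial_map (inv \<pi>) c' w \<in> \<psi> Q" unfolding \<psi>[OF Q w] by (rule proj_point_self)
    ultimately have "\<phi> (\<psi> Q) = proj_point (monomial_map \<pi> c (monomial_map (inv \<pi>) c' w))" by (rule \<phi>)
    also have "\<dots> = proj_point w"
      using monomial_map_inverse(2)[of \<pi> c w, OF \<pi> c supp[OF Q w]] by (simp add: c'_def[abs_def])
    finally show ?thesis using point[OF Q w] by simp
  qed
  have bij: "bij_betw \<phi> (quartic A) (quartic A')"
    by (rule bij_betw_byWitness[of _ \<psi>]) (use 1 2 im im' in auto)
  have inv: "inv_into (quartic A) \<phi> Q = \<psi> Q" if "Q \<in> quartic A'" for Q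
    using inv_into_f_f[OF bij_betw_imp_inj_on[OF bij], of "\<psi> Q"] 2[OF that] im' that by auto
  have "morphism_over E 2 (quartic A) 2 (quartic A') \<phi>"
    by (rule morphism_over_monomial[OF E c \<pi> quartic_subset im \<phi>])
  moreover have "morphism_over E 2 (quartic A') 2 (quartic A) (inv_into (quartic A) \<phi>)"
  proof (rule morphism_over_monomial[OF E(1) c' \<pi>' quartic_subset])
    show "inv_into (quartic A) \<phi> ` quartic A' \<subseteq> quartic A" using inv im' by auto
    show "inv_into (quartic A) \<phi> Q = proj_point (monomial_map (inv \<pi>) c' w)" if "Q \<in> quartic A'" "w \<in> Q" for Q w
      using inv[OF that(1)] \<psi>[OF that] by simp
  qed
  ultimately show ?thesis using bij by (simp add: isomorphism_over_def)
qed

lemma morphism_over_mono: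
  assumes "morphism_over E n V m W \<phi>" "E \<subseteq> E'"
  shows "morphism_over E' n V m W \<phi>"
  unfolding morphism_over_def
proof (intro conjI ballI)
  show "\<phi> ` V \<subseteq> W" using assms(1) by (simp add: morphism_over_def)
  fix P assume P: "P \<in> V"
  obtain d F where F: "\<And>j. j \<le> m \<Longrightarrow> F j \<in> forms E n d"
    and nz: "\<And>v. v \<in> P \<Longrightarrow> \<exists>j\<le>m. mpol_eval (F j) v \<noteq> 0"
    and rep: "\<And>Q v j. Q \<in> V \<Longrightarrow> v \<in> Q \<Longrightarrow> j \<le> m \<Longrightarrow> mpol_eval (F j) v \<noteq> 0 \<Longrightarrow>
       \<phi> Q = proj_point (\<lambda>j. if j \<le> m then mpol_eval (F j) v else 0)"
    by (rule morphism_over_rep[OF assms(1) P]) (assumption | blast)+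
  have "forms E n d \<subseteq> forms E' n d" by (rule forms_mono[OF assms(2)]) simp
  then have "\<forall>j\<le>m. F j \<in> forms E' n d" using F by blast
  moreover have "\<forall>v\<in>P. \<exists>j\<le>m. mpol_eval (F j) v \<noteq> 0" using nz by blast
  moreover have "\<forall>Q\<in>V. \<forall>v\<in>Q. (\<exists>j\<le>m. mpol_eval (F j) v \<noteq> 0) \<longrightarrow>
       \<phi> Q = proj_point (\<lambda>j. if j \<le> m then mpol_eval (F j) v else 0)" using rep by blast
  ultimately show "\<exists>d F. (\<forall>j\<le>m. F j \<in> forms E' n d) \<and> (\<forall>v\<in>P. \<exists>j\<le>m. mpol_eval (F j) v \<noteq> 0) \<and>
        (\<forall>Q\<in>V. \<forall>v\<in>Q. (\<exists>j\<le>m. mpol_eval (F j) v \<noteq> 0) \<longrightarrow>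
           \<phi> Q = proj_point (\<lambda>j. if j \<le> m then mpol_eval (F j) v else 0))"
    by (intro exI conjI)
qed

lemma isomorphism_over_mono:
  "isomorphism_over E n V m W \<phi> \<Longrightarrow> E \<subseteq> E' \<Longrightarrow> isomorphism_over E' n V m W \<phi>"
  by (auto simp: isomorphism_over_def intro: morphism_over_mono)

lemma on_cone_all_nonzero:
  fixes A :: "nat \<Rightarrow> 'a::{alg_closed_field, field_char_0}"
  assumes A: "A 0 \<noteq> 0" "A 1 \<noteq> 0" "A 2 \<noteq> 0"
  shows "\<exists>x y z. on_cone A (vec3 x y z) \<and> x \<noteq> 0 \<and> y \<noteq> 0 \<and> z \<noteq> 0"
proof -
  obtain y where y: "y ^ 4 = A 0 / A 1" using nth_root_exists[of 4 "A 0 / A 1"] by auto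
  obtain z where z: "z ^ 4 = - 2 * A 0 / A 2" using nth_root_exists[of 4 "- 2 * A 0 / A 2"] by auto
  have "y \<noteq> 0" "z \<noteq> 0" using y z A by auto
  moreover have "on_cone A (vec3 1 y z)" using A by (simp add: on_cone_iff y z)
  ultimately show ?thesis by (intro exI[of _ 1] exI[of _ y] exI[of _ z]) simp
qed

text \<open>At a general point \<open>w\<close>, the ratio \<open>c\<^sub>i / c\<^sub>j\<close> is the value of a rational function over \<open>E\<close>. It
  takes the same value at the conjugate points, hence is fixed by the Galois group of \<open>E\<close>.\<close>

lemma monomial_ratio_in_subfield:
  fixes A :: "nat \<Rightarrow> 'a::{alg_closed_field, field_char_0}"
  assumes A: "A 0 \<noteq> 0" "A 1 \<noteq> 0" "A 2 \<noteq> 0" and E: "is_subfield E" "algebraic_extension_of E"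
    and AE: "\<And>i. i \<le> 2 \<Longrightarrow> A i \<in> E"
    and mor: "morphism_over E 2 (quartic A) 2 W \<phi>"
    and \<pi>: "\<pi> permutes {..2}" and c: "\<And>j. j \<le> 2 \<Longrightarrow> c j \<noteq> 0"
    and \<phi>: "\<And>P v. P \<in> quartic A \<Longrightarrow> v \<in> P \<Longrightarrow> \<phi> P = proj_point (monomial_map \<pi> c v)"
    and ij: "i \<le> 2" "j \<le> 2"
  shows "c i / c j \<in> E"
proof -
  obtain P0 where P0: "P0 \<in> quartic A" using two_points_quartic[of A, OF A] by blast
  obtain v0 where v0: "v0 \<in> P0" using proj_space_nonempty[OF subsetD[OF quartic_subset P0]] by blast
  obtain d F where F: "represents A d F \<phi>" and nz: "\<And>v. v \<in> P0 \<Longrightarrow> \<exists>j\<le>2. mpol_eval (F j) v \<noteq> 0"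
    and FE: "\<And>j. j \<le> 2 \<Longrightarrow> F j \<in> forms E 2 d"
    by (rule ex_represents[OF mor P0]) blast
  obtain i0 where i0: "i0 \<le> 2" "mpol_eval (F i0) v0 \<noteq> 0" using nz[OF v0] by blast
  define X where "X = Var 0 * Var 1 * (Var 2 :: 'a mpol)"
  have Xf: "X \<in> forms UNIV 2 (1 + 1 + 1)" unfolding X_def
    by (intro forms_mult[OF is_subfield_UNIV] forms_Var[OF is_subfield_UNIV]) auto
  have "\<not> vanishes A X"
    using on_cone_all_nonzero[of A, OF A] by (auto simp: vanishes_def X_def mpol_eval_mult)
  moreover have "\<not> vanishes A (F i0)" using vanishes_at[OF _ P0 v0] i0(2) by blast
  ultimately have "\<not> vanishes A (F i0 * X)"
    using vanishes_mult[of A, OF A representsD(1)[OF F i0(1)] Xf] by blast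
  then obtain w where w: "on_cone A w" "mpol_eval (F i0) w \<noteq> 0" "w 0 \<noteq> 0" "w 1 \<noteq> 0" "w 2 \<noteq> 0"
    by (auto simp: vanishes_def X_def mpol_eval_mult)
  have formula: "mpol_eval (F j) x * x (\<pi> i) \<noteq> 0 \<and>
      c i / c j = mpol_eval (F i) x * x (\<pi> j) / (mpol_eval (F j) x * x (\<pi> i))"
    if x: "on_cone A x" "mpol_eval (F i0) x \<noteq> 0" "x 0 \<noteq> 0" "x 1 \<noteq> 0" "x 2 \<noteq> 0" for x
  proof -
    define x' where "x' = vec3 (x 0) (x 1) (x 2)"
    have P: "proj_point x' \<in> quartic A" unfolding x'_def using on_cone_trunc[OF x(1)] by (rule quartic_memI) simp
    have ev: "mpol_eval (F l) x' = mpol_eval (F l) x" if "l \<le> 2" for l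
      unfolding x'_def by (rule mpol_eval_trunc[OF FE[OF that]])
    have xl: "x' l = x l" "x l \<noteq> 0" if "l \<le> 2" for l using le_2_cases[OF that] x by (auto simp: x'_def)
    have "(\<lambda>j. if j \<le> 2 then mpol_eval (F j) x' else 0) \<in> proj_point (monomial_map \<pi> c x')"
      using representsD(2)[OF F P proj_point_self i0(1)] ev[OF i0(1)] x(2) \<phi>[OF P proj_point_self] by simp
    then obtain t where t: "t \<noteq> 0" "(\<lambda>j. if j \<le> 2 then mpol_eval (F j) x' else 0) = (\<lambda>j. t * monomial_map \<pi> c x' j)"
      by (auto simp: proj_point_mem_iff)
    have pl: "\<pi> l \<le> 2" if "l \<le> 2" for l using permutes_in_image[OF \<pi>, of l] that by simp
    have Fl: "mpol_eval (F l) x = t * (c l * x (\<pi> l))" if "l \<le> 2" for l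
      using fun_cong[OF t(2), of l] that ev[OF that] xl(1)[OF pl[OF that]] by (simp add: monomial_map_def)
    show ?thesis
      using Fl[OF ij(1)] Fl[OF ij(2)] t(1) c[OF ij(1)] c[OF ij(2)] xl(2)[OF pl[OF ij(1)]] xl(2)[OF pl[OF ij(2)]]
      by (simp add: field_simps)
  qed
  show ?thesis
  proof (rule fixed_field_of_galois_group[OF E])
    fix \<sigma> assume \<sigma>: "\<sigma> \<in> galois_group E"
    note s = galois_group_props[OF \<sigma>]
    have conj: "mpol_eval (F l) (\<sigma> \<circ> w) = \<sigma> (mpol_eval (F l) w)" if "l \<le> 2" for l
    proof -
      have "map_coeffs \<sigma> (F l) = F l"
        using FE[OF that] s(4,5) by (intro map_coeffs_fixed) (auto simp: forms_iff)
      then show ?thesis using galois_mpol_eval[OF \<sigma>, of "F l" w] by simp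
    qed
    have "\<sigma> (A 0 * w 0 ^ 4 + A 1 * w 1 ^ 4 + A 2 * w 2 ^ 4) = 0" using w(1) s(5) by (simp add: on_cone_iff)
    then have "on_cone A (\<sigma> \<circ> w)" using w(3) AE by (simp add: on_cone_iff s)
    then have "c i / c j = mpol_eval (F i) (\<sigma> \<circ> w) * (\<sigma> \<circ> w) (\<pi> j) / (mpol_eval (F j) (\<sigma> \<circ> w) * (\<sigma> \<circ> w) (\<pi> i))"
      using formula[of "\<sigma> \<circ> w"] conj[OF i0(1)] w s(7) by simp
    also have "\<dots> = \<sigma> (mpol_eval (F i) w * w (\<pi> j) / (mpol_eval (F j) w * w (\<pi> i)))"
      using conj[OF ij(1)] conj[OF ij(2)] by (simp add: s)
    also have "\<dots> = \<sigma> (c i / c j)" using formula[OF w] by simp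
    finally show "\<sigma> (c i / c j) = c i / c j" by simp
  qed
qed

text \<open>The pullback of the equation of the target vanishes on the source, hence is proportional to the
  equation of the source. Points with a zero coordinate suffice to see this.\<close>

lemma monomial_isomorphism_coefficients:
  fixes A A' :: "nat \<Rightarrow> 'a::{alg_closed_field, field_char_0}"
  assumes A: "A 0 \<noteq> 0" "A 1 \<noteq> 0" "A 2 \<noteq> 0" and A': "A' 0 \<noteq> 0" "A' 1 \<noteq> 0" "A' 2 \<noteq> 0"
    and im: "\<phi> ` quartic A \<subseteq> quartic A'"
    and \<pi>: "\<pi> permutes {..2}" and c: "\<And>j. j \<le> 2 \<Longrightarrow> c j \<noteq> 0"
    and \<phi>: "\<And>P v. P \<in> quartic A \<Longrightarrow> v \<in> P \<Longrightarrow> \<phi> P = proj_point (monomial_map \<pi> c v)"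
  shows "\<exists>\<mu>. \<mu> \<noteq> 0 \<and> (\<forall>j\<le>2. A' j * c j ^ 4 = \<mu> * A (\<pi> j))"
proof -
  define B where "B l = A' (inv \<pi> l) * c (inv \<pi> l) ^ 4" for l
  have B: "B (\<pi> j) = A' j * c j ^ 4" for j using permutes_inverses(2)[OF \<pi>, of j] by (simp add: B_def)
  have zero: "B 0 * v 0 ^ 4 + B 1 * v 1 ^ 4 + B 2 * v 2 ^ 4 = 0"
    if v: "on_cone A v" "\<And>i. i > 2 \<Longrightarrow> v i = 0" for v
  proof -
    have P: "proj_point v \<in> quartic A" by (rule quartic_memI[OF v])
    have "proj_point (monomial_map \<pi> c v) \<in> quartic A'" using im P \<phi>[OF P proj_point_self] by auto
    then have "on_cone A' (monomial_map \<pi> c v)" using quartic_memD proj_point_self by blast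
    then have "B (\<pi> 0) * v (\<pi> 0) ^ 4 + B (\<pi> 1) * v (\<pi> 1) ^ 4 + B (\<pi> 2) * v (\<pi> 2) ^ 4 = 0"
      unfolding B by (simp add: on_cone_iff monomial_map_def power_mult_distrib mult_ac)
    then show ?thesis using sum_permutes_2[OF \<pi>, of "\<lambda>l. B l * v l ^ 4"] by simp
  qed
  obtain \<zeta> where \<zeta>: "\<zeta> ^ 4 = - A 1 / A 0" using nth_root_exists[of 4 "- A 1 / A 0"] by auto
  obtain \<eta> where \<eta>: "\<eta> ^ 4 = - A 2 / A 0" using nth_root_exists[of 4 "- A 2 / A 0"] by auto
  have "on_cone A (vec3 \<zeta> 1 0)" "on_cone A (vec3 \<eta> 0 1)" using A by (simp_all add: on_cone_iff \<zeta> \<eta>)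
  then have e: "B 0 * \<zeta> ^ 4 + B 1 = 0" "B 0 * \<eta> ^ 4 + B 2 = 0"
    using zero[of "vec3 \<zeta> 1 0"] zero[of "vec3 \<eta> 0 1"] by simp_all
  define \<mu> where "\<mu> = B 0 / A 0"
  have m: "B 0 = \<mu> * A 0" "B 1 = \<mu> * A 1" "B 2 = \<mu> * A 2"
    using e A unfolding \<zeta> \<eta> by (simp_all add: \<mu>_def field_simps add_eq_0_iff2)
  have "B l = \<mu> * A l" if "l \<le> 2" for l using le_2_cases[OF that] m by auto
  then have "A' j * c j ^ 4 = \<mu> * A (\<pi> j)" if "j \<le> 2" for j
    using permutes_in_image[OF \<pi>, of j] that B[of j] by simp
  moreover from this[of 0] have "\<mu> \<noteq> 0" using A'(1) c[of 0] by auto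
  ultimately show ?thesis by blast
qed

text \<open>After normalizing \<open>c\<^sub>2 = 1\<close>, the entries of the matrix are ratios and so belong to \<open>E\<close>.\<close>

theorem isomorphic_over_quartic_iff:
  fixes A A' :: "nat \<Rightarrow> 'a::{alg_closed_field, field_char_0}"
  assumes A: "A 0 \<noteq> 0" "A 1 \<noteq> 0" "A 2 \<noteq> 0" and A': "A' 0 \<noteq> 0" "A' 1 \<noteq> 0" "A' 2 \<noteq> 0"
    and E: "is_subfield E" "algebraic_extension_of E" "\<And>i. i \<le> 2 \<Longrightarrow> A i \<in> E" "\<And>i. i \<le> 2 \<Longrightarrow> A' i \<in> E"
  shows "isomorphic_over E 2 (quartic A) 2 (quartic A') \<longleftrightarrow>
    (\<exists>\<pi> c \<mu>. \<pi> permutes {..2} \<and> \<mu> \<in> E - {0} \<and> (\<forall>j\<le>2. c j \<in> E - {0} \<and> A' j * c j ^ 4 = \<mu> * A (\<pi> j)))"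
proof
  assume "isomorphic_over E 2 (quartic A) 2 (quartic A')"
  then obtain \<phi> where \<phi>: "isomorphism_over E 2 (quartic A) 2 (quartic A') \<phi>" by (auto simp: isomorphic_over_def)
  then have "isomorphism_over UNIV 2 (quartic A) 2 (quartic A') \<phi>" by (rule isomorphism_over_mono) simp
  then obtain \<pi> c where \<pi>: "\<pi> permutes {..2}" and c: "\<forall>j\<le>2. c j \<noteq> 0"
    and mono: "\<forall>P\<in>quartic A. \<forall>v\<in>P. \<phi> P = proj_point (monomial_map \<pi> c v)"
    using isomorphism_is_monomial[of A A' \<phi>, OF A A'] by blast
  have mor: "morphism_over E 2 (quartic A) 2 (quartic A') \<phi>" using \<phi> by (simp add: isomorphism_over_def)
  have im: "\<phi> ` quartic A \<subseteq> quartic A'" using mor by (simp add: morphism_over_def)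
  define c' where "c' j = c j / c 2" for j
  have c'E: "c' j \<in> E" if "j \<le> 2" for j
    unfolding c'_def
    by (rule monomial_ratio_in_subfield[of A E "quartic A'" \<phi> \<pi> c, OF A E(1,2,3) mor \<pi>]) (use c mono that in auto)
  have c'0: "c' j \<noteq> 0" if "j \<le> 2" for j using c that by (simp add: c'_def)
  have "\<phi> P = proj_point (monomial_map \<pi> c' v)" if "P \<in> quartic A" "v \<in> P" for P v
    using monomial_map_scale(2)[of "inverse (c 2)" \<pi> c v] c mono that by (simp add: c'_def[abs_def] field_simps)
  from monomial_isomorphism_coefficients[of A A' \<phi> \<pi> c', OF A A' im \<pi> c'0 this]
  obtain \<mu> where \<mu>: "\<mu> \<noteq> 0" "\<forall>j\<le>2. A' j * c' j ^ 4 = \<mu> * A (\<pi> j)" by blast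
  have p2: "\<pi> 2 \<le> 2" using permutes_in_image[OF \<pi>, of 2] by simp
  have "A (\<pi> 2) \<noteq> 0" using le_2_cases[OF p2] A by auto
  moreover have "A' 2 = \<mu> * A (\<pi> 2)" using \<mu>(2)[rule_format, of 2] c by (simp add: c'_def)
  ultimately have "\<mu> = A' 2 / A (\<pi> 2)" by simp
  then have "\<mu> \<in> E" using subfield_closed(8)[OF E(1)] E(3)[OF p2] E(4)[of 2] by simp
  then show "\<exists>\<pi> c \<mu>. \<pi> permutes {..2} \<and> \<mu> \<in> E - {0} \<and> (\<forall>j\<le>2. c j \<in> E - {0} \<and> A' j * c j ^ 4 = \<mu> * A (\<pi> j))"
    using \<pi> \<mu> c'E c'0 by (intro exI[of _ \<pi>] exI[of _ c'] exI[of _ \<mu>]) simp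
next
  assume "\<exists>\<pi> c \<mu>. \<pi> permutes {..2} \<and> \<mu> \<in> E - {0} \<and> (\<forall>j\<le>2. c j \<in> E - {0} \<and> A' j * c j ^ 4 = \<mu> * A (\<pi> j))"
  then obtain \<pi> c \<mu> where *: "\<pi> permutes {..2}" "\<mu> \<noteq> 0" "\<And>j. j \<le> 2 \<Longrightarrow> c j \<in> E" "\<And>j. j \<le> 2 \<Longrightarrow> c j \<noteq> 0"
    "\<And>j. j \<le> 2 \<Longrightarrow> A' j * c j ^ 4 = \<mu> * A (\<pi> j)" by auto
  define \<phi> where "\<phi> P = proj_point (monomial_map \<pi> c (SOME v. v \<in> P))" for P
  have "\<phi> P = proj_point (monomial_map \<pi> c v)" if "P \<in> quartic A" "v \<in> P" for P v
  proof -
    have "(SOME w. w \<in> P) \<in> proj_point v"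
      using proj_spaceD(1)[OF subsetD[OF quartic_subset that(1)] that(2)] that(2) by (metis someI)
    then obtain t where "t \<noteq> 0" "(SOME w. w \<in> P) = (\<lambda>i. t * v i)" by (auto simp: proj_point_mem_iff)
    then show ?thesis unfolding \<phi>_def using monomial_map_scale(1) by metis
  qed
  from isomorphism_over_monomial[of E c \<pi> \<mu> A' A \<phi>, OF E(1) *(3,4,1,2,5) this]
  show "isomorphic_over E 2 (quartic A) 2 (quartic A')" by (auto simp: isomorphic_over_def)
qed


section \<open>Diagonal maps and cocycles\<close>

definition diag_map :: "(nat \<Rightarrow> 'a::field) \<Rightarrow> 'a ppoint \<Rightarrow> 'a ppoint" where
  "diag_map m P = (\<lambda>v i. m i * v i) ` P"

lemma diag_map_proj_point: "diag_map m (proj_point v) = proj_point (\<lambda>i. m i * v i)"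
  unfolding diag_map_def proj_point_def by (auto simp: image_def fun_eq_iff mult_ac)

lemma diag_map_monomial:
  assumes "P \<in> proj_space 2" "v \<in> P"
  shows "diag_map m P = proj_point (monomial_map (\<lambda>i. i) m v)"
proof -
  have "(\<lambda>i. m i * v i) = monomial_map (\<lambda>i. i) m v"
    using proj_spaceD(3)[OF assms] by (auto simp: monomial_map_def fun_eq_iff)
  then show ?thesis using diag_map_proj_point[of m v] proj_spaceD(1)[OF assms] by simp
qed

lemma diag_map_isomorphism:
  fixes E :: "'a::field set"
  assumes "is_subfield E" "\<And>j. j \<le> 2 \<Longrightarrow> m j \<in> E" "\<And>j. j \<le> 2 \<Longrightarrow> m j \<noteq> 0"
    and "\<And>j. j \<le> 2 \<Longrightarrow> A' j * m j ^ 4 = A j"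
  shows "isomorphism_over E 2 (quartic A) 2 (quartic A') (diag_map m)"
proof (rule isomorphism_over_monomial[of E m "\<lambda>i. i" 1])
  show "(\<lambda>i. i) permutes {..2::nat}" using permutes_id unfolding id_def .
  show "diag_map m P = proj_point (monomial_map (\<lambda>i. i) m v)" if "P \<in> quartic A" "v \<in> P" for P v
    by (rule diag_map_monomial[OF subsetD[OF quartic_subset that(1)] that(2)])
qed (use assms in auto)

text \<open>The cocycle in a form without inverse maps: \<open>\<xi>\<^sub>\<sigma>\<close> takes the conjugate of \<open>\<phi>(R)\<close> to \<open>\<phi>\<close> of the
  conjugate of \<open>R\<close>.\<close>

lemma twist_cocycle_eq:
  assumes \<sigma>: "\<sigma> \<in> galois_group k" and bij: "bij_betw \<phi> V W"
    and V: "\<And>\<tau> P. \<tau> \<in> galois_group k \<Longrightarrow> P \<in> V \<Longrightarrow> galois_point \<tau> P \<in> V"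
  shows "R \<in> V \<Longrightarrow> twist_cocycle V \<phi> \<sigma> (galois_point \<sigma> (\<phi> R)) = \<phi> (galois_point \<sigma> R)"
proof -
  assume R: "R \<in> V"
  have gm: "galois_map \<sigma> \<phi> (galois_point \<sigma> R) = galois_point \<sigma> (\<phi> R)" for R
    by (simp add: galois_map_def galois_point_inv[OF \<sigma>])
  have "inj_on (galois_map \<sigma> \<phi>) V"
  proof (rule inj_onI)
    fix P Q assume PQ: "P \<in> V" "Q \<in> V" "galois_map \<sigma> \<phi> P = galois_map \<sigma> \<phi> Q"
    let ?P = "galois_point (inv \<sigma>) P" and ?Q = "galois_point (inv \<sigma>) Q"
    have "\<phi> ?P = \<phi> ?Q"
      using PQ(3) galois_point_inv(2)[OF \<sigma>] unfolding galois_map_def by metis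
    then have "?P = ?Q"
      using bij_betw_imp_inj_on[OF bij] V[OF galois_group_inv(1)[OF \<sigma>]] PQ by (auto dest: inj_onD)
    then show "P = Q" using galois_point_inv(1)[OF \<sigma>] by metis
  qed
  then have "inv_into V (galois_map \<sigma> \<phi>) (galois_point \<sigma> (\<phi> R)) = galois_point \<sigma> R"
    unfolding gm[symmetric] using V[OF \<sigma> R] by (rule inv_into_f_f)
  then show "twist_cocycle V \<phi> \<sigma> (galois_point \<sigma> (\<phi> R)) = \<phi> (galois_point \<sigma> R)"
    by (simp add: twist_cocycle_def)
qed

lemma galois_point_quartic:
  assumes "\<sigma> \<in> galois_group k" "is_subfield k" "\<And>i. i \<le> 2 \<Longrightarrow> A i \<in> k" "P \<in> quartic A"
  shows "galois_point \<sigma> P \<in> quartic A"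
  using proj_closed_galois[OF proj_closed_quartic[of k A, OF assms(2,3)] assms(1,4)] .

lemma field_adjoin_subfield: "is_subfield (field_adjoin k S)"
  unfolding is_subfield_def field_adjoin_def by auto

lemma field_adjoin_subset: "k \<subseteq> field_adjoin k S" "S \<subseteq> field_adjoin k S"
  by (auto simp: field_adjoin_def)

lemma field_adjoin_least: "is_subfield E \<Longrightarrow> k \<subseteq> E \<Longrightarrow> S \<subseteq> E \<Longrightarrow> field_adjoin k S \<subseteq> E"
  by (auto simp: field_adjoin_def)

lemma fourth_root_cases:
  fixes x y :: "'a::field"
  assumes "x ^ 4 = y ^ 4" "\<iota>\<^sup>2 = -1"
  shows "x = y \<or> x = - y \<or> x = \<iota> * y \<or> x = - (\<iota> * y)"
proof -
  have "(x - y) * (x + y) * ((x - \<iota> * y) * (x + \<iota> * y)) = 0" using assms by algebra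
  then show ?thesis by (auto simp: eq_neg_iff_add_eq_0)
qed

lemma fourth_root_in_subfield:
  fixes x y :: "'a::field"
  assumes "is_subfield E" "\<iota> \<in> E" "\<iota>\<^sup>2 = -1" "x ^ 4 = y ^ 4" "y \<in> E"
  shows "x \<in> E"
  using fourth_root_cases[OF assms(4,3)] subfield_closed(4,6)[OF assms(1)] assms(2,5) by auto


section \<open>Diagonal quartics are diagonal twists\<close>

text \<open>The matrix \<open>diag(\<alpha>, \<beta>, 1)\<close> with \<open>\<alpha>\<^sup>4 = a\<close> and \<open>\<beta>\<^sup>4 = b\<close> defines an isomorphism to the Fermat quartic,
  and its quotient by a conjugate is diagonal again.\<close>

lemma diagonal_quartic_is_diagonal_twist:
  fixes k :: "'a::{alg_closed_field, field_char_0} set"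
  assumes k: "is_subfield k" and ab: "a \<in> k - {0}" "b \<in> k - {0}"
  shows "is_diagonal_twist k 2 (diagonal_quartic a b)"
proof -
  define A where "A = vec3 a b (1::'a)"
  have A: "A 0 \<noteq> 0" "A 1 \<noteq> 0" "A 2 \<noteq> 0" using ab by (auto simp: A_def)
  have Ak: "A i \<in> k" if "i \<le> 2" for i
    using ab subfield_closed(2)[OF k] le_2_cases[OF that] by (auto simp: A_def)
  obtain \<alpha> where \<alpha>: "\<alpha> ^ 4 = a" using nth_root_exists[of 4 a] by auto
  obtain \<beta> where \<beta>: "\<beta> ^ 4 = b" using nth_root_exists[of 4 b] by auto
  define m where "m = vec3 \<alpha> \<beta> (1::'a)"
  have m0: "m j \<noteq> 0" if "j \<le> 2" for j using le_2_cases[OF that] \<alpha> \<beta> ab by (auto simp: m_def)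
  have m4: "1 * m j ^ 4 = A j" if "j \<le> 2" for j using le_2_cases[OF that] \<alpha> \<beta> by (auto simp: m_def A_def)
  have iso: "isomorphism_over UNIV 2 (quartic A) 2 (quartic (\<lambda>_. 1)) (diag_map m)"
    by (rule diag_map_isomorphism[OF is_subfield_UNIV UNIV_I m0 m4])
  have "smooth_projective_curve k 2 (quartic A)"
    by (rule smooth_projective_curve_quartic[of A, OF A k Ak])
  then have twist: "is_twist k 2 (quartic A) 2 (quartic (\<lambda>_. 1))"
    using iso by (auto simp: is_twist_def isomorphic_over_def)
  have bij: "bij_betw (diag_map m) (quartic A) (quartic (\<lambda>_. 1))" using iso by (simp add: isomorphism_over_def)
  have "given_by_diagonal_matrix 2 (quartic (\<lambda>_. 1)) (twist_cocycle (quartic A) (diag_map m) \<sigma>)"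
    if \<sigma>: "\<sigma> \<in> galois_group k" for \<sigma>
    unfolding given_by_diagonal_matrix_def
  proof (intro exI[of _ "\<lambda>i. m i / \<sigma> (m i)"] conjI allI impI ballI)
    note s = galois_group_props[OF \<sigma>]
    show "m i / \<sigma> (m i) \<noteq> 0" if "i \<le> 2" for i using m0[OF that] s(7) by simp
    fix P :: "'a ppoint" assume P: "P \<in> quartic (\<lambda>_. 1)"
    have one: "(1::'a) \<in> k" by (rule subfield_closed(2)[OF k])
    have "galois_point (inv \<sigma>) P \<in> quartic (\<lambda>_. 1)"
      by (rule galois_point_quartic[OF galois_group_inv(1)[OF \<sigma>] k one P])
    then have "galois_point (inv \<sigma>) P \<in> diag_map m ` quartic A" using bij by (simp add: bij_betw_def)
    then obtain R where R: "R \<in> quartic A" "galois_point (inv \<sigma>) P = diag_map m R" by blast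
    then have P_eq: "P = galois_point \<sigma> (diag_map m R)" using galois_point_inv(1)[OF \<sigma>] by metis
    obtain v where v: "v \<in> R" using proj_space_nonempty[OF subsetD[OF quartic_subset R(1)]] by blast
    have Rv: "R = proj_point v" using proj_spaceD(1)[OF subsetD[OF quartic_subset R(1)] v] .
    have "twist_cocycle (quartic A) (diag_map m) \<sigma> P = diag_map m (galois_point \<sigma> R)"
      unfolding P_eq by (rule twist_cocycle_eq[OF \<sigma> bij galois_point_quartic[OF _ k Ak] R(1)])
    also have "\<dots> = proj_point (\<lambda>i. m i * \<sigma> (v i))"
      by (simp add: Rv galois_point_proj_point[OF \<sigma>] diag_map_proj_point)
    also have "(\<lambda>i. m i * \<sigma> (v i)) = (\<lambda>i. m i / \<sigma> (m i) * \<sigma> (m i * v i))"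
    proof
      fix i
      have "\<sigma> (m i) = 0 \<longleftrightarrow> m i = 0" by (rule s(7))
      then show "m i * \<sigma> (v i) = m i / \<sigma> (m i) * \<sigma> (m i * v i)" by (auto simp: s)
    qed
    also have "proj_point \<dots> = diag_map (\<lambda>i. m i / \<sigma> (m i)) (galois_point \<sigma> (diag_map m R))"
      by (simp add: Rv galois_point_proj_point[OF \<sigma>] diag_map_proj_point)
    finally show "twist_cocycle (quartic A) (diag_map m) \<sigma> P = (\<lambda>v i. m i / \<sigma> (m i) * v i) ` P"
      unfolding P_eq diag_map_def .
  qed
  then show ?thesis
    unfolding is_diagonal_twist_def fermat_quartic_eq diagonal_quartic_eq A_def[symmetric]
    using twist iso by blast
qed

text \<open>All automorphisms of the Fermat quartic are monomial with fourth roots of unity as entries, and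
  \<open>diag(\<iota>, 1, 1)\<close> is one of them.\<close>

lemma automorphism_field_fermat:
  fixes k :: "'a::{alg_closed_field, field_char_0} set"
  assumes k: "is_subfield k" "algebraic_extension_of k" and \<iota>: "\<iota>\<^sup>2 = -1"
  shows "is_automorphism_field k 2 fermat_quartic (field_adjoin k {\<iota>})"
  unfolding is_automorphism_field_def is_least_set_def fermat_quartic_eq
proof (intro conjI ballI)
  define I where "I = (\<lambda>_::nat. 1::'a)"
  have I: "I 0 \<noteq> 0" "I 1 \<noteq> 0" "I 2 \<noteq> 0" by (simp_all add: I_def)
  let ?K = "field_adjoin k {\<iota>}"
  have K: "is_subfield ?K" "k \<subseteq> ?K" "\<iota> \<in> ?K"
    using field_adjoin_subfield field_adjoin_subset by blast+
  have "isomorphism_over ?K 2 (quartic I) 2 (quartic I) \<phi>"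
    if iso: "isomorphism_over UNIV 2 (quartic I) 2 (quartic I) \<phi>" for \<phi>
  proof -
    obtain \<pi> c where \<pi>: "\<pi> permutes {..2}" and c: "\<forall>j\<le>2. c j \<noteq> 0"
      and mono: "\<forall>P\<in>quartic I. \<forall>v\<in>P. \<phi> P = proj_point (monomial_map \<pi> c v)"
      using isomorphism_is_monomial[of I I \<phi>, OF I I iso] by blast
    have im: "\<phi> ` quartic I \<subseteq> quartic I" using iso by (simp add: isomorphism_over_def morphism_over_def)
    obtain \<mu> where \<mu>: "\<mu> \<noteq> 0" "\<forall>j\<le>2. I j * c j ^ 4 = \<mu> * I (\<pi> j)"
      using monomial_isomorphism_coefficients[of I I \<phi> \<pi> c, OF I I im \<pi>] c mono by blast
    define c' where "c' j = c j / c 2" for j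
    have c'4: "c' j ^ 4 = 1 ^ 4" if "j \<le> 2" for j
      using \<mu> that by (simp add: c'_def I_def power_divide)
    have c'K: "c' j \<in> ?K" if "j \<le> 2" for j
      by (rule fourth_root_in_subfield[OF K(1,3) \<iota> c'4[OF that]]) (rule subfield_closed(2)[OF K(1)])
    have "\<phi> P = proj_point (monomial_map \<pi> c' v)" if "P \<in> quartic I" "v \<in> P" for P v
      using monomial_map_scale(2)[of "inverse (c 2)" \<pi> c v] c mono that by (simp add: c'_def[abs_def] field_simps)
    then show ?thesis
      using c'4 c'K c \<pi> K(1) by (intro isomorphism_over_monomial[of ?K c' \<pi> 1]) (auto simp: I_def c'_def)
  qed
  then show "?K \<in> {E. is_subfield E \<and> k \<subseteq> E \<and> (\<forall>\<alpha>. isomorphism_over UNIV 2 (quartic (\<lambda>_. 1)) 2 (quartic (\<lambda>_. 1)) \<alpha> \<longrightarrow>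
      isomorphism_over E 2 (quartic (\<lambda>_. 1)) 2 (quartic (\<lambda>_. 1)) \<alpha>)}"
    using K unfolding I_def by blast
next
  fix E assume "E \<in> {E. is_subfield E \<and> k \<subseteq> E \<and> (\<forall>\<alpha>. isomorphism_over UNIV 2 (quartic (\<lambda>_. 1)) 2 (quartic (\<lambda>_. 1)) \<alpha> \<longrightarrow>
      isomorphism_over E 2 (quartic (\<lambda>_. 1)) 2 (quartic (\<lambda>_. 1)) \<alpha>)}"
  then have E: "is_subfield E" "k \<subseteq> E" and all: "\<And>\<alpha>. isomorphism_over UNIV 2 (quartic (\<lambda>_. 1)) 2 (quartic (\<lambda>_. 1)) \<alpha> \<Longrightarrow>
      isomorphism_over E 2 (quartic (\<lambda>_. 1)) 2 (quartic (\<lambda>_. 1)) \<alpha>" by auto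
  define m where "m = vec3 \<iota> 1 (1::'a)"
  have "\<iota> ^ 4 = 1" using \<iota> power_mult[of \<iota> 2 2] by simp
  then have m4: "1 * m j ^ 4 = 1" if "j \<le> 2" for j using le_2_cases[OF that] by (auto simp: m_def)
  then have m0: "m j \<noteq> 0" if "j \<le> 2" for j using that by fastforce
  have "isomorphism_over UNIV 2 (quartic (\<lambda>_. 1)) 2 (quartic (\<lambda>_. 1)) (diag_map m)"
    by (rule diag_map_isomorphism[OF is_subfield_UNIV UNIV_I m0 m4])
  then have mor: "morphism_over E 2 (quartic (\<lambda>_. 1)) 2 (quartic (\<lambda>_. 1)) (diag_map m)"
    using all by (simp add: isomorphism_over_def)
  have "m 0 / m 2 \<in> E"
  proof (rule monomial_ratio_in_subfield[of "\<lambda>_. 1" E "quartic (\<lambda>_. 1)" "diag_map m" "\<lambda>i. i" m])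
    show "algebraic_extension_of E" by (rule algebraic_extension_of_mono[OF k(2) E(2)])
    show "(\<lambda>i. i) permutes {..2::nat}" using permutes_id unfolding id_def .
    show "diag_map m P = proj_point (monomial_map (\<lambda>i. i) m v)" if "P \<in> quartic (\<lambda>_. 1)" "v \<in> P" for P v
      by (rule diag_map_monomial[OF subsetD[OF quartic_subset that(1)] that(2)])
  qed (use E(1) subfield_closed(2)[OF E(1)] mor m0 in auto)
  then have "\<iota> \<in> E" by (simp add: m_def)
  then show "field_adjoin k {\<iota>} \<subseteq> E" using field_adjoin_least[OF E] by blast
qed

text \<open>An isomorphism to the Fermat quartic over \<open>E\<close> is monomial, and \<open>a\<close> and \<open>b\<close> are fourth powers of ratios
  of its entries. As \<open>\<iota> \<in> E\<close>, all fourth roots of \<open>a\<close> and \<open>b\<close> are in \<open>E\<close>.\<close>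

lemma field_of_definition_diagonal_quartic:
  fixes k :: "'a::{alg_closed_field, field_char_0} set"
  assumes k: "is_subfield k" "algebraic_extension_of k" and ab: "a \<in> k - {0}" "b \<in> k - {0}"
    and roots: "\<iota>\<^sup>2 = -1" "\<alpha> ^ 4 = a" "\<beta> ^ 4 = b"
  shows "is_field_of_definition k 2 (diagonal_quartic a b) 2 fermat_quartic (field_adjoin k {\<iota>, \<alpha>, \<beta>})"
  unfolding is_field_of_definition_def is_least_set_def
proof (intro exI[of _ "field_adjoin k {\<iota>}"] conjI ballI)
  show "is_automorphism_field k 2 fermat_quartic (field_adjoin k {\<iota>})"
    by (rule automorphism_field_fermat[OF k roots(1)])
  define A where "A = vec3 a b (1::'a)"
  define I where "I = (\<lambda>_::nat. 1::'a)"
  have A: "A 0 \<noteq> 0" "A 1 \<noteq> 0" "A 2 \<noteq> 0" using ab by (auto simp: A_def)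
  have I: "I 0 \<noteq> 0" "I 1 \<noteq> 0" "I 2 \<noteq> 0" by (simp_all add: I_def)
  let ?L = "field_adjoin k {\<iota>, \<alpha>, \<beta>}"
  have L: "is_subfield ?L" "k \<subseteq> ?L" "\<iota> \<in> ?L" "\<alpha> \<in> ?L" "\<beta> \<in> ?L"
    using field_adjoin_subfield[of k "{\<iota>, \<alpha>, \<beta>}"] field_adjoin_subset(1)[of k "{\<iota>, \<alpha>, \<beta>}"]
      field_adjoin_subset(2)[of "{\<iota>, \<alpha>, \<beta>}" k] by simp_all
  define m where "m = vec3 \<alpha> \<beta> (1::'a)"
  have mL: "m j \<in> ?L" if "j \<le> 2" for j
    using le_2_cases[OF that] L subfield_closed(2)[OF L(1)] by (auto simp: m_def)
  have m0: "m j \<noteq> 0" if "j \<le> 2" for j using le_2_cases[OF that] roots ab by (auto simp: m_def)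
  have m4: "I j * m j ^ 4 = A j" if "j \<le> 2" for j using le_2_cases[OF that] roots by (auto simp: m_def A_def I_def)
  have "isomorphism_over ?L 2 (quartic A) 2 (quartic I) (diag_map m)"
    by (rule diag_map_isomorphism[OF L(1) mL m0 m4])
  then show "?L \<in> {E. is_subfield E \<and> field_adjoin k {\<iota>} \<subseteq> E \<and> isomorphic_over E 2 (diagonal_quartic a b) 2 fermat_quartic}"
    unfolding diagonal_quartic_eq fermat_quartic_eq A_def[symmetric] I_def[symmetric]
    using L field_adjoin_least[OF L(1,2), of "{\<iota>}"] by (auto simp: isomorphic_over_def)
  fix E assume "E \<in> {E. is_subfield E \<and> field_adjoin k {\<iota>} \<subseteq> E \<and> isomorphic_over E 2 (diagonal_quartic a b) 2 fermat_quartic}"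
  then have E: "is_subfield E" "field_adjoin k {\<iota>} \<subseteq> E" and iso: "isomorphic_over E 2 (quartic A) 2 (quartic I)"
    unfolding diagonal_quartic_eq fermat_quartic_eq A_def[symmetric] I_def[symmetric] by auto
  have kE: "k \<subseteq> E" "\<iota> \<in> E" using field_adjoin_subset(1)[of k "{\<iota>}"] field_adjoin_subset(2)[of "{\<iota>}" k] E(2) by auto
  have AE: "A i \<in> E" "I i \<in> E" if "i \<le> 2" for i
    using le_2_cases[OF that] ab kE subfield_closed(2)[OF E(1)] by (auto simp: A_def I_def)
  from iffD1[OF isomorphic_over_quartic_iff[of A I E, OF A I E(1) algebraic_extension_of_mono[OF k(2) kE(1)] AE] iso]
  obtain \<pi> c \<mu> where "\<pi> permutes {..2} \<and> \<mu> \<in> E - {0} \<and> (\<forall>j\<le>2. c j \<in> E - {0} \<and> I j * c j ^ 4 = \<mu> * A (\<pi> j))"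
    by blast
  then have \<pi>: "\<pi> permutes {..2}" and \<mu>: "\<mu> \<noteq> 0" and c: "\<And>j. j \<le> 2 \<Longrightarrow> c j \<in> E - {0}"
    and eq: "\<And>j. j \<le> 2 \<Longrightarrow> I j * c j ^ 4 = \<mu> * A (\<pi> j)"
    by simp_all
  obtain j where j: "j \<le> 2" "\<pi> j = 2" using permutes_image[OF \<pi>] by (metis atMost_iff imageE order.refl)
  have root: "x \<in> E" if i: "i \<le> 2" and x: "x ^ 4 = A i" for i x
  proof -
    obtain l where l: "l \<le> 2" "\<pi> l = i" using permutes_image[OF \<pi>] i by (metis atMost_iff imageE)
    have cl: "c l / c j \<in> E" using subfield_closed(8)[OF E(1)] c[OF l(1)] c[OF j(1)] by blast
    have "c j ^ 4 = \<mu>" "c l ^ 4 = \<mu> * x ^ 4" using eq[OF j(1)] eq[OF l(1)] j(2) l(2) x by (simp_all add: I_def A_def)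
    then have "x ^ 4 = (c l / c j) ^ 4" using \<mu> by (simp add: power_divide)
    then show ?thesis by (rule fourth_root_in_subfield[OF E(1) kE(2) roots(1) _ cl])
  qed
  have "\<alpha> \<in> E" "\<beta> \<in> E" using root[of 0 \<alpha>] root[of 1 \<beta>] roots by (simp_all add: A_def)
  then show "?L \<subseteq> E" using field_adjoin_least[OF E(1) kE(1)] kE(2) by simp
qed

text \<open>The permutation and the entries of a monomial isomorphism are exactly the data of a congruence
  modulo fourth powers, with \<open>m = 1 / \<mu>\<close>.\<close>

lemma diagonal_quartics_isomorphic_iff:
  fixes k :: "'a::{alg_closed_field, field_char_0} set"
  assumes k: "is_subfield k" "algebraic_extension_of k" and ab: "a \<in> k - {0}" "b \<in> k - {0}"
    and ab': "a' \<in> k - {0}" "b' \<in> k - {0}"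
  shows "isomorphic_over k 2 (diagonal_quartic a b) 2 (diagonal_quartic a' b') \<longleftrightarrow>
    (\<exists>m\<in>k - {0}. congruent_mod_fourth_powers k [a, b, 1] [m * a', m * b', m])"
proof -
  define A A' where "A = vec3 a b (1::'a)" and "A' = vec3 a' b' (1::'a)"
  have A: "A 0 \<noteq> 0" "A 1 \<noteq> 0" "A 2 \<noteq> 0" using ab by (auto simp: A_def)
  have A': "A' 0 \<noteq> 0" "A' 1 \<noteq> 0" "A' 2 \<noteq> 0" using ab' by (auto simp: A'_def)
  have Ak: "A i \<in> k" "A' i \<in> k" if "i \<le> 2" for i
    using le_2_cases[OF that] ab ab' subfield_closed(2)[OF k(1)] by (auto simp: A_def A'_def)
  have set: "{..<3::nat} = {..2}" and lt: "i < 3 \<longleftrightarrow> i \<le> 2" for i :: nat by auto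
  have nth: "[a, b, 1] ! i = A i" "[m * a', m * b', m] ! i = m * A' i" if "i \<le> 2" for i m
    using le_2_cases[OF that] by (auto simp: A_def A'_def)
  have inv: "\<mu> \<in> k - {0} \<Longrightarrow> inverse \<mu> \<in> k - {0}" for \<mu> using subfield_closed(5)[OF k(1)] by auto
  have "congruent_mod_fourth_powers k [a, b, 1] [m * a', m * b', m] \<longleftrightarrow>
      (\<exists>\<pi> c. \<pi> permutes {..2} \<and> (\<forall>j\<le>2. c j \<in> k - {0} \<and> A' j * c j ^ 4 = inverse m * A (\<pi> j)))"
    if "m \<in> k - {0}" for m
  proof -
    have "congruent_mod_fourth_powers k [a, b, 1] [m * a', m * b', m] \<longleftrightarrow>
      (\<exists>\<pi>. \<pi> permutes {..2} \<and> (\<forall>j\<le>2. \<exists>c\<in>k - {0}. A (\<pi> j) = c ^ 4 * (m * A' j)))"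
      unfolding congruent_mod_fourth_powers_def set lt
      by (intro ex_cong1 conj_cong refl all_cong1 imp_cong) (auto simp: nth permutes_in_image[of _ "{..2}", simplified])
    also have "\<dots> \<longleftrightarrow> (\<exists>\<pi>. \<pi> permutes {..2} \<and> (\<forall>j\<le>2. \<exists>c\<in>k - {0}. A' j * c ^ 4 = inverse m * A (\<pi> j)))"
      using that by (intro ex_cong1 conj_cong refl all_cong1 imp_cong bex_cong) (auto simp: field_simps)
    also have "\<dots> \<longleftrightarrow> (\<exists>\<pi> c. \<pi> permutes {..2} \<and> (\<forall>j\<le>2. c j \<in> k - {0} \<and> A' j * c j ^ 4 = inverse m * A (\<pi> j)))"
      by metis
    finally show ?thesis .
  qed
  then have "(\<exists>m\<in>k - {0}. congruent_mod_fourth_powers k [a, b, 1] [m * a', m * b', m]) \<longleftrightarrow>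
    (\<exists>m\<in>k - {0}. \<exists>\<pi> c. \<pi> permutes {..2} \<and> (\<forall>j\<le>2. c j \<in> k - {0} \<and> A' j * c j ^ 4 = inverse m * A (\<pi> j)))"
    by (rule bex_cong[OF refl])
  also have "\<dots> \<longleftrightarrow> (\<exists>\<pi> c \<mu>. \<pi> permutes {..2} \<and> \<mu> \<in> k - {0} \<and> (\<forall>j\<le>2. c j \<in> k - {0} \<and> A' j * c j ^ 4 = \<mu> * A (\<pi> j)))"
    (is "?l \<longleftrightarrow> ?r")
  proof
    assume ?l then show ?r using inv by metis
  next
    assume ?r
    then obtain \<pi> c \<mu> where *: "\<pi> permutes {..2}" "\<mu> \<in> k - {0}"
      "\<forall>j\<le>2. c j \<in> k - {0} \<and> A' j * c j ^ 4 = \<mu> * A (\<pi> j)" by blast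
    then show ?l using inv[OF *(2)]
      by (intro bexI[of _ "inverse \<mu>"] exI[of _ \<pi>] exI[of _ c]) simp_all
  qed
  also have "\<dots> \<longleftrightarrow> isomorphic_over k 2 (quartic A) 2 (quartic A')"
    using isomorphic_over_quartic_iff[of A A' k, OF A A' k Ak] by simp
  finally show ?thesis unfolding diagonal_quartic_eq A_def A'_def by simp
qed



section \<open>Diagonal twists are diagonal quartics\<close>

lemma morphism_over_diag_map_comp:
  assumes \<phi>: "morphism_over UNIV n V 2 W \<phi>" and m: "\<And>j. j \<le> 2 \<Longrightarrow> m j \<noteq> 0" and im: "diag_map m ` W \<subseteq> W'"
  shows "morphism_over UNIV n V 2 W' (\<lambda>P. diag_map m (\<phi> P))"
  unfolding morphism_over_def
proof (intro conjI ballI)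
  show "(\<lambda>P. diag_map m (\<phi> P)) ` V \<subseteq> W'" using \<phi> im by (auto simp: morphism_over_def)
  fix P assume P: "P \<in> V"
  obtain d F where F: "\<And>j. j \<le> 2 \<Longrightarrow> F j \<in> forms UNIV n d"
    and nz: "\<And>v. v \<in> P \<Longrightarrow> \<exists>j\<le>2. mpol_eval (F j) v \<noteq> 0"
    and rep: "\<And>Q v j. Q \<in> V \<Longrightarrow> v \<in> Q \<Longrightarrow> j \<le> 2 \<Longrightarrow> mpol_eval (F j) v \<noteq> 0 \<Longrightarrow>
       \<phi> Q = proj_point (\<lambda>j. if j \<le> 2 then mpol_eval (F j) v else 0)"
    by (rule morphism_over_rep[OF \<phi> P]) (assumption | blast)+
  define G where "G j = Const (m j) * F j" for j
  have ev: "mpol_eval (G j) v = m j * mpol_eval (F j) v" for j v by (simp add: G_def mpol_eval_mult)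
  have "\<forall>j\<le>2. G j \<in> forms UNIV n (0 + d)"
    unfolding G_def by (intro allI impI forms_mult[OF is_subfield_UNIV forms_Const[OF is_subfield_UNIV UNIV_I]] F)
  moreover have "\<forall>v\<in>P. \<exists>j\<le>2. mpol_eval (G j) v \<noteq> 0" using nz m unfolding ev by (metis mult_eq_0_iff)
  moreover have "diag_map m (\<phi> Q) = proj_point (\<lambda>j. if j \<le> 2 then mpol_eval (G j) v else 0)"
    if "Q \<in> V" "v \<in> Q" "j \<le> 2" "mpol_eval (G j) v \<noteq> 0" for Q v j
  proof -
    have "mpol_eval (F j) v \<noteq> 0" using that(4) by (auto simp: ev)
    from rep[OF that(1-3) this] have "diag_map m (\<phi> Q) = proj_point (\<lambda>j. m j * (if j \<le> 2 then mpol_eval (F j) v else 0))"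
      by (simp add: diag_map_proj_point)
    also have "(\<lambda>j. m j * (if j \<le> 2 then mpol_eval (F j) v else 0)) = (\<lambda>j. if j \<le> 2 then mpol_eval (G j) v else 0)"
      by (auto simp: ev)
    finally show ?thesis .
  qed
  then have "\<forall>Q\<in>V. \<forall>v\<in>Q. (\<exists>j\<le>2. mpol_eval (G j) v \<noteq> 0) \<longrightarrow>
           diag_map m (\<phi> Q) = proj_point (\<lambda>j. if j \<le> 2 then mpol_eval (G j) v else 0)" by blast
  ultimately show "\<exists>d F. (\<forall>j\<le>2. F j \<in> forms UNIV n d) \<and> (\<forall>v\<in>P. \<exists>j\<le>2. mpol_eval (F j) v \<noteq> 0) \<and>
        (\<forall>Q\<in>V. \<forall>v\<in>Q. (\<exists>j\<le>2. mpol_eval (F j) v \<noteq> 0) \<longrightarrow>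
           diag_map m (\<phi> Q) = proj_point (\<lambda>j. if j \<le> 2 then mpol_eval (F j) v else 0))"
    by (intro exI conjI)
qed

lemma morphism_over_comp_diag_map:
  assumes \<phi>: "morphism_over UNIV 2 W n V \<phi>" and im: "diag_map m ` W' \<subseteq> W"
  shows "morphism_over UNIV 2 W' n V (\<lambda>Q. \<phi> (diag_map m Q))"
  unfolding morphism_over_def
proof (intro conjI ballI)
  show "(\<lambda>Q. \<phi> (diag_map m Q)) ` W' \<subseteq> V" using \<phi> im by (auto simp: morphism_over_def)
  fix P assume P: "P \<in> W'"
  then have mP: "diag_map m P \<in> W" using im by blast
  obtain d F where F: "\<And>j. j \<le> n \<Longrightarrow> F j \<in> forms UNIV 2 d"
    and nz: "\<And>v. v \<in> diag_map m P \<Longrightarrow> \<exists>j\<le>n. mpol_eval (F j) v \<noteq> 0"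
    and rep: "\<And>Q v j. Q \<in> W \<Longrightarrow> v \<in> Q \<Longrightarrow> j \<le> n \<Longrightarrow> mpol_eval (F j) v \<noteq> 0 \<Longrightarrow>
       \<phi> Q = proj_point (\<lambda>j. if j \<le> n then mpol_eval (F j) v else 0)"
    by (rule morphism_over_rep[OF \<phi> mP]) (assumption | blast)+
  define G where "G j = scale_vars m (F j)" for j
  have ev: "mpol_eval (G j) v = mpol_eval (F j) (\<lambda>i. m i * v i)" for j v by (simp add: G_def mpol_eval_scale_vars)
  have mem: "(\<lambda>i. m i * v i) \<in> diag_map m Q" if "v \<in> Q" for v Q using that by (auto simp: diag_map_def)
  have "\<forall>j\<le>n. G j \<in> forms UNIV 2 d" unfolding G_def using forms_UNIV_scale F by blast
  moreover have "\<forall>v\<in>P. \<exists>j\<le>n. mpol_eval (G j) v \<noteq> 0" using nz mem unfolding ev by blast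
  moreover have "\<forall>Q\<in>W'. \<forall>v\<in>Q. (\<exists>j\<le>n. mpol_eval (G j) v \<noteq> 0) \<longrightarrow>
           \<phi> (diag_map m Q) = proj_point (\<lambda>j. if j \<le> n then mpol_eval (G j) v else 0)"
    using rep mem im unfolding ev by blast
  ultimately show "\<exists>d F. (\<forall>j\<le>n. F j \<in> forms UNIV 2 d) \<and> (\<forall>v\<in>P. \<exists>j\<le>n. mpol_eval (F j) v \<noteq> 0) \<and>
        (\<forall>Q\<in>W'. \<forall>v\<in>Q. (\<exists>j\<le>n. mpol_eval (F j) v \<noteq> 0) \<longrightarrow>
           \<phi> (diag_map m Q) = proj_point (\<lambda>j. if j \<le> n then mpol_eval (F j) v else 0))"
    by (intro exI conjI)
qed

lemma proj_point_ratios: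
  assumes "proj_point (\<lambda>i. a i * w i) = proj_point (\<lambda>i. b i * w i)" "\<And>i. i \<le> 2 \<Longrightarrow> w i \<noteq> 0" "b 2 \<noteq> (0::'a::field)" "i \<le> (2::nat)"
  shows "a i / a 2 = b i / b 2"
proof -
  obtain t where t: "t \<noteq> 0" "(\<lambda>i. a i * w i) = (\<lambda>i. t * (b i * w i))" using assms(1) by (auto simp: proj_point_eq_iff)
  have "a l = t * b l" if "l \<le> 2" for l using fun_cong[OF t(2), of l] assms(2)[OF that] by simp
  then show ?thesis using t(1) assms(3,4) by simp
qed

text \<open>By Hilbert's Theorem 90, the cocycle is the coboundary of a diagonal matrix \<open>diag(\<alpha>, \<beta>, 1)\<close>. It
  is continuous because \<open>\<xi>\<^sub>\<sigma>\<close> is determined by its effect on a single point of the Fermat quartic,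
  and its entries are fourth roots of unity, so that \<open>\<alpha>\<^sup>4\<close> and \<open>\<beta>\<^sup>4\<close> are in \<open>k\<close>. Composing \<open>\<phi>\<close> with the
  inverse of the matrix gives an equivariant isomorphism, which descends to \<open>k\<close>.\<close>

theorem diagonal_twist_isomorphic_diagonal_quartic:
  fixes k :: "'a::{alg_closed_field, field_char_0} set"
  assumes k: "is_subfield k" "algebraic_extension_of k" and twist: "is_diagonal_twist k n V"
  shows "\<exists>a\<in>k - {0}. \<exists>b\<in>k - {0}. isomorphic_over k n V 2 (diagonal_quartic a b)"
proof -
  let ?G = "galois_group k"
  define C where "C = quartic (\<lambda>_::nat. 1::'a)"
  obtain \<phi> where iso: "isomorphism_over UNIV n V 2 C \<phi>"
    and diag: "\<And>\<sigma>. \<sigma> \<in> ?G \<Longrightarrow> given_by_diagonal_matrix 2 C (twist_cocycle V \<phi> \<sigma>)"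
    using twist unfolding is_diagonal_twist_def fermat_quartic_eq C_def by blast
  have bij: "bij_betw \<phi> V C" and mor: "morphism_over UNIV n V 2 C \<phi>"
    and mor': "morphism_over UNIV 2 C n V (inv_into V \<phi>)" using iso by (auto simp: isomorphism_over_def)
  have cl: "proj_closed k n V"
    using twist unfolding is_diagonal_twist_def is_twist_def smooth_projective_curve_def by blast
  have Vn: "V \<subseteq> proj_space n" by (rule proj_closed_proj_space[OF cl])
  have C2: "C \<subseteq> proj_space 2" unfolding C_def by (rule quartic_subset)
  have VG: "galois_point \<sigma> P \<in> V" if "\<sigma> \<in> ?G" "P \<in> V" for \<sigma> P by (rule proj_closed_galois[OF cl that])
  have one: "(1::'a) \<in> k" by (rule subfield_closed(2)[OF k(1)])
  have CG: "galois_point \<sigma> P \<in> C" if "\<sigma> \<in> ?G" "P \<in> C" for \<sigma> P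
    using galois_point_quartic[OF that(1) k(1) one] that(2) unfolding C_def by blast
  have \<phi>C: "\<phi> P \<in> C" if "P \<in> V" for P using bij that by (auto simp: bij_betw_def)
  have "\<forall>\<sigma>. \<exists>c. \<sigma> \<in> ?G \<longrightarrow> (\<forall>i\<le>2. c i \<noteq> 0) \<and> (\<forall>P\<in>C. twist_cocycle V \<phi> \<sigma> P = diag_map c P)"
    using diag unfolding given_by_diagonal_matrix_def diag_map_def by blast
  then obtain c where c0: "\<And>\<sigma> i. \<sigma> \<in> ?G \<Longrightarrow> i \<le> 2 \<Longrightarrow> c \<sigma> i \<noteq> 0"
    and c: "\<And>\<sigma> P. \<sigma> \<in> ?G \<Longrightarrow> P \<in> C \<Longrightarrow> twist_cocycle V \<phi> \<sigma> P = diag_map (c \<sigma>) P" by metis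
  have conj: "\<phi> (galois_point \<sigma> R) = diag_map (c \<sigma>) (galois_point \<sigma> (\<phi> R))" if "\<sigma> \<in> ?G" "R \<in> V" for \<sigma> R
    using twist_cocycle_eq[OF that(1) bij VG that(2)] c[OF that(1) CG[OF that(1) \<phi>C[OF that(2)]]] by simp
  \<comment> \<open>A point of the Fermat quartic with nonzero coordinates, and the corresponding point of the twist.\<close>
  obtain q1 :: 'a where q1: "q1 ^ 4 = - 2" using nth_root_exists[of 4 "- 2 :: 'a"] by auto
  define q where "q = vec3 1 q1 (1::'a)"
  have q0: "q i \<noteq> 0" if "i \<le> 2" for i using le_2_cases[OF that] q1 by (auto simp: q_def)
  have "on_cone (\<lambda>_. 1) q" using q1 by (simp add: on_cone_iff q_def)
  then have "proj_point q \<in> C" unfolding C_def by (rule quartic_memI) (simp add: q_def)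
  then have "proj_point q \<in> \<phi> ` V" using bij by (simp add: bij_betw_def)
  then obtain R where R: "R \<in> V" "\<phi> R = proj_point q" by auto
  obtain r where r: "r \<in> R" using proj_space_nonempty[OF subsetD[OF Vn R(1)]] by blast
  note rd = proj_spaceD[OF subsetD[OF Vn R(1)] r]
  have conj_R: "\<phi> (galois_point \<sigma> R) = proj_point (\<lambda>i. c \<sigma> i * (\<sigma> \<circ> q) i)" if "\<sigma> \<in> ?G" for \<sigma>
    using conj[OF that R(1)] by (simp add: R(2) galois_point_proj_point[OF that] diag_map_proj_point)
  have \<sigma>q: "(\<sigma> \<circ> q) i \<noteq> 0" if "\<sigma> \<in> ?G" "i \<le> 2" for \<sigma> i
    using q0[OF that(2)] galois_group_props(7)[OF that(1)] by simp
  define T where "T = insert q1 (r ` {..n})"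
  have finT: "finite T" by (simp add: T_def)
  define \<gamma> where "\<gamma> i \<sigma> = c \<sigma> i / c \<sigma> 2" for i \<sigma>
  have \<gamma>0: "\<gamma> i \<sigma> \<noteq> 0" if "i \<le> 2" "\<sigma> \<in> ?G" for i \<sigma> using c0[OF that(2,1)] c0[OF that(2), of 2] by (simp add: \<gamma>_def)
  have cont: "\<gamma> i \<sigma> = \<gamma> i \<tau>" if i: "i \<le> 2" and \<sigma>\<tau>: "\<sigma> \<in> ?G" "\<tau> \<in> ?G" "agree_on T \<sigma> \<tau>" for i \<sigma> \<tau>
  proof -
    have "\<sigma> (r j) = \<tau> (r j)" for j
      using \<sigma>\<tau>(3) rd(3)[of j] galois_group_props(5)[OF \<sigma>\<tau>(1)] galois_group_props(5)[OF \<sigma>\<tau>(2)]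
      by (cases "j \<le> n") (auto simp: agree_on_def T_def)
    then have "\<sigma> \<circ> r = \<tau> \<circ> r" by auto
    then have "galois_point \<sigma> R = galois_point \<tau> R"
      using rd(1) galois_point_proj_point[OF \<sigma>\<tau>(1)] galois_point_proj_point[OF \<sigma>\<tau>(2)] by metis
    moreover have "\<sigma> \<circ> q = \<tau> \<circ> q"
    proof
      fix j
      have "\<sigma> q1 = \<tau> q1" using \<sigma>\<tau>(3) by (simp add: agree_on_def T_def)
      then show "(\<sigma> \<circ> q) j = (\<tau> \<circ> q) j"
        using galois_group_props(5,6)[OF \<sigma>\<tau>(1)] galois_group_props(5,6)[OF \<sigma>\<tau>(2)] by (simp add: q_def vec3_def)
    qed
    ultimately have "proj_point (\<lambda>i. c \<sigma> i * (\<sigma> \<circ> q) i) = proj_point (\<lambda>i. c \<tau> i * (\<sigma> \<circ> q) i)"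
      using conj_R[OF \<sigma>\<tau>(1)] conj_R[OF \<sigma>\<tau>(2)] by simp
    then show ?thesis unfolding \<gamma>_def
      by (rule proj_point_ratios[OF _ \<sigma>q[OF \<sigma>\<tau>(1)] c0[OF \<sigma>\<tau>(2)] i]) auto
  qed
  have cocycle: "\<gamma> i (\<sigma> \<circ> \<tau>) = \<gamma> i \<sigma> * \<sigma> (\<gamma> i \<tau>)" if i: "i \<le> 2" and \<sigma>\<tau>: "\<sigma> \<in> ?G" "\<tau> \<in> ?G" for i \<sigma> \<tau>
  proof -
    note s = galois_group_props[OF \<sigma>\<tau>(1)]
    have st: "\<sigma> \<circ> \<tau> \<in> ?G" by (rule galois_group_comp[OF \<sigma>\<tau>])
    have "\<phi> (galois_point (\<sigma> \<circ> \<tau>) R) = diag_map (c \<sigma>) (galois_point \<sigma> (\<phi> (galois_point \<tau> R)))"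
      using conj[OF \<sigma>\<tau>(1) VG[OF \<sigma>\<tau>(2) R(1)]] by (simp add: galois_point_comp)
    also have "\<dots> = proj_point (\<lambda>i. (c \<sigma> i * \<sigma> (c \<tau> i)) * (\<sigma> \<circ> \<tau> \<circ> q) i)"
      by (simp add: conj_R[OF \<sigma>\<tau>(2)] galois_point_proj_point[OF \<sigma>\<tau>(1)] diag_map_proj_point comp_def s mult.assoc)
    finally have "proj_point (\<lambda>i. c (\<sigma> \<circ> \<tau>) i * (\<sigma> \<circ> \<tau> \<circ> q) i) = proj_point (\<lambda>i. (c \<sigma> i * \<sigma> (c \<tau> i)) * (\<sigma> \<circ> \<tau> \<circ> q) i)"
      unfolding conj_R[OF st] .
    then have "c (\<sigma> \<circ> \<tau>) i / c (\<sigma> \<circ> \<tau>) 2 = (c \<sigma> i * \<sigma> (c \<tau> i)) / (c \<sigma> 2 * \<sigma> (c \<tau> 2))"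
      by (rule proj_point_ratios[OF _ \<sigma>q[OF st] _ i]) (use c0[OF \<sigma>\<tau>(1)] c0[OF \<sigma>\<tau>(2)] s(7) in auto)
    then show ?thesis by (simp add: \<gamma>_def s)
  qed
  have \<gamma>4: "\<gamma> i \<sigma> ^ 4 = 1" if i: "i \<le> 2" and \<sigma>: "\<sigma> \<in> ?G" for i \<sigma>
  proof -
    have mem: "on_cone (\<lambda>_. 1) (\<lambda>i. c \<sigma> i * v i)" if v: "on_cone (\<lambda>_. 1) v" "\<And>i. i > 2 \<Longrightarrow> v i = 0" for v
    proof -
      have P: "proj_point v \<in> C" unfolding C_def by (rule quartic_memI[OF v])
      have "galois_point (inv \<sigma>) (proj_point v) \<in> \<phi> ` V"
        using CG[OF galois_group_inv(1)[OF \<sigma>] P] bij by (simp add: bij_betw_def)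
      then obtain S where S: "S \<in> V" "\<phi> S = galois_point (inv \<sigma>) (proj_point v)" by auto
      have "\<phi> (galois_point \<sigma> S) = proj_point (\<lambda>i. c \<sigma> i * v i)"
        using conj[OF \<sigma> S(1)] by (simp add: S(2) galois_point_inv[OF \<sigma>] diag_map_proj_point)
      then have "proj_point (\<lambda>i. c \<sigma> i * v i) \<in> quartic (\<lambda>_. 1)" using \<phi>C[OF VG[OF \<sigma> S(1)]] by (simp add: C_def)
      then show ?thesis using quartic_memD proj_point_self by blast
    qed
    obtain \<zeta> :: 'a where \<zeta>: "\<zeta> ^ 4 = - 1" using nth_root_exists[of 4 "- 1 :: 'a"] by auto
    have "on_cone (\<lambda>_. 1) (vec3 \<zeta> 0 1)" "on_cone (\<lambda>_. 1) (vec3 0 \<zeta> 1)" using \<zeta> by (simp_all add: on_cone_iff)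
    then have "c \<sigma> 0 ^ 4 = c \<sigma> 2 ^ 4" "c \<sigma> 1 ^ 4 = c \<sigma> 2 ^ 4"
      using mem[of "vec3 \<zeta> 0 1"] mem[of "vec3 0 \<zeta> 1"] \<zeta> by (simp_all add: on_cone_iff power_mult_distrib)
    then have "c \<sigma> i ^ 4 = c \<sigma> 2 ^ 4" using le_2_cases[OF i] by auto
    then show ?thesis using c0[OF \<sigma>, of 2] by (simp add: \<gamma>_def power_divide)
  qed
  have hilbert: "\<exists>\<alpha>. \<alpha> \<noteq> 0 \<and> (\<forall>\<sigma>\<in>?G. \<gamma> i \<sigma> * \<sigma> \<alpha> = \<alpha>)" if i: "i \<le> 2" for i
    by (rule hilbert_90[OF k(2) finT cont[OF i] cocycle[OF i] \<gamma>0[OF i]])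
  have root_k: "\<alpha> ^ 4 \<in> k" if i: "i \<le> 2" and \<alpha>: "\<forall>\<sigma>\<in>?G. \<gamma> i \<sigma> * \<sigma> \<alpha> = \<alpha>" for i \<alpha>
  proof (rule fixed_field_of_galois_group[OF k])
    fix \<sigma> assume \<sigma>: "\<sigma> \<in> ?G"
    have "\<alpha> ^ 4 = (\<gamma> i \<sigma> * \<sigma> \<alpha>) ^ 4" using \<alpha> \<sigma> by simp
    also have "\<dots> = \<sigma> (\<alpha> ^ 4)" using \<gamma>4[OF i \<sigma>] galois_group_props(10)[OF \<sigma>] by (simp add: power_mult_distrib)
    finally show "\<sigma> (\<alpha> ^ 4) = \<alpha> ^ 4" by simp
  qed
  obtain \<alpha> where \<alpha>: "\<alpha> \<noteq> 0" "\<forall>\<sigma>\<in>?G. \<gamma> 0 \<sigma> * \<sigma> \<alpha> = \<alpha>" using hilbert[of 0] by auto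
  obtain \<beta> where \<beta>: "\<beta> \<noteq> 0" "\<forall>\<sigma>\<in>?G. \<gamma> 1 \<sigma> * \<sigma> \<beta> = \<beta>" using hilbert[of 1] by auto
  define a b where "a = \<alpha> ^ 4" and "b = \<beta> ^ 4"
  have ab: "a \<in> k - {0}" "b \<in> k - {0}" using root_k[of 0 \<alpha>] root_k[of 1 \<beta>] \<alpha> \<beta> by (auto simp: a_def b_def)
  define A where "A = vec3 a b (1::'a)"
  have Ak: "A i \<in> k" if "i \<le> 2" for i using le_2_cases[OF that] ab one by (auto simp: A_def)
  define m where "m = vec3 \<alpha> \<beta> (1::'a)"
  define m' where "m' i = inverse (m i)" for i
  have m0: "m i \<noteq> 0" if "i \<le> 2" for i using le_2_cases[OF that] \<alpha> \<beta> by (auto simp: m_def)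
  have m'0: "m' i \<noteq> 0" if "i \<le> 2" for i using m0[OF that] by (simp add: m'_def)
  have mm: "m i * m' i = 1" if "i \<le> 2" for i using m0[OF that] by (simp add: m'_def)
  have m4: "1 * m j ^ 4 = A j" if "j \<le> 2" for j using le_2_cases[OF that] by (auto simp: m_def A_def a_def b_def)
  have m'4: "A j * m' j ^ 4 = 1" if "j \<le> 2" for j
    using m4[OF that] mm[OF that] by (metis mult_1 power_mult_distrib power_one)
  have "isomorphism_over UNIV 2 C 2 (quartic A) (diag_map m')" unfolding C_def
    by (rule diag_map_isomorphism[OF is_subfield_UNIV UNIV_I m'0 m'4])
  then have bij': "bij_betw (diag_map m') C (quartic A)" by (simp add: isomorphism_over_def)
  have "isomorphism_over UNIV 2 (quartic A) 2 C (diag_map m)" unfolding C_def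
    by (rule diag_map_isomorphism[OF is_subfield_UNIV UNIV_I m0 m4])
  then have im: "diag_map m ` quartic A \<subseteq> C" by (simp add: isomorphism_over_def morphism_over_def)
  have im': "diag_map m' ` C \<subseteq> quartic A" using bij' by (simp add: bij_betw_def)
  have inv_diag: "diag_map m (diag_map m' P) = P" if P: "P \<in> C" for P
  proof -
    have PS: "P \<in> proj_space 2" using C2 P by blast
    obtain v where v: "v \<in> P" using proj_space_nonempty[OF PS] by blast
    have "(\<lambda>i. m i * (m' i * v i)) = v"
    proof
      fix i show "m i * (m' i * v i) = v i"
        using mm[of i] proj_spaceD(3)[OF PS v, of i] by (cases "i \<le> 2") (simp_all flip: mult.assoc)
    qed
    then show ?thesis using proj_spaceD(1)[OF PS v] by (simp add: diag_map_proj_point)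
  qed
  define \<psi> where "\<psi> P = diag_map m' (\<phi> P)" for P
  have bij\<psi>: "bij_betw \<psi> V (quartic A)"
    using bij_betw_trans[OF bij bij'] by (simp add: \<psi>_def[abs_def] comp_def)
  have equiv: "\<psi> (galois_point \<sigma> P) = galois_point \<sigma> (\<psi> P)" if \<sigma>: "\<sigma> \<in> ?G" and P: "P \<in> V" for \<sigma> P
  proof -
    note s = galois_group_props[OF \<sigma>]
    have PS: "\<phi> P \<in> proj_space 2" using C2 \<phi>C[OF P] by blast
    obtain w where w: "w \<in> \<phi> P" using proj_space_nonempty[OF PS] by blast
    note wd = proj_spaceD[OF PS w]
    have "\<psi> (galois_point \<sigma> P) = proj_point (\<lambda>i. m' i * (c \<sigma> i * \<sigma> (w i)))"
      by (simp add: \<psi>_def conj[OF \<sigma> P] wd(1) galois_point_proj_point[OF \<sigma>] diag_map_proj_point)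
    also have "(\<lambda>i. m' i * (c \<sigma> i * \<sigma> (w i))) = (\<lambda>i. c \<sigma> 2 * \<sigma> (m' i * w i))"
    proof
      fix i
      have \<gamma>m: "\<gamma> i \<sigma> * \<sigma> (m i) = m i" if "i \<le> 2"
        using le_2_cases[OF that] \<alpha>(2) \<beta>(2) \<sigma> c0[OF \<sigma>, of 2] s(6) by (auto simp: m_def \<gamma>_def)
      show "m' i * (c \<sigma> i * \<sigma> (w i)) = c \<sigma> 2 * \<sigma> (m' i * w i)"
      proof (cases "i \<le> 2")
        case True
        have "\<sigma> (m i) * \<sigma> (m' i) = 1" using mm[OF True] s(3,6) by metis
        moreover have "c \<sigma> i * \<sigma> (m i) = c \<sigma> 2 * m i"
          using \<gamma>m[OF True] c0[OF \<sigma>, of 2] by (simp add: \<gamma>_def field_simps)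
        ultimately have "m' i * c \<sigma> i = c \<sigma> 2 * \<sigma> (m' i)" using mm[OF True] by algebra
        then show ?thesis by (simp add: s flip: mult.assoc)
      next
        case False then show ?thesis using wd(3)[of i] s(5) by simp
      qed
    qed
    also have "proj_point (\<lambda>i. c \<sigma> 2 * \<sigma> (m' i * w i)) = galois_point \<sigma> (\<psi> P)"
      using proj_point_scale[of "c \<sigma> 2" "\<lambda>i. \<sigma> (m' i * w i)"] c0[OF \<sigma>, of 2]
      by (simp add: \<psi>_def wd(1) diag_map_proj_point galois_point_proj_point[OF \<sigma>] comp_def)
    finally show ?thesis .
  qed
  have AG: "galois_point \<sigma> Q \<in> quartic A" if "\<sigma> \<in> ?G" "Q \<in> quartic A" for \<sigma> Q
    by (rule galois_point_quartic[OF that(1) k(1) Ak that(2)])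
  have mor_\<psi>: "morphism_over UNIV n V 2 (quartic A) \<psi>"
    unfolding \<psi>_def[abs_def] by (rule morphism_over_diag_map_comp[OF mor m'0 im'])
  have 1: "morphism_over k n V 2 (quartic A) \<psi>"
    by (rule morphism_descent[OF k Vn VG quartic_subset mor_\<psi> equiv])
  have inv\<psi>: "inv_into V \<psi> Q = inv_into V \<phi> (diag_map m Q)" if Q: "Q \<in> quartic A" for Q
  proof -
    have "Q \<in> \<psi> ` V" using Q bij\<psi> by (simp add: bij_betw_def)
    then obtain P where P: "P \<in> V" "Q = \<psi> P" by blast
    have "inv_into V \<psi> Q = P" unfolding P(2) by (rule inv_into_f_f[OF bij_betw_imp_inj_on[OF bij\<psi>] P(1)])
    moreover have "diag_map m Q = \<phi> P" using inv_diag[OF \<phi>C[OF P(1)]] by (simp add: P(2) \<psi>_def)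
    ultimately show ?thesis using inv_into_f_f[OF bij_betw_imp_inj_on[OF bij] P(1)] by simp
  qed
  have "morphism_over UNIV 2 (quartic A) n V (\<lambda>Q. inv_into V \<phi> (diag_map m Q))"
    by (rule morphism_over_comp_diag_map[OF mor' im])
  then have mor_inv: "morphism_over UNIV 2 (quartic A) n V (inv_into V \<psi>)"
    using inv\<psi> unfolding morphism_over_def by (simp cong: image_cong)
  have 2: "morphism_over k 2 (quartic A) n V (inv_into V \<psi>)"
  proof (rule morphism_descent[OF k quartic_subset AG Vn mor_inv])
    fix \<sigma> Q assume \<sigma>: "\<sigma> \<in> ?G" and Q: "Q \<in> quartic A"
    then have "Q \<in> \<psi> ` V" using bij\<psi> by (simp add: bij_betw_def)
    then obtain P where P: "P \<in> V" "Q = \<psi> P" by blast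
    have inj: "inv_into V \<psi> (\<psi> P) = P" if "P \<in> V" for P
      by (rule inv_into_f_f[OF bij_betw_imp_inj_on[OF bij\<psi>] that])
    show "inv_into V \<psi> (galois_point \<sigma> Q) = galois_point \<sigma> (inv_into V \<psi> Q)"
      unfolding P(2) equiv[OF \<sigma> P(1), symmetric] inj[OF P(1)] by (rule inj[OF VG[OF \<sigma> P(1)]])
  qed
  have "isomorphic_over k n V 2 (diagonal_quartic a b)"
    unfolding isomorphic_over_def isomorphism_over_def diagonal_quartic_eq A_def[symmetric]
    using bij\<psi> 1 2 by blast
  then show ?thesis using ab by blast
qed

theorem theorem4p1:
  fixes k :: "'a::{alg_closed_field, field_char_0} set"
  assumes "number_field k" and "algebraic_extension_of k"
  shows
    "(\<forall>n C'. is_diagonal_twist k n C' \<longrightarrow>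
        (\<exists>a\<in>k - {0}. \<exists>b\<in>k - {0}. isomorphic_over k n C' 2 (diagonal_quartic a b))) \<and>
     (\<forall>a\<in>k - {0}. \<forall>b\<in>k - {0}.
        is_diagonal_twist k 2 (diagonal_quartic a b) \<and>
        (\<forall>\<iota> \<alpha> \<beta>. \<iota>\<^sup>2 = -1 \<and> \<alpha> ^ 4 = a \<and> \<beta> ^ 4 = b \<longrightarrow>
           is_field_of_definition k 2 (diagonal_quartic a b) 2 fermat_quartic
             (field_adjoin k {\<iota>, \<alpha>, \<beta>}))) \<and>
     (\<forall>a\<in>k - {0}. \<forall>b\<in>k - {0}. \<forall>a'\<in>k - {0}. \<forall>b'\<in>k - {0}.
        isomorphic_over k 2 (diagonal_quartic a b) 2 (diagonal_quartic a' b') \<longleftrightarrow>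
        (\<exists>m\<in>k - {0}. congruent_mod_fourth_powers k [a, b, 1] [m * a', m * b', m]))"
proof -
  have k: "is_subfield k" using assms(1) by (simp add: number_field_def)
  have twists: "\<forall>n C'. is_diagonal_twist k n C' \<longrightarrow>
      (\<exists>a\<in>k - {0}. \<exists>b\<in>k - {0}. isomorphic_over k n C' 2 (diagonal_quartic a b))"
    using diagonal_twist_isomorphic_diagonal_quartic[OF k assms(2)] by blast
  have converse: "\<forall>a\<in>k - {0}. \<forall>b\<in>k - {0}.
      is_diagonal_twist k 2 (diagonal_quartic a b) \<and>
      (\<forall>\<iota> \<alpha> \<beta>. \<iota>\<^sup>2 = -1 \<and> \<alpha> ^ 4 = a \<and> \<beta> ^ 4 = b \<longrightarrow>
         is_field_of_definition k 2 (diagonal_quartic a b) 2 fermat_quartic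
           (field_adjoin k {\<iota>, \<alpha>, \<beta>}))"
    using diagonal_quartic_is_diagonal_twist[OF k] field_of_definition_diagonal_quartic[OF k assms(2)]
    by blast
  have equivalence: "\<forall>a\<in>k - {0}. \<forall>b\<in>k - {0}. \<forall>a'\<in>k - {0}. \<forall>b'\<in>k - {0}.
      isomorphic_over k 2 (diagonal_quartic a b) 2 (diagonal_quartic a' b') \<longleftrightarrow>
      (\<exists>m\<in>k - {0}. congruent_mod_fourth_powers k [a, b, 1] [m * a', m * b', m])"
    by (intro ballI diagonal_quartics_isomorphic_iff[OF k assms(2)])
  show ?thesis by (rule conjI[OF twists conjI[OF converse equivalence]])
qed

end
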